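(* Let $n$ be a positive integer, $0<q<p<\infty$, let $\mathbf{u}=(u_0,u_1,\dots,u_n)$ with each $u_k\in H(\mathbb{D})$, and let $\mu$ be a positive Borel measure on $\mathbb{D}$. The following are equivalent: (a) $\mu$ is a $(\mathbf{u},p,q)$-Sobolev Carleson measure; (b) $\mu$ is a vanishing $(\mathbf{u},p,q)$-Sobolev Carleson measure; (c) for each $0\leq k\leq n$, $|u_k|^q\,d\mu$ is a $(k,p,q)$-Carleson measure; (d) for each $0\leq k\leq n$, $|u_k|^q\,d\mu$ is a vanishing $(k,p,q)$-Carleson measure.
   Context: $\mathbb{D}$ is the open unit disc, $H(\mathbb{D})$ the space of analytic functions on $\mathbb{D}$, $dA=\frac{dx\,dy}{\pi}$ normalized area measure. For $0<p<\infty$, the Bergman space $A^p$ consists of $f\in H(\mathbb{D})$ with $\|f\|_p^p=\int_{\mathbb{D}}|f|^p\,dA<\infty$. For an integer $k\geq0$, a positive Borel measure $\nu$ on $\mathbb{D}$ is a $(k,p,q)$-Carleson measure if there is $C>0$ with $\int_{\mathbb{D}}|f^{(k)}|^q\,d\nu\leq C\|f\|_p^q$ for all $f\in A^p$; it is a vanishing $(k,p,q)$-Carleson measure if $\int_{\mathbb{D}}|f_j^{(k)}|^q\,d\nu\to0$ whenever $\{f_j\}$ is a bounded sequence in $A^p$ converging to $0$ uniformly on compact subsets of $\mathbb{D}$. Writing $\langle\mathbf{u},\mathcal{D}f\rangle=u_0f+u_1f'+\cdots+u_nf^{(n)}$, $\mu$ is a $(\mathbf{u},p,q)$-Sobolev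 Carleson measure if there is $C>0$ with $\int_{\mathbb{D}}|\langle\mathbf{u}(z),\mathcal{D}f(z)\rangle|^q\,d\mu(z)\leq C\|f\|_p^q$ for all $f\in A^p$, and a vanishing $(\mathbf{u},p,q)$-Sobolev Carleson measure if $\int_{\mathbb{D}}|\langle\mathbf{u},\mathcal{D}f_j\rangle|^q\,d\mu\to0$ whenever $\{f_j\}$ is bounded in $A^p$ and converges to $0$ uniformly on compact subsets of $\mathbb{D}$. *)

theory Defs
  imports "HOL-Analysis.Analysis"
begin

abbreviation disc :: "complex set" where "disc \<equiv> ball 0 1"

text \<open>dA = dx dy / pi, normalized area measure on the disc;
  the p-th power of the Bergman norm, as an extended nonnegative real.\<close>
definition bergman_pnorm_pow :: "real \<Rightarrow> (complex \<Rightarrow> complex) \<Rightarrow> ennreal" where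
  "bergman_pnorm_pow p f =
     (\<integral>\<^sup>+ z \<in> disc. ennreal (norm (f z) powr p) \<partial>lborel) / ennreal pi"

definition bergman_space :: "real \<Rightarrow> (complex \<Rightarrow> complex) set" where
  "bergman_space p = {f. f holomorphic_on disc \<and> bergman_pnorm_pow p f < \<infinity>}"

definition bergman_norm :: "real \<Rightarrow> (complex \<Rightarrow> complex) \<Rightarrow> real" where
  "bergman_norm p f = (enn2real (bergman_pnorm_pow p f)) powr (1 / p)"

definition disc_borel_measure :: "complex measure \<Rightarrow> bool" where
  "disc_borel_measure \<mu> \<longleftrightarrow> sets \<mu> = sets (restrict_space borel disc)"

definition bdd_loc_unif_null :: "real \<Rightarrow> (nat \<Rightarrow> complex \<Rightarrow> complex) \<Rightarrow> bool" where
  "bdd_loc_unif_null p F \<longleftrightarrow>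
     (\<forall>j. F j \<in> bergman_space p) \<and>
     (\<exists>M. \<forall>j. bergman_norm p (F j) \<le> M) \<and>
     (\<forall>K. compact K \<and> K \<subseteq> disc \<longrightarrow> uniform_limit K F (\<lambda>_. 0) sequentially)"

definition carleson :: "nat \<Rightarrow> real \<Rightarrow> real \<Rightarrow> complex measure \<Rightarrow> bool" where
  "carleson k p q \<nu> \<longleftrightarrow>
     (\<exists>C>0. \<forall>f \<in> bergman_space p.
        (\<integral>\<^sup>+ z. ennreal (norm ((deriv ^^ k) f z) powr q) \<partial>\<nu>)
          \<le> ennreal (C * bergman_norm p f powr q))"

definition vanishing_carleson :: "nat \<Rightarrow> real \<Rightarrow> real \<Rightarrow> complex measure \<Rightarrow> bool" where
  "vanishing_carleson k p q \<nu> \<longleftrightarrow>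
     (\<forall>F. bdd_loc_unif_null p F \<longrightarrow>
        ((\<lambda>j. \<integral>\<^sup>+ z. ennreal (norm ((deriv ^^ k) (F j) z) powr q) \<partial>\<nu>) \<longlongrightarrow> 0) sequentially)"

definition sobolev_op :: "nat \<Rightarrow> (nat \<Rightarrow> complex \<Rightarrow> complex) \<Rightarrow> (complex \<Rightarrow> complex) \<Rightarrow> complex \<Rightarrow> complex" where
  "sobolev_op n u f z = (\<Sum>k\<le>n. u k z * (deriv ^^ k) f z)"

definition sobolev_carleson ::
  "nat \<Rightarrow> (nat \<Rightarrow> complex \<Rightarrow> complex) \<Rightarrow> real \<Rightarrow> real \<Rightarrow> complex measure \<Rightarrow> bool" where
  "sobolev_carleson n u p q \<mu> \<longleftrightarrow>
     (\<exists>C>0. \<forall>f \<in> bergman_space p.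
        (\<integral>\<^sup>+ z. ennreal (norm (sobolev_op n u f z) powr q) \<partial>\<mu>)
          \<le> ennreal (C * bergman_norm p f powr q))"

definition vanishing_sobolev_carleson ::
  "nat \<Rightarrow> (nat \<Rightarrow> complex \<Rightarrow> complex) \<Rightarrow> real \<Rightarrow> real \<Rightarrow> complex measure \<Rightarrow> bool" where
  "vanishing_sobolev_carleson n u p q \<mu> \<longleftrightarrow>
     (\<forall>F. bdd_loc_unif_null p F \<longrightarrow>
        ((\<lambda>j. \<integral>\<^sup>+ z. ennreal (norm (sobolev_op n u (F j) z) powr q) \<partial>\<mu>) \<longlongrightarrow> 0) sequentially)"

definition weighted :: "complex measure \<Rightarrow> (complex \<Rightarrow> complex) \<Rightarrow> real \<Rightarrow> complex measure" where
  "weighted \<mu> w q = density \<mu> (\<lambda>z. ennreal (norm (w z) powr q))"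

end

theory Submission
  imports Defs "HOL-Complex_Analysis.Complex_Analysis" "HOL-Real_Asymp.Real_Asymp"
begin

text \<open>
  The cycle of implications is (a) to (c) and (d), (c) to (a), (d) to (b), (b) to (a); all but the first
  are soft. Fix a lattice of points a in the disc whose Whitney balls B(a) cover the disc with bounded
  overlap. Testing (a) on random sums of the functions
  (1 - |a|) powr (m - 2/p) * (P a - z) ^ (- m), with pole P a just outside the disc, bounds sums of
  integrals of |<u, D g>|^q over the B(a). Taking n + 1 consecutive exponents m, the vectors <u, D g>
  determine all u_k near a, because the Pochhammer polynomials in m of degree at most n form a basis.
  By duality the masses of |u_k|^q dmu on B(a), scaled by (1 - |a|) powr (- k q - 2 q / p), are in
  the sequence space l^s with s = p / (p - q) (Luecking's condition). Conversely the local estimate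
  for derivatives and Young's inequality turn that condition into boundedness, and into vanishing by
  dominated convergence over the lattice.
\<close>

section \<open>Integrals over the plane and the disc\<close>

text \<open>Since q < p, a single test function bounds the lattice masses only uniformly;
  summability requires functions that charge all lattice points at once. In <u, D f> such a function
  interferes with itself twice: between different points, and between different orders k at one
  point. Signs remove the first interference: they leave the norm bound unchanged, and averaging
  |<u, D f>|^q over them dominates each single term. As few balls meet at a point, this crude lower
  bound suffices in place of a square function. Linear algebra removes the second: for the exponent
  m, order k contributes u_k (P - z)^(-k) with the coefficient m (m + 1) ... (m + k - 1), so the
  unknowns are the same for all m; hence pure powers of P - z as test functions. Scaling back to u_k
  costs |P - z|^k, harmless on B(a) because P lies at distance 2 (1 - |a|) from a. Constants are
  immaterial, so for p >= 1 Hoelder's inequality is replaced by the splitting x <= T + x^p T^(1 - p)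
  with a free threshold T; for p <= 1 subadditivity of x^p takes its place.\<close>

lemma measurable_Complex [measurable]:
  "(\<lambda>(x, y). Complex x y) \<in> borel_measurable (borel \<Otimes>\<^sub>M borel)"
proof -
  have "(\<lambda>z::real\<times>real. complex_of_real (fst z) + \<i> * complex_of_real (snd z)) \<in> borel_measurable (borel \<Otimes>\<^sub>M borel)"
    by measurable
  then show ?thesis
    by (simp add: case_prod_beta Complex_eq)
qed

text \<open>A measure that gives every box the product of its side lengths is \<open>lborel\<close>.
  The product form opens plane integrals to Tonelli in the two coordinates.\<close>

lemma lborel_complex:
  "(lborel :: complex measure) = distr (lborel \<Otimes>\<^sub>M lborel) borel (\<lambda>(x, y). Complex x y)"
proof (rule lborel_eqI)
  fix l u :: complex
  assume le: "\<And>b. b \<in> Basis \<Longrightarrow> l \<bullet> b \<le> u \<bullet> b"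
  have vi: "(\<lambda>(x, y). Complex x y) -` box l u \<inter> space (lborel \<Otimes>\<^sub>M lborel)
     = {Re l<..<Re u} \<times> {Im l<..<Im u}"
    by (auto simp: box_def Basis_complex_def space_pair_measure)
  have "emeasure (distr (lborel \<Otimes>\<^sub>M lborel) borel (\<lambda>(x, y). Complex x y)) (box l u)
     = emeasure (lborel \<Otimes>\<^sub>M lborel) ({Re l<..<Re u} \<times> {Im l<..<Im u})"
    by (subst emeasure_distr) (use vi in auto)
  also have "\<dots> = ennreal (\<Prod>b\<in>Basis. (u - l) \<bullet> b)"
    using le[of 1] le[of \<i>]
    by (subst lborel.emeasure_pair_measure_Times)
       (auto simp: Basis_complex_def complex_eq_iff ennreal_mult)
  finally show "emeasure (distr (lborel \<Otimes>\<^sub>M lborel) borel (\<lambda>(x, y). Complex x y)) (box l u)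
      = ennreal (\<Prod>b\<in>Basis. (u - l) \<bullet> b)" .
qed simp

lemma nn_integral_complex:
  assumes [measurable]: "g \<in> borel_measurable borel"
  shows "(\<integral>\<^sup>+z. g z \<partial>lborel) = (\<integral>\<^sup>+x. \<integral>\<^sup>+y. g (Complex x y) \<partial>lborel \<partial>lborel)"
proof -
  have "(\<integral>\<^sup>+z. g z \<partial>lborel) = (\<integral>\<^sup>+z. g z \<partial>distr (lborel \<Otimes>\<^sub>M lborel) borel (\<lambda>(x, y). Complex x y))"
    by (simp add: lborel_complex)
  also have "\<dots> = (\<integral>\<^sup>+z. g (case z of (x, y) \<Rightarrow> Complex x y) \<partial>(lborel \<Otimes>\<^sub>M lborel))"
    by (subst nn_integral_distr) auto
  also have "\<dots> = (\<integral>\<^sup>+x. \<integral>\<^sup>+y. g (Complex x y) \<partial>lborel \<partial>lborel)"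
    by (subst lborel_pair.nn_integral_snd[symmetric] lborel.nn_integral_fst[symmetric]) auto
  finally show ?thesis .
qed

lemma nn_integral_complex':
  assumes [measurable]: "g \<in> borel_measurable borel"
  shows "(\<integral>\<^sup>+z. g z \<partial>lborel) = (\<integral>\<^sup>+y. \<integral>\<^sup>+x. g (Complex x y) \<partial>lborel \<partial>lborel)"
proof -
  have "(\<lambda>(x, y). g (Complex x y)) \<in> borel_measurable (lborel \<Otimes>\<^sub>M lborel)"
    using measurable_compose[OF measurable_Complex assms] by (simp add: case_prod_beta)
  then show ?thesis
    by (subst lborel_pair.Fubini'[symmetric]) (auto simp: nn_integral_complex)
qed

section \<open>Invariance under shears, rotations and translations\<close>

lemma nn_integral_shift_real:
  fixes t :: real
  assumes [measurable]: "g \<in> borel_measurable borel"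
  shows "(\<integral>\<^sup>+x. g (x + t) \<partial>lborel) = (\<integral>\<^sup>+x. g x \<partial>lborel)"
  using nn_integral_real_affine[of g 1 t] by (simp add: add.commute)

text \<open>With the imaginary part fixed, a shear is a translation of the line. The moving
  coordinate has to be the inner variable of integration, hence the two orders of Tonelli
  above.\<close>

lemma nn_integral_shear_Re:
  assumes [measurable]: "g \<in> borel_measurable borel"
  shows "(\<integral>\<^sup>+z. g (Complex (Re z + t * Im z) (Im z)) \<partial>lborel) = (\<integral>\<^sup>+z. g z \<partial>lborel)"
proof -
  have [measurable]: "(\<lambda>x. g (Complex x y)) \<in> borel_measurable borel" for y
    by (simp add: Complex_eq)
  have m: "(\<lambda>z. g (Complex (Re z + t * Im z) (Im z))) \<in> borel_measurable borel"
    by (simp add: Complex_eq)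
  show ?thesis
    unfolding nn_integral_complex'[OF m] nn_integral_complex'[OF assms]
    using nn_integral_shift_real[of "\<lambda>x. g (Complex x y)" "t * y" for y] by simp
qed

lemma nn_integral_shear_Im:
  assumes [measurable]: "g \<in> borel_measurable borel"
  shows "(\<integral>\<^sup>+z. g (Complex (Re z) (Im z + t * Re z)) \<partial>lborel) = (\<integral>\<^sup>+z. g z \<partial>lborel)"
proof -
  have [measurable]: "(\<lambda>y. g (Complex x y)) \<in> borel_measurable borel" for x
    by (simp add: Complex_eq)
  have m: "(\<lambda>z. g (Complex (Re z) (Im z + t * Re z))) \<in> borel_measurable borel"
    by (simp add: Complex_eq)
  show ?thesis
    unfolding nn_integral_complex[OF m] nn_integral_complex[OF assms]
    using nn_integral_shift_real[of "\<lambda>y. g (Complex x y)" "t * x" for x] by simp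
qed

text \<open>A rotation is a product of three shears.\<close>

lemma nn_integral_rotate:
  assumes [measurable]: "g \<in> borel_measurable borel" and c: "cmod c = 1"
  shows "(\<integral>\<^sup>+z. g (c * z) \<partial>lborel) = (\<integral>\<^sup>+z. g z \<partial>lborel)"
proof -
  have main: "(\<integral>\<^sup>+z. g (c * z) \<partial>lborel) = (\<integral>\<^sup>+z. g z \<partial>lborel)"
    if [measurable]: "g \<in> borel_measurable borel" and c: "cmod c = 1" and c1: "c \<noteq> -1" for c and g :: "complex \<Rightarrow> ennreal"
  proof -
    have n1: "(Re c)\<^sup>2 + (Im c)\<^sup>2 = 1"
      using c by (metis cmod_power2 one_power2)
    have R: "1 + Re c \<noteq> 0"
    proof
      assume "1 + Re c = 0"
      then have "Re c = -1" by simp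
      with n1 c1 show False by (auto simp: complex_eq_iff)
    qed
    \<comment> \<open>For c = exp(i \<theta>) this is - tan(\<theta>/2), and the middle shear has
      the parameter sin \<theta>. The tangent has a pole at the half turn, which is treated below as
      two quarter turns.\<close>
    define t where "t = - (Im c / (1 + Re c))"
    have t1: "1 + t * Im c = Re c"
      using n1 R unfolding t_def by (simp add: field_simps power2_eq_square)
    have t2: "t + Re c * t = - Im c"
    proof -
      have "t * (1 + Re c) = - Im c"
        using R by (simp add: t_def)
      then show ?thesis by (simp add: algebra_simps)
    qed
    define h1 where "h1 = (\<lambda>z. g (Complex (Re z + t * Im z) (Im z)))"
    define h2 where "h2 = (\<lambda>z. h1 (Complex (Re z) (Im z + Im c * Re z)))"
    have [measurable]: "h1 \<in> borel_measurable borel" "h2 \<in> borel_measurable borel"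
      unfolding h1_def h2_def by (simp_all add: Complex_eq)
    have "g (c * z) = h2 (Complex (Re z + t * Im z) (Im z))" for z
    proof -
      have a: "Re z + t * Im z + t * (Im z + Im c * (Re z + t * Im z)) = Re c * Re z - Im c * Im z"
      proof -
        have "Re z + t * Im z + t * (Im z + Im c * (Re z + t * Im z))
          = (1 + t * Im c) * Re z + (t + (1 + t * Im c) * t) * Im z" by algebra
        also have "\<dots> = Re c * Re z - Im c * Im z"
          unfolding t1 t2 by simp
        finally show ?thesis .
      qed
      have b: "Im z + Im c * (Re z + t * Im z) = Re c * Im z + Im c * Re z"
      proof -
        have "Im z + Im c * (Re z + t * Im z) = (1 + t * Im c) * Im z + Im c * Re z" by algebra
        then show ?thesis unfolding t1 .
      qed
      show ?thesis
        unfolding h2_def h1_def using a b by (auto simp: complex_eq_iff intro!: arg_cong[of _ _ g])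
    qed
    then have "(\<integral>\<^sup>+z. g (c * z) \<partial>lborel) = (\<integral>\<^sup>+z. h2 z \<partial>lborel)"
      by (simp add: nn_integral_shear_Re)
    also have "\<dots> = (\<integral>\<^sup>+z. h1 z \<partial>lborel)"
      unfolding h2_def by (simp add: nn_integral_shear_Im)
    also have "\<dots> = (\<integral>\<^sup>+z. g z \<partial>lborel)"
      unfolding h1_def by (simp add: nn_integral_shear_Re)
    finally show ?thesis .
  qed
  show ?thesis
  proof (cases "c = -1")
    case True
    have "(\<integral>\<^sup>+z. g (c * z) \<partial>lborel) = (\<integral>\<^sup>+z. g (\<i> * (\<i> * z)) \<partial>lborel)"
      using True by simp
    also have "\<dots> = (\<integral>\<^sup>+z. g (\<i> * z) \<partial>lborel)"
      by (rule main[of "\<lambda>z. g (\<i> * z)"]) (auto simp: complex_eq_iff)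
    also have "\<dots> = (\<integral>\<^sup>+z. g z \<partial>lborel)"
      by (rule main) (auto simp: complex_eq_iff)
    finally show ?thesis .
  qed (simp add: main c)
qed

lemma nn_integral_translate:
  fixes g :: "'a::euclidean_space \<Rightarrow> ennreal"
  assumes [measurable]: "g \<in> borel_measurable borel"
  shows "(\<integral>\<^sup>+z. g (w + z) \<partial>lborel) = (\<integral>\<^sup>+z. g z \<partial>lborel)"
proof -
  have "(\<integral>\<^sup>+z. g z \<partial>lborel) = (\<integral>\<^sup>+z. g z \<partial>distr lborel borel ((+) w))"
    by (simp add: lborel_distr_plus)
  then show ?thesis by (simp add: nn_integral_distr)
qed

lemma nn_integral_reflect_real:
  fixes c :: real
  assumes [measurable]: "g \<in> borel_measurable borel"
  shows "(\<integral>\<^sup>+x. g (c - x) \<partial>lborel) = (\<integral>\<^sup>+x. g x \<partial>lborel)"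
  using nn_integral_real_affine[of g "-1" c] by simp

section \<open>Integrals of decay kernels over the line, the plane and the disc\<close>

lemma nn_integral_abs_le:
  fixes k :: "real \<Rightarrow> ennreal"
  assumes [measurable]: "k \<in> borel_measurable borel"
  shows "(\<integral>\<^sup>+x. k \<bar>x\<bar> \<partial>lborel) \<le> 2 * (\<integral>\<^sup>+x. k x \<partial>lborel)"
proof -
  have "(\<integral>\<^sup>+x. k \<bar>x\<bar> \<partial>lborel) \<le> (\<integral>\<^sup>+x. k x + k (0 - x) \<partial>lborel)"
    by (intro nn_integral_mono) (auto simp: abs_if)
  also have "\<dots> = (\<integral>\<^sup>+x. k x \<partial>lborel) + (\<integral>\<^sup>+x. k (0 - x) \<partial>lborel)"
    by (subst nn_integral_add) auto
  also have "\<dots> = 2 * (\<integral>\<^sup>+x. k x \<partial>lborel)"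
    by (subst nn_integral_reflect_real) (auto simp: mult_2)
  finally show ?thesis .
qed

lemma nn_integral_line_kernel_le:
  fixes \<delta> \<tau> c :: real
  assumes \<delta>: "\<delta> > 0" and \<tau>: "\<tau> > 0"
  shows "(\<integral>\<^sup>+x. ennreal ((\<delta> + \<bar>x - c\<bar>) powr (-1 - \<tau>)) \<partial>lborel) \<le> ennreal (2 / \<tau> * \<delta> powr (-\<tau>))"
proof -
  define f where "f = (\<lambda>x. (\<delta> + x) powr (-1 - \<tau>))"
  define F where "F = (\<lambda>x. - ((\<delta> + x) powr (-\<tau>)) / \<tau>)"
  have [measurable]: "f \<in> borel_measurable borel"
    unfolding f_def by measurable
  have lim: "(F \<longlongrightarrow> 0) at_top"
    unfolding F_def using \<tau> by real_asymp
  have half: "(\<integral>\<^sup>+x. ennreal (f x) * indicator {0..} x \<partial>lborel) = ennreal (0 - F 0)"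
  proof (rule nn_integral_FTC_atLeast[OF _ _ _ lim])
    show "DERIV F x :> f x" if "0 \<le> x" for x
      unfolding F_def f_def using \<delta> \<tau> that
      by (auto intro!: derivative_eq_intros simp: field_simps minus_diff_commute)
  qed (auto simp: f_def)
  have "(\<integral>\<^sup>+x. ennreal ((\<delta> + \<bar>x - c\<bar>) powr (-1 - \<tau>)) \<partial>lborel)
     = (\<integral>\<^sup>+x. ennreal (f \<bar>x\<bar>) * indicator {0..} \<bar>x\<bar> \<partial>lborel)"
    using nn_integral_shift_real[of "\<lambda>x. ennreal ((\<delta> + \<bar>x\<bar>) powr (-1 - \<tau>))" "-c"]
    by (simp add: f_def)
  also have "\<dots> \<le> 2 * (\<integral>\<^sup>+x. ennreal (f x) * indicator {0..} x \<partial>lborel)"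
    by (rule nn_integral_abs_le) measurable
  also have "\<dots> = ennreal (2 / \<tau> * \<delta> powr (-\<tau>))"
    unfolding half using \<tau> by (simp add: F_def flip: ennreal_mult' ennreal_numeral)
  finally show ?thesis .
qed

text \<open>The distance in the plane dominates both coordinate distances, so giving half of the
  exponent to each coordinate bounds the kernel by a product of two line kernels. Each factor costs
  2 / (\<sigma>/2), whence 16 / \<sigma>^2.\<close>

lemma nn_integral_plane_kernel_le:
  fixes \<delta> \<sigma> :: real and z :: complex
  assumes \<delta>: "\<delta> > 0" and \<sigma>: "\<sigma> > 0"
  shows "(\<integral>\<^sup>+w. ennreal ((\<delta> + cmod (w - z)) powr (-2 - \<sigma>)) \<partial>lborel)
    \<le> ennreal (16 / \<sigma>\<^sup>2 * \<delta> powr (-\<sigma>))"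
proof -
  define K where "K = (\<lambda>c x. (\<delta> + \<bar>x - c\<bar>) powr (-1 - \<sigma> / 2))"
  have [measurable]: "K c \<in> borel_measurable borel" for c
    unfolding K_def by measurable
  have le: "(\<delta> + cmod (Complex x y - z)) powr (-2 - \<sigma>) \<le> K (Re z) x * K (Im z) y" for x y
  proof -
    have 1: "\<bar>x - Re z\<bar> \<le> cmod (Complex x y - z)" "\<bar>y - Im z\<bar> \<le> cmod (Complex x y - z)"
      using abs_Re_le_cmod[of "Complex x y - z"] abs_Im_le_cmod[of "Complex x y - z"] by auto
    have "(\<delta> + cmod (Complex x y - z)) powr (-2 - \<sigma>)
      = (\<delta> + cmod (Complex x y - z)) powr (-1 - \<sigma> / 2) * (\<delta> + cmod (Complex x y - z)) powr (-1 - \<sigma> / 2)"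
      by (simp flip: powr_add)
    also have "\<dots> \<le> K (Re z) x * K (Im z) y"
      unfolding K_def using 1 \<delta> \<sigma>
      by (intro mult_mono powr_mono2') auto
    finally show ?thesis .
  qed
  have "(\<integral>\<^sup>+w. ennreal ((\<delta> + cmod (w - z)) powr (-2 - \<sigma>)) \<partial>lborel)
     = (\<integral>\<^sup>+x. \<integral>\<^sup>+y. ennreal ((\<delta> + cmod (Complex x y - z)) powr (-2 - \<sigma>)) \<partial>lborel \<partial>lborel)"
    by (rule nn_integral_complex) measurable
  also have "\<dots> \<le> (\<integral>\<^sup>+x. \<integral>\<^sup>+y. ennreal (K (Re z) x) * ennreal (K (Im z) y) \<partial>lborel \<partial>lborel)"
    using le by (intro nn_integral_mono) (simp add: K_def flip: ennreal_mult')
  also have "\<dots> = (\<integral>\<^sup>+x. ennreal (K (Re z) x) \<partial>lborel) * (\<integral>\<^sup>+y. ennreal (K (Im z) y) \<partial>lborel)"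
    by (simp add: nn_integral_cmult nn_integral_multc)
  also have "\<dots> \<le> ennreal (2 / (\<sigma>/2) * \<delta> powr (-(\<sigma>/2))) * ennreal (2 / (\<sigma>/2) * \<delta> powr (-(\<sigma>/2)))"
    unfolding K_def using \<delta> \<sigma> by (intro mult_mono nn_integral_line_kernel_le) auto
  also have "\<dots> = ennreal (16 / \<sigma>\<^sup>2 * (\<delta> powr (-(\<sigma>/2)) * \<delta> powr (-(\<sigma>/2))))"
    using \<sigma> by (subst ennreal_mult'[symmetric]) (auto simp: power2_eq_square field_simps)
  also have "\<delta> powr (-(\<sigma>/2)) * \<delta> powr (-(\<sigma>/2)) = \<delta> powr (-\<sigma>)"
    by (simp flip: powr_add)
  finally show ?thesis .
qed

text \<open>The two exponents add up to -2, which makes (2/\<delta>) sqrt(t / (\<delta> + t)) an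
  antiderivative; it runs from 0 to 2/\<delta>. The singularity t^(-1/2) is the one that Schur's
  test leaves at the circle.\<close>

lemma nn_integral_sqrt_kernel:
  fixes \<delta> :: real
  assumes \<delta>: "\<delta> > 0"
  shows "(\<integral>\<^sup>+t. ennreal (t powr (-1/2) * (\<delta> + t) powr (-3/2)) * indicator {0<..} t \<partial>lborel) = ennreal (2 / \<delta>)"
proof -
  define f where "f = (\<lambda>t. t powr (-1/2) * (\<delta> + t) powr (-3/2))"
  define F where "F = (\<lambda>t. 2 / \<delta> * (t powr (1/2) * (\<delta> + t) powr (-1/2)))"
  have 1: "DERIV F t :> f t" if "t > 0" for t
  proof -
    have e: "(\<delta> + t) powr (-1/2) = (\<delta> + t) * (\<delta> + t) powr (-3/2)"
      using that \<delta> powr_add[of "\<delta> + t" 1 "-3/2"] by simp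
    have e2: "t powr (1/2) = t * t powr (-1/2)"
      using that powr_add[of t 1 "-1/2"] by simp
    have "DERIV F t :> 2 / \<delta> * ((1/2) * t powr (-1/2) * (\<delta> + t) powr (-1/2) + t powr (1/2) * ((-1/2) * (\<delta> + t) powr (-3/2)))"
      unfolding F_def using that \<delta> by (auto intro!: derivative_eq_intros)
    also have "2 / \<delta> * ((1/2) * t powr (-1/2) * (\<delta> + t) powr (-1/2) + t powr (1/2) * ((-1/2) * (\<delta> + t) powr (-3/2))) = f t"
      unfolding e e2 f_def using \<delta> by (simp add: field_simps)
    finally show ?thesis .
  qed
  have 2: "isCont f t" if "t > 0" for t
    unfolding f_def using that \<delta> by (intro continuous_intros) auto
  have A: "((F \<circ> real_of_ereal) \<longlongrightarrow> 0) (at_right (ereal 0))"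
    unfolding ereal_tendsto_simps1 F_def using \<delta> by real_asymp
  have B: "((F \<circ> real_of_ereal) \<longlongrightarrow> 2 / \<delta>) (at_left \<infinity>)"
    unfolding ereal_tendsto_simps1 F_def using \<delta> by real_asymp
  have ei: "einterval (ereal 0) \<infinity> = {0<..}"
    by (auto simp: einterval_def)
  have int: "set_integrable lborel {0<..} f" and eq: "(LBINT t=ereal 0..\<infinity>. f t) = 2 / \<delta>"
    using interval_integral_FTC_nonneg[of "ereal 0" \<infinity> F f, OF _ _ _ _ A B] 1 2
    unfolding ei by (auto simp: f_def)
  have "(\<integral>\<^sup>+t. ennreal (f t) * indicator {0<..} t \<partial>lborel) = (\<integral>\<^sup>+t. ennreal (indicator {0<..} t *\<^sub>R f t) \<partial>lborel)"
    by (intro nn_integral_cong) (auto simp: indicator_def)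
  also have "\<dots> = ennreal (\<integral>t. indicator {0<..} t *\<^sub>R f t \<partial>lborel)"
    using int unfolding set_integrable_def by (intro nn_integral_eq_integral) (auto simp: f_def)
  also have "\<dots> = ennreal (2 / \<delta>)"
    using eq unfolding interval_lebesgue_integral_def set_lebesgue_integral_def ei by simp
  finally show ?thesis unfolding f_def .
qed

text \<open>On the part of the disc where |Im z| is at most |Re z|, the distance of z to the circle is
  comparable to its distance along the horizontal line, which turns the integral into a
  product of one-dimensional ones.\<close>

lemma disc_horizontal_gap:
  assumes z: "cmod z < 1" and le: "\<bar>Im z\<bar> \<le> \<bar>Re z\<bar>"
  shows "0 < sqrt (1 - (Im z)\<^sup>2) - \<bar>Re z\<bar>" "sqrt (1 - (Im z)\<^sup>2) - \<bar>Re z\<bar> \<le> 4 * (1 - cmod z)"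
proof -
  have n: "(cmod z)\<^sup>2 = (Re z)\<^sup>2 + (Im z)\<^sup>2" by (simp add: cmod_power2)
  have n1: "(cmod z)\<^sup>2 < 1" using z by (simp add: power_less_one_iff)
  have "(Im z)\<^sup>2 \<le> (Re z)\<^sup>2" using le by (simp add: abs_le_square_iff)
  then have im: "(Im z)\<^sup>2 \<le> 1/2" using n n1 by linarith
  define X where "X = sqrt (1 - (Im z)\<^sup>2)"
  have X2: "X\<^sup>2 = 1 - (Im z)\<^sup>2" unfolding X_def using im by simp
  have "(1/2)\<^sup>2 \<le> 1 - (Im z)\<^sup>2" unfolding power_divide one_power2 using im by simp
  then have Xh: "X \<ge> 1/2" unfolding X_def by (rule real_le_rsqrt)
  have "\<bar>Re z\<bar>\<^sup>2 < X\<^sup>2" unfolding power2_abs using X2 n n1 by linarith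
  moreover have "0 \<le> X" using Xh by linarith
  ultimately have lt: "\<bar>Re z\<bar> < X" by (rule power2_less_imp_less)
  then show "0 < sqrt (1 - (Im z)\<^sup>2) - \<bar>Re z\<bar>" by (simp add: X_def)
  \<comment> \<open>X^2 - (Re z)^2 and 1 - |z|^2 are the same number. Factoring both, with X + |Re
    z| >= 1/2 and 1 + |z| <= 2, gives the factor 4.\<close>
  have "(X - \<bar>Re z\<bar>) * (1/2) \<le> (X - \<bar>Re z\<bar>) * (X + \<bar>Re z\<bar>)"
    using lt Xh by (intro mult_left_mono) auto
  also have "\<dots> = X\<^sup>2 - \<bar>Re z\<bar>\<^sup>2" by (simp add: power2_eq_square algebra_simps)
  also have "\<dots> = (1 - cmod z) * (1 + cmod z)" using X2 n by (simp add: power2_eq_square algebra_simps)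
  also have "\<dots> \<le> (1 - cmod z) * 2" using z by (intro mult_left_mono) auto
  finally show "sqrt (1 - (Im z)\<^sup>2) - \<bar>Re z\<bar> \<le> 4 * (1 - cmod z)" by (simp add: X_def)
qed

text \<open>The exponent -3/2 - \<tau> is split: -3/2 joins the factor (1 - |z|)^(-1/2) and is
  integrated towards the circle, while -\<tau> is integrated along the other coordinate, which
  converges as \<tau> > 1. The 256 collects 16 from the pointwise comparison, 4 and 2 from the two
  line integrals, and 2 for the two regions.\<close>

lemma nn_integral_disc_kernel_le:
  fixes \<tau> :: real and a :: complex
  assumes a: "cmod a < 1" and \<tau>: "\<tau> > 1"
  shows "(\<integral>\<^sup>+z\<in>disc. ennreal ((1 - cmod z) powr (-1/2)
       * ((1 - cmod a) + (1 - cmod z) + cmod (z - a)) powr (-3/2 - \<tau>)) \<partial>lborel)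
    \<le> ennreal (256 / (\<tau> - 1) * (1 - cmod a) powr (-\<tau>))"
proof -
  define \<delta> where "\<delta> = 1 - cmod a"
  have \<delta>: "\<delta> > 0" using a by (simp add: \<delta>_def)
  define G where "G = (\<lambda>t. ennreal (t powr (-1/2) * (\<delta> + t) powr (-3/2)) * indicator {0<..} t)"
  define H where "H = (\<lambda>c y. ennreal ((\<delta> + \<bar>y - c\<bar>) powr (-\<tau>)))"
  have [measurable]: "G \<in> borel_measurable borel" "H c \<in> borel_measurable borel" for c
    unfolding G_def H_def by measurable
  have Gint: "(\<integral>\<^sup>+x. G (X - \<bar>x\<bar>) \<partial>lborel) \<le> ennreal (4 / \<delta>)" for X
  proof -
    have "(\<integral>\<^sup>+x. G (X - \<bar>x\<bar>) \<partial>lborel) \<le> 2 * (\<integral>\<^sup>+x. G (X - x) \<partial>lborel)"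
      by (rule nn_integral_abs_le[of "\<lambda>x. G (X - x)"]) measurable
    also have "(\<integral>\<^sup>+x. G (X - x) \<partial>lborel) = ennreal (2 / \<delta>)"
        using nn_integral_sqrt_kernel[OF \<delta>] by (subst nn_integral_reflect_real) (simp_all add: G_def)
    finally show ?thesis using \<delta> by (simp flip: ennreal_mult' ennreal_numeral)
  qed
  have Hint: "(\<integral>\<^sup>+y. H c y \<partial>lborel) \<le> ennreal (2 / (\<tau> - 1) * \<delta> powr (1 - \<tau>))" for c
    using nn_integral_line_kernel_le[OF \<delta>, of "\<tau> - 1" c] \<tau> unfolding H_def by simp
  have pw: "(1 - cmod z) powr (-1/2) * (\<delta> + (1 - cmod z) + cmod (z - a)) powr (-3/2 - \<tau>)
     \<le> 16 * ((t powr (-1/2) * (\<delta> + t) powr (-3/2)) * (\<delta> + \<bar>y\<bar>) powr (-\<tau>))"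
    if "0 < t" "t \<le> 4 * (1 - cmod z)" "\<bar>y\<bar> \<le> cmod (z - a)" "cmod z < 1" for z t y
  proof -
    let ?D = "\<delta> + (1 - cmod z) + cmod (z - a)"
    have 1: "(1 - cmod z) powr (-1/2) \<le> (t/4) powr (-1/2)"
      using that by (intro powr_mono2') auto
    have 2: "?D powr (-3/2) \<le> ((\<delta> + t)/4) powr (-3/2)"
      using that \<delta> norm_ge_zero[of "z - a"] by (intro powr_mono2') (auto simp del: norm_ge_zero)
    have 3: "?D powr (-\<tau>) \<le> (\<delta> + \<bar>y\<bar>) powr (-\<tau>)"
      using that \<delta> \<tau> by (intro powr_mono2') auto
    have "(1 - cmod z) powr (-1/2) * ?D powr (-3/2 - \<tau>)
       = (1 - cmod z) powr (-1/2) * ?D powr (-3/2) * ?D powr (-\<tau>)"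
      by (simp flip: powr_add)
    also have "\<dots> \<le> (t/4) powr (-1/2) * ((\<delta> + t)/4) powr (-3/2) * (\<delta> + \<bar>y\<bar>) powr (-\<tau>)"
      by (intro mult_mono 1 2 3) auto
    also have "(t/4) powr (-1/2) * ((\<delta> + t)/4) powr (-3/2) = 4 powr (1/2) * 4 powr (3/2) * (t powr (-1/2) * (\<delta> + t) powr (-3/2))"
      using that \<delta> by (simp add: powr_divide powr_minus field_simps)
    also have "4 powr (1/2) * 4 powr (3/2) = (16::real)"
      by (simp flip: powr_add)
    finally show ?thesis by (simp add: mult.assoc)
  qed
  have main: "ennreal ((1 - cmod z) powr (-1/2) * (\<delta> + (1 - cmod z) + cmod (z - a)) powr (-3/2 - \<tau>)) * indicator disc z
     \<le> 16 * (G (sqrt (1 - (Im z)\<^sup>2) - \<bar>Re z\<bar>) * H (Im a) (Im z))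
      + 16 * (G (sqrt (1 - (Re z)\<^sup>2) - \<bar>Im z\<bar>) * H (Re a) (Re z))" for z
  proof (cases "cmod z < 1")
    case True
    have *: "16 * (ennreal x * ennreal y) = ennreal (16 * (x * y))" if "x \<ge> 0" for x y
      using that by (simp add: ennreal_mult'' flip: ennreal_mult' ennreal_numeral)
    show ?thesis
    proof (cases "\<bar>Im z\<bar> \<le> \<bar>Re z\<bar>")
      case le: True
      note g = disc_horizontal_gap[OF True le]
      have "\<bar>Im z - Im a\<bar> \<le> cmod (z - a)" using abs_Im_le_cmod[of "z - a"] by simp
      from pw[OF g this True] g(1) True show ?thesis
        by (intro add_increasing2) (auto simp: G_def H_def * intro!: ennreal_leI)
    next
      case False
      note g = disc_horizontal_gap[of "\<i> * z"]
      have le: "\<bar>Im (\<i> * z)\<bar> \<le> \<bar>Re (\<i> * z)\<bar>" using False by simp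
      have n: "cmod (\<i> * z) = cmod z" by (simp add: norm_mult)
      have "\<bar>Re z - Re a\<bar> \<le> cmod (z - a)" using abs_Re_le_cmod[of "z - a"] by simp
      from pw[OF _ _ this True, of "sqrt (1 - (Re z)\<^sup>2) - \<bar>Im z\<bar>"] g[OF _ le] True n show ?thesis
        by (intro add_increasing) (auto simp: G_def H_def * intro!: ennreal_leI)
    qed
  qed auto
  have "(\<integral>\<^sup>+z\<in>disc. ennreal ((1 - cmod z) powr (-1/2) * (\<delta> + (1 - cmod z) + cmod (z - a)) powr (-3/2 - \<tau>)) \<partial>lborel)
     \<le> (\<integral>\<^sup>+z. 16 * (G (sqrt (1 - (Im z)\<^sup>2) - \<bar>Re z\<bar>) * H (Im a) (Im z))
      + 16 * (G (sqrt (1 - (Re z)\<^sup>2) - \<bar>Im z\<bar>) * H (Re a) (Re z)) \<partial>lborel)"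
    by (intro nn_integral_mono main)
  also have "\<dots> = 16 * (\<integral>\<^sup>+z. G (sqrt (1 - (Im z)\<^sup>2) - \<bar>Re z\<bar>) * H (Im a) (Im z) \<partial>lborel)
      + 16 * (\<integral>\<^sup>+z. G (sqrt (1 - (Re z)\<^sup>2) - \<bar>Im z\<bar>) * H (Re a) (Re z) \<partial>lborel)"
    by (subst nn_integral_add) (auto simp: nn_integral_cmult)
  also have "(\<integral>\<^sup>+z. G (sqrt (1 - (Im z)\<^sup>2) - \<bar>Re z\<bar>) * H (Im a) (Im z) \<partial>lborel)
     = (\<integral>\<^sup>+y. (\<integral>\<^sup>+x. G (sqrt (1 - y\<^sup>2) - \<bar>x\<bar>) \<partial>lborel) * H (Im a) y \<partial>lborel)"
    by (subst nn_integral_complex') (auto simp: nn_integral_multc)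
  also have "(\<integral>\<^sup>+z. G (sqrt (1 - (Re z)\<^sup>2) - \<bar>Im z\<bar>) * H (Re a) (Re z) \<partial>lborel)
     = (\<integral>\<^sup>+x. (\<integral>\<^sup>+y. G (sqrt (1 - x\<^sup>2) - \<bar>y\<bar>) \<partial>lborel) * H (Re a) x \<partial>lborel)"
    by (subst nn_integral_complex) (auto simp: nn_integral_multc)
  also have "16 * (\<integral>\<^sup>+y. (\<integral>\<^sup>+x. G (sqrt (1 - y\<^sup>2) - \<bar>x\<bar>) \<partial>lborel) * H (Im a) y \<partial>lborel)
     + 16 * (\<integral>\<^sup>+x. (\<integral>\<^sup>+y. G (sqrt (1 - x\<^sup>2) - \<bar>y\<bar>) \<partial>lborel) * H (Re a) x \<partial>lborel)
     \<le> 16 * (\<integral>\<^sup>+y. ennreal (4 / \<delta>) * H (Im a) y \<partial>lborel) + 16 * (\<integral>\<^sup>+x. ennreal (4 / \<delta>) * H (Re a) x \<partial>lborel)"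
    by (intro add_mono mult_mono nn_integral_mono Gint) auto
  also have "\<dots> \<le> 16 * (ennreal (4 / \<delta>) * ennreal (2 / (\<tau> - 1) * \<delta> powr (1 - \<tau>)))
       + 16 * (ennreal (4 / \<delta>) * ennreal (2 / (\<tau> - 1) * \<delta> powr (1 - \<tau>)))"
    using Hint[of "Im a"] Hint[of "Re a"]
    by (intro add_mono mult_left_mono) (simp_all add: nn_integral_cmult mult_left_mono)
  also have "\<dots> = ennreal (2 * (16 * (4 / \<delta> * (2 / (\<tau> - 1) * \<delta> powr (1 - \<tau>)))))"
  proof -
    have 1: "16 * ennreal x + 16 * ennreal x = ennreal (2 * (16 * x))" if "x \<ge> 0" for x
      using that by (simp add: ennreal_mult flip: distrib_right)
    have 2: "ennreal (4 / \<delta>) * ennreal x = ennreal (4 / \<delta> * x)" for x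
      using \<delta> by (intro ennreal_mult'[symmetric]) simp
    show ?thesis
      unfolding 2 by (rule 1) (use \<delta> \<tau> in simp)
  qed
  also have "2 * (16 * (4 / \<delta> * (2 / (\<tau> - 1) * \<delta> powr (1 - \<tau>)))) = 256 / (\<tau> - 1) * \<delta> powr (-\<tau>)"
    using \<delta> powr_add[of \<delta> 1 "-\<tau>"] by (simp add: field_simps)
  finally show ?thesis unfolding \<delta>_def .
qed

section \<open>Local estimates for holomorphic functions\<close>

text \<open>Cauchy's formula on the unit circle for the map from \<zeta> to f (z + \<zeta> w).
  Fixing w and turning it, instead of fixing a radius, prepares for integrating over w by rotation
  invariance.\<close>

lemma circle_mean_le:
  assumes f: "f holomorphic_on ball z r" and w: "cmod w < r"
  shows "ennreal (cmod (f z)) \<le> (\<integral>\<^sup>+t\<in>{0..1}. ennreal (cmod (f (z + exp (2 * pi * \<i> * of_real t) * w))) \<partial>lborel)"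
proof -
  define h where "h = (\<lambda>\<zeta>. f (z + \<zeta> * w))"
  have mapsto: "z + \<zeta> * w \<in> ball z r" if "cmod \<zeta> \<le> 1" for \<zeta>
  proof -
    have "cmod (\<zeta> * w) \<le> 1 * cmod w"
      unfolding norm_mult using that by (intro mult_right_mono) auto
    then show ?thesis using w by (simp add: dist_norm)
  qed
  have "((f \<circ> (\<lambda>\<zeta>. z + \<zeta> * w)) holomorphic_on cball 0 1)"
    by (rule holomorphic_on_compose_gen[OF _ f]) (auto intro!: holomorphic_intros mapsto)
  then have hol: "h holomorphic_on cball 0 1"
    by (simp add: h_def o_def)
  have cis: "circlepath 0 1 t = exp (2 * pi * \<i> * of_real t)" for t
    by (simp add: circlepath)
  have n1: "cmod (exp (2 * pi * \<i> * of_real t)) = 1" for t :: real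
    by (simp add: norm_exp_eq_Re)
  have "((\<lambda>u. h u / (u - 0)) has_contour_integral (2 * of_real pi * \<i> * h 0)) (circlepath 0 1)"
    by (rule Cauchy_integral_circlepath_simple[OF hol]) simp
  then have "((\<lambda>t. h (exp (2 * pi * \<i> * of_real t)) / exp (2 * pi * \<i> * of_real t) *
      vector_derivative (circlepath 0 1) (at t within {0..1})) has_integral (2 * of_real pi * \<i> * h 0)) {0..1}"
    by (simp add: has_contour_integral_def cis)
  then have "((\<lambda>t. (2 * of_real pi * \<i>) * h (exp (2 * pi * \<i> * of_real t))) has_integral (2 * of_real pi * \<i> * h 0)) {0..1}"
    by (rule has_integral_eq[rotated]) (simp add: vector_derivative_circlepath01)
  then have int: "((\<lambda>t. h (exp (2 * pi * \<i> * of_real t))) has_integral h 0) {0..1}"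
    by (subst (asm) has_integral_mult_right_iff) auto
  have cont: "continuous_on UNIV (\<lambda>t::real. h (exp (2 * pi * \<i> * of_real t)))"
    by (rule continuous_on_compose2[OF holomorphic_on_imp_continuous_on[OF hol]])
       (auto intro!: continuous_intros simp: n1)
  have cn: "continuous_on UNIV (\<lambda>t::real. cmod (h (exp (2 * pi * \<i> * of_real t))))"
    by (intro continuous_on_norm cont)
  then have io: "(\<lambda>t::real. cmod (h (exp (2 * pi * \<i> * of_real t)))) integrable_on {0..1}"
    by (intro integrable_continuous_interval) (auto intro: continuous_on_subset)
  have "cmod (h 0) \<le> integral {0..1} (\<lambda>t. cmod (h (exp (2 * pi * \<i> * of_real t))))"
    using integral_norm_bound_integral[OF has_integral_integrable[OF int] io] integral_unique[OF int] by simp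
  then have "ennreal (cmod (h 0)) \<le> ennreal (integral {0..1} (\<lambda>t. cmod (h (exp (2 * pi * \<i> * of_real t)))))"
    by (rule ennreal_leI)
  also have "\<dots> = (\<integral>\<^sup>+t. indicator {0..1} t * ennreal (cmod (h (exp (2 * pi * \<i> * of_real t)))) \<partial>lborel)"
    using nn_integral_has_integral_lebesgue[OF _ integrable_integral[OF io]]
    by (simp add: ennreal_mult'' ennreal_indicator)
  finally show ?thesis
    by (simp add: h_def mult.commute)
qed

lemma borel_measurable_holomorphic_indicator:
  assumes "f holomorphic_on S" "open S"
  shows "(\<lambda>z. ennreal (cmod (f z) powr p) * indicator S z) \<in> borel_measurable borel"
proof -
  have [measurable]: "S \<in> sets borel"
    using assms(2) by (rule borel_open)
  have "(\<lambda>z. indicator S z *\<^sub>R f z) \<in> borel_measurable borel"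
    using assms by (intro borel_measurable_continuous_on_indicator)
      (auto intro: holomorphic_on_imp_continuous_on borel_open)
  then have "(\<lambda>z. ennreal (cmod (indicator S z *\<^sub>R f z) powr p) * indicator S z) \<in> borel_measurable borel"
    by measurable
  also have "(\<lambda>z. ennreal (cmod (indicator S z *\<^sub>R f z) powr p) * indicator S z)
      = (\<lambda>z. ennreal (cmod (f z) powr p) * indicator S z)"
    by (auto simp: indicator_def fun_eq_iff)
  finally show ?thesis .
qed

lemma emeasure_ball_complex:
  "r \<ge> 0 \<Longrightarrow> emeasure lborel (ball (z::complex) r) = ennreal (pi * r\<^sup>2)"
  by (simp add: emeasure_ball unit_ball_vol_2)

text \<open>Integrate the circle inequality over all w of modulus below r. After Tonelli, rotation
  and translation invariance give the inner integral the same value for every t, so polar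
  coordinates do not enter.\<close>

lemma area_mean_le:
  assumes f: "f holomorphic_on ball z r" and r: "r > 0"
  shows "ennreal (cmod (f z) * (pi * r\<^sup>2)) \<le> (\<integral>\<^sup>+w\<in>ball z r. ennreal (cmod (f w)) \<partial>lborel)"
proof -
  let ?e = "\<lambda>t::real. exp (2 * pi * \<i> * of_real t)"
  define g where "g = (\<lambda>w. ennreal (cmod (f w)) * indicator (ball z r) w)"
  have g: "g \<in> borel_measurable borel"
    using borel_measurable_holomorphic_indicator[OF f, of 1] by (simp add: g_def)
  note [measurable] = g
  have n1: "cmod (?e t) = 1" for t
    by (simp add: norm_exp_eq_Re)
  have "ennreal (cmod (f z) * (pi * r\<^sup>2)) = (\<integral>\<^sup>+w. ennreal (cmod (f z)) * indicator (ball 0 r) w \<partial>(lborel :: complex measure))"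
    using r by (simp add: nn_integral_cmult_indicator emeasure_ball_complex ennreal_mult)
  also have "\<dots> \<le> (\<integral>\<^sup>+w. \<integral>\<^sup>+t. g (z + ?e t * w) * indicator {0..1} t \<partial>lborel \<partial>lborel)"
  proof (intro nn_integral_mono)
    fix w
    show "ennreal (cmod (f z)) * indicator (ball 0 r) w \<le> (\<integral>\<^sup>+t. g (z + ?e t * w) * indicator {0..1} t \<partial>lborel)"
    proof (cases "cmod w < r")
      case True
      then have "g (z + ?e t * w) = ennreal (cmod (f (z + ?e t * w)))" for t
        by (simp add: g_def dist_norm norm_mult n1)
      then show ?thesis
        using circle_mean_le[OF f True] True by simp
    qed simp
  qed
  also have "\<dots> = (\<integral>\<^sup>+t. \<integral>\<^sup>+w. g (z + ?e t * w) * indicator {0..1} t \<partial>lborel \<partial>lborel)"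
    by (rule lborel_pair.Fubini') measurable
  also have "\<dots> = (\<integral>\<^sup>+t. (\<integral>\<^sup>+w. g w \<partial>lborel) * indicator {0..1} (t::real) \<partial>lborel)"
  proof (intro nn_integral_cong)
    fix t :: real
    have "(\<integral>\<^sup>+w. g (z + ?e t * w) \<partial>lborel) = (\<integral>\<^sup>+w. g (z + w) \<partial>lborel)"
      by (rule nn_integral_rotate[of "\<lambda>w. g (z + w)"]) (auto simp: n1)
    also have "\<dots> = (\<integral>\<^sup>+w. g w \<partial>lborel)"
      by (rule nn_integral_translate) measurable
    finally show "(\<integral>\<^sup>+w. g (z + ?e t * w) * indicator {0..1} t \<partial>lborel) = (\<integral>\<^sup>+w. g w \<partial>lborel) * indicator {0..1} t"
      by (simp add: nn_integral_multc)
  qed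
  also have "\<dots> = (\<integral>\<^sup>+w. g w \<partial>lborel)"
    by (simp add: nn_integral_cmult)
  finally show ?thesis
    by (simp add: g_def)
qed

text \<open>Young's inequality in threshold form: above T write x = x^p x^(1 - p). The threshold is
  free; setting it to half of an average lets the first term be absorbed into the left side. This
  stands in for Hoelder's inequality at the loss of a factor 2^p.\<close>

lemma le_add_powr_scaled:
  fixes x T p :: real
  assumes "x \<ge> 0" "T > 0" "p \<ge> 1"
  shows "x \<le> T + x powr p * T powr (1 - p)"
proof (cases "x \<le> T")
  case True
  then show ?thesis by (simp add: add_increasing2)
next
  case False
  have "x = x powr p * x powr (1 - p)"
    using assms False by (simp flip: powr_add)
  also have "\<dots> \<le> x powr p * T powr (1 - p)"
    using assms False by (intro mult_left_mono powr_mono2') auto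
  finally show ?thesis using assms by linarith
qed

lemma powr_le_cancel:
  fixes T :: real
  assumes T: "T > 0" and le: "T * A \<le> T powr (1 - p) * B"
  shows "T powr p * A \<le> B"
proof -
  have "T powr p * A = T powr (p - 1) * (T * A)"
    using T powr_add[of T "p - 1" 1] by simp
  also have "\<dots> \<le> T powr (p - 1) * (T powr (1 - p) * B)"
    by (intro mult_left_mono le) auto
  also have "\<dots> = B"
    using T powr_add[of T "p - 1" "1 - p"] by simp
  finally show ?thesis .
qed

lemma powr_submean_ge1:
  assumes f: "f holomorphic_on ball z r" and r: "r > 0" and p: "p \<ge> 1"
  shows "ennreal (cmod (f z) powr p)
    \<le> ennreal (2 powr p / (pi * r\<^sup>2)) * (\<integral>\<^sup>+w\<in>ball z r. ennreal (cmod (f w) powr p) \<partial>lborel)"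
    (is "_ \<le> _ * ?I")
proof (cases "f z = 0 \<or> ?I = \<infinity>")
  case True
  then show ?thesis using r by (auto simp: ennreal_mult_top)
next
  case False
  then obtain I where I: "?I = ennreal I" "I \<ge> 0"
    by (metis enn2real_nonneg ennreal_enn2real infinity_ennreal_def less_top)
  \<comment> \<open>With this threshold the term T pi r^2 is half of the left side, so it can be
    subtracted.\<close>
  define T where "T = cmod (f z) / 2"
  have T: "T > 0" using False by (simp add: T_def)
  have [measurable]: "ball z r \<in> sets borel"
    by simp
  have [measurable]: "(\<lambda>w. ennreal (cmod (f w) powr p) * indicator (ball z r) w) \<in> borel_measurable borel"
    by (rule borel_measurable_holomorphic_indicator[OF f]) simp
  have "ennreal (cmod (f z) * (pi * r\<^sup>2)) \<le> (\<integral>\<^sup>+w\<in>ball z r. ennreal (cmod (f w)) \<partial>lborel)"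
    by (rule area_mean_le[OF f r])
  also have "\<dots> \<le> (\<integral>\<^sup>+w. ennreal T * indicator (ball z r) w
      + ennreal (T powr (1 - p)) * (ennreal (cmod (f w) powr p) * indicator (ball z r) w) \<partial>lborel)"
  proof (intro nn_integral_mono)
    fix w
    have "ennreal (cmod (f w)) \<le> ennreal (T + cmod (f w) powr p * T powr (1 - p))"
      using T p by (intro ennreal_leI le_add_powr_scaled) auto
    then show "ennreal (cmod (f w)) * indicator (ball z r) w \<le> ennreal T * indicator (ball z r) w
      + ennreal (T powr (1 - p)) * (ennreal (cmod (f w) powr p) * indicator (ball z r) w)"
      using T by (auto simp: indicator_def ennreal_plus ennreal_mult mult.commute)
  qed
  also have "\<dots> = ennreal T * ennreal (pi * r\<^sup>2) + ennreal (T powr (1 - p)) * ennreal I"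
    using r by (subst nn_integral_add) (auto simp: nn_integral_cmult nn_integral_cmult_indicator emeasure_ball_complex I)
  also have "\<dots> = ennreal (T * (pi * r\<^sup>2) + T powr (1 - p) * I)"
    using T I by (simp add: ennreal_plus ennreal_mult)
  finally have "cmod (f z) * (pi * r\<^sup>2) \<le> T * (pi * r\<^sup>2) + T powr (1 - p) * I"
    using T I by (subst (asm) ennreal_le_iff) auto
  then have "T * (pi * r\<^sup>2) \<le> T powr (1 - p) * I"
    by (simp add: T_def)
  with T have "T powr p * (pi * r\<^sup>2) \<le> I"
    by (rule powr_le_cancel)
  then have "cmod (f z) powr p \<le> 2 powr p / (pi * r\<^sup>2) * I"
    using r by (simp add: T_def powr_divide field_simps)
  then show ?thesis
    unfolding I using r I(2) by (simp add: ennreal_leI flip: ennreal_mult)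
qed

text \<open>For p < 1 one compares f with its value at a point maximising
  (s - |w - z|) powr (2/p) * |f w|; near such a point |f| is at most a constant times that value.\<close>

lemma powr_submean_le1:
  assumes f: "f holomorphic_on ball z r" and r: "r > 0" and p: "0 < p" "p \<le> 1"
  shows "ennreal (cmod (f z) powr p)
    \<le> ennreal (16 * 2 powr (2 / p) / (pi * r\<^sup>2)) * (\<integral>\<^sup>+w\<in>ball z r. ennreal (cmod (f w) powr p) \<partial>lborel)"
    (is "_ \<le> _ * ?I")
proof -
  define s where "s = r / 2"
  have s: "s > 0" "s < r" using r by (auto simp: s_def)
  have fc: "continuous_on (cball z s) f"
    using s by (intro holomorphic_on_imp_continuous_on holomorphic_on_subset[OF f]) auto
  \<comment> \<open>The exponent 2/p makes \<open>H w powr p\<close> equal to (s - |w - z|)^2 |f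
    w|^p. The square matches the area of a ball around the maximiser, so the scale cancels at the
    end.\<close>
  define H where "H = (\<lambda>w. (s - cmod (w - z)) powr (2/p) * cmod (f w))"
  have "continuous_on (cball z s) H"
    unfolding H_def using p
    by (intro continuous_intros fc continuous_on_powr') (auto simp: dist_norm norm_minus_commute)
  then obtain w0 where w0: "w0 \<in> cball z s" and mx: "\<And>w. w \<in> cball z s \<Longrightarrow> H w \<le> H w0"
    using continuous_attains_sup[of "cball z s" H] s by auto
  show ?thesis
  proof (cases "f z = 0 \<or> ?I = \<infinity>")
    case True
    then show ?thesis using r by (auto simp: ennreal_mult_top)
  next
    case False
    then obtain I where I: "?I = ennreal I" "I \<ge> 0"
      by (metis enn2real_nonneg ennreal_enn2real infinity_ennreal_def less_top)
    have Hz: "H z = s powr (2/p) * cmod (f z)" by (simp add: H_def)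
    have "H w0 > 0"
      using mx[of z] s False unfolding Hz by (smt (verit) centre_in_cball mult_pos_pos powr_gt_zero zero_less_norm_iff)
    then have fw0: "f w0 \<noteq> 0" and lt: "cmod (w0 - z) < s"
      using w0 by (auto simp: H_def dist_norm norm_minus_commute order_less_le)
    \<comment> \<open>Within half of the distance to the boundary, s - |w - z| drops by at most a
      factor 2; hence the bound 2^(2/p) |f w0| for |f| on this ball.\<close>
    define \<rho> where "\<rho> = (s - cmod (w0 - z)) / 2"
    have \<rho>: "\<rho> > 0" using lt by (simp add: \<rho>_def)
    have two_rho: "2 * \<rho> = s - cmod (w0 - z)" by (simp add: \<rho>_def)
    have near: "w \<in> cball z s" "\<rho> \<le> s - cmod (w - z)" if "w \<in> ball w0 \<rho>" for w
    proof -
      have "cmod (w - z) \<le> cmod (w - w0) + cmod (w0 - z)"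
        by (metis diff_add_cancel add_diff_eq norm_triangle_ineq)
      with that have "cmod (w - z) \<le> \<rho> + cmod (w0 - z)" by (simp add: dist_norm norm_minus_commute)
      then show "\<rho> \<le> s - cmod (w - z)" by (simp add: \<rho>_def field_simps)
      then show "w \<in> cball z s" using \<rho> by (simp add: dist_norm norm_minus_commute)
    qed
    have sub: "ball w0 \<rho> \<subseteq> ball z r"
      using near(1) s by (force simp: dist_norm)
    define K where "K = 2 powr (2/p) * cmod (f w0)"
    have Kpos: "K > 0" using fw0 by (simp add: K_def)
    have K: "cmod (f w) \<le> K" if "w \<in> ball w0 \<rho>" for w
    proof -
      have "\<rho> powr (2/p) * cmod (f w) \<le> H w"
        unfolding H_def using near[OF that] \<rho> p by (intro mult_right_mono powr_mono2) auto
      also have "\<dots> \<le> H w0" by (rule mx[OF near(1)[OF that]])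
      also have "H w0 = (2 * \<rho>) powr (2/p) * cmod (f w0)" by (simp add: H_def two_rho)
      also have "\<dots> = \<rho> powr (2/p) * K" using \<rho> by (simp add: K_def powr_mult)
      finally show ?thesis using \<rho> by simp
    qed
    have [measurable]: "(\<lambda>w. ennreal (cmod (f w) powr p) * indicator (ball z r) w) \<in> borel_measurable borel"
      by (rule borel_measurable_holomorphic_indicator[OF f]) simp
    have "ennreal (cmod (f w0) * (pi * \<rho>\<^sup>2)) \<le> (\<integral>\<^sup>+w\<in>ball w0 \<rho>. ennreal (cmod (f w)) \<partial>lborel)"
      by (rule area_mean_le[OF holomorphic_on_subset[OF f sub] \<rho>])
    also have "\<dots> \<le> (\<integral>\<^sup>+w. ennreal (K powr (1 - p)) * (ennreal (cmod (f w) powr p) * indicator (ball z r) w) \<partial>lborel)"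
    proof (intro nn_integral_mono)
      fix w
      have "ennreal (cmod (f w)) \<le> ennreal (K powr (1 - p)) * ennreal (cmod (f w) powr p)" if w: "w \<in> ball w0 \<rho>"
      proof -
        have "cmod (f w) = cmod (f w) powr (1 - p) * cmod (f w) powr p"
          by (simp flip: powr_add)
        also have "\<dots> \<le> K powr (1 - p) * cmod (f w) powr p"
          using K[OF w] p by (intro mult_right_mono powr_mono2) auto
        finally show ?thesis by (simp add: ennreal_leI flip: ennreal_mult)
      qed
      then show "ennreal (cmod (f w)) * indicator (ball w0 \<rho>) w \<le>
         ennreal (K powr (1 - p)) * (ennreal (cmod (f w) powr p) * indicator (ball z r) w)"
        using sub by (auto simp: indicator_def)
    qed
    also have "\<dots> = ennreal (K powr (1 - p) * I)"
      by (simp add: nn_integral_cmult I ennreal_mult)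
    finally have "cmod (f w0) * (pi * \<rho>\<^sup>2) \<le> K powr (1 - p) * I"
      using I by (subst (asm) ennreal_le_iff) auto
    also have "\<dots> = 2 powr (2/p * (1 - p)) * cmod (f w0) powr (1 - p) * I"
      by (simp add: K_def powr_mult powr_powr)
    also have "\<dots> \<le> 2 powr (2/p) * cmod (f w0) powr (1 - p) * I"
      using p I by (intro mult_right_mono powr_mono) (auto simp: field_simps)
    finally have "cmod (f w0) * (pi * \<rho>\<^sup>2) \<le> cmod (f w0) powr (1 - p) * (2 powr (2/p) * I)"
      by (simp add: mult_ac)
    then have main: "cmod (f w0) powr p * (pi * \<rho>\<^sup>2) \<le> 2 powr (2/p) * I"
      using fw0 by (intro powr_le_cancel) auto
    have "H z powr p \<le> H w0 powr p"
      using mx[of z] s p by (intro powr_mono2) (auto simp: H_def)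
    moreover have "H z powr p = s\<^sup>2 * cmod (f z) powr p"
      unfolding Hz using s p by (simp add: powr_mult powr_powr)
    moreover have "H w0 powr p = (2 * \<rho>)\<^sup>2 * cmod (f w0) powr p"
    proof -
      have "H w0 = (2 * \<rho>) powr (2/p) * cmod (f w0)" by (simp add: H_def two_rho)
      then show ?thesis using \<rho> p by (simp add: powr_mult powr_powr)
    qed
    \<comment> \<open>A factor 4 from s = r/2 and another from (2 \<rho>)^2 make 16.\<close>
    ultimately have "r\<^sup>2 * cmod (f z) powr p \<le> 16 * (\<rho>\<^sup>2 * cmod (f w0) powr p)"
      by (simp add: s_def power2_eq_square)
    then have "pi * r\<^sup>2 * cmod (f z) powr p \<le> 16 * (cmod (f w0) powr p * (pi * \<rho>\<^sup>2))"
      using mult_left_mono[of "r\<^sup>2 * cmod (f z) powr p" _ pi] by (simp add: mult_ac)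
    also have "\<dots> \<le> 16 * (2 powr (2/p) * I)"
      using main by simp
    finally have "cmod (f z) powr p \<le> 16 * 2 powr (2 / p) / (pi * r\<^sup>2) * I"
      using r by (simp add: field_simps)
    then show ?thesis
      unfolding I using r I(2) by (simp add: ennreal_leI flip: ennreal_mult)
  qed
qed

lemma powr_submean:
  assumes p: "0 < p"
  obtains C where "C > 0" and "\<And>f z r. f holomorphic_on ball z r \<Longrightarrow> r > 0 \<Longrightarrow>
    ennreal (cmod (f z) powr p) \<le> ennreal (C * r powr (-2)) * (\<integral>\<^sup>+w\<in>ball z r. ennreal (cmod (f w) powr p) \<partial>lborel)"
proof (cases "p \<ge> 1")
  case True
  show ?thesis
    by (rule that[of "2 powr p / pi"])
       (use powr_submean_ge1[OF _ _ True] in \<open>auto simp: powr_minus field_simps\<close>)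
next
  case False
  show ?thesis
    by (rule that[of "16 * 2 powr (2 / p) / pi"])
       (use powr_submean_le1[OF _ _ p] False in \<open>auto simp: powr_minus field_simps\<close>)
qed

text \<open>Cauchy's inequality on the circle of radius r/2, where |f| is bounded by the submean
  property on balls of radius r/2; these stay inside the ball of radius r. C is chosen before f, z
  and r, so the power of r carries the whole scaling.\<close>

lemma higher_deriv_local_estimate:
  assumes p: "0 < p"
  obtains C where "C > 0" and "\<And>f z r. f holomorphic_on ball z r \<Longrightarrow> r > 0 \<Longrightarrow>
    ennreal (cmod ((deriv ^^ k) f z) powr p)
      \<le> ennreal (C * r powr (-2 - k * p)) * (\<integral>\<^sup>+w\<in>ball z r. ennreal (cmod (f w) powr p) \<partial>lborel)"
proof -
  obtain C where C: "C > 0" and est: "\<And>f z r. f holomorphic_on ball z r \<Longrightarrow> r > 0 \<Longrightarrow>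
    ennreal (cmod (f z) powr p) \<le> ennreal (C * r powr (-2)) * (\<integral>\<^sup>+w\<in>ball z r. ennreal (cmod (f w) powr p) \<partial>lborel)"
    using powr_submean[OF p] by blast
  define C' where "C' = (fact k * 2 ^ k) powr p * (4 * C)"
  have "C' > 0" using C by (simp add: C'_def)
  moreover have "ennreal (cmod ((deriv ^^ k) f z) powr p)
      \<le> ennreal (C' * r powr (-2 - k * p)) * (\<integral>\<^sup>+w\<in>ball z r. ennreal (cmod (f w) powr p) \<partial>lborel)"
    (is "_ \<le> _ * ?I") if f: "f holomorphic_on ball z r" and r: "r > 0" for f z r
  proof (cases "?I = \<infinity>")
    case True
    then show ?thesis using r \<open>C' > 0\<close> by (simp add: ennreal_mult_top)
  next
    case False
    then obtain I where I: "?I = ennreal I" "I \<ge> 0"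
      by (metis enn2real_nonneg ennreal_enn2real infinity_ennreal_def less_top)
    define B where "B = (4 * C * r powr (-2) * I) powr (1/p)"
    have bd: "cmod (f w) \<le> B" if "cmod (z - w) = r / 2" for w
    proof -
      have sub: "ball w (r/2) \<subseteq> ball z r"
      proof
        fix x assume "x \<in> ball w (r/2)"
        then show "x \<in> ball z r"
          using that dist_triangle[of z x w] by (simp add: dist_norm)
      qed
      have "ennreal (cmod (f w) powr p) \<le> ennreal (C * (r/2) powr (-2)) * (\<integral>\<^sup>+x\<in>ball w (r/2). ennreal (cmod (f x) powr p) \<partial>lborel)"
        using r by (intro est holomorphic_on_subset[OF f sub]) auto
      also have "\<dots> \<le> ennreal (C * (r/2) powr (-2)) * ?I"
        using sub by (intro mult_left_mono nn_integral_mono) (auto simp: indicator_def)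
      also have "\<dots> = ennreal (4 * C * r powr (-2) * I)"
        unfolding I using C r I(2) by (simp add: powr_divide powr_minus field_simps flip: ennreal_mult)
      finally have "cmod (f w) powr p \<le> 4 * C * r powr (-2) * I"
        using C I by (subst (asm) ennreal_le_iff) auto
      then have "(cmod (f w) powr p) powr (1/p) \<le> B"
        unfolding B_def using p by (intro powr_mono2) auto
      then show ?thesis using p by (simp add: powr_powr)
    qed
    have "cmod ((deriv ^^ k) f z) \<le> fact k * B / (r/2) ^ k"
    proof (rule Cauchy_inequality[OF _ _ _ bd])
      show "f holomorphic_on ball z (r/2)"
        using r by (intro holomorphic_on_subset[OF f]) auto
      show "continuous_on (cball z (r/2)) f"
        using r by (intro holomorphic_on_imp_continuous_on holomorphic_on_subset[OF f]) auto
    qed (use r in auto)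
    also have "\<dots> = (fact k * 2 ^ k) * B * r powr (- real k)"
      using r by (simp add: powr_minus powr_realpow field_simps)
    finally have "cmod ((deriv ^^ k) f z) powr p \<le> ((fact k * 2 ^ k) * B * r powr (- real k)) powr p"
      using p by (intro powr_mono2) auto
    also have "\<dots> = (fact k * 2 ^ k) powr p * B powr p * r powr (- (k * p))"
      by (simp add: powr_mult powr_powr B_def)
    also have "B powr p = 4 * C * r powr (-2) * I"
      using p C I by (simp add: B_def powr_powr)
    also have "(fact k * 2 ^ k) powr p * (4 * C * r powr (-2) * I) * r powr (- (k * p))
       = C' * (r powr (-2) * r powr (- (k * p))) * I"
      by (simp add: C'_def mult_ac)
    also have "r powr (-2) * r powr (- (k * p)) = r powr (-2 - k * p)"
      by (simp flip: powr_add)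
    finally show ?thesis
      unfolding I using r I(2) \<open>C' > 0\<close> by (simp add: ennreal_leI flip: ennreal_mult)
  qed
  ultimately show thesis by (rule that)
qed

section \<open>Lattices in the disc\<close>

abbreviation bdist :: "complex \<Rightarrow> real" where "bdist z \<equiv> 1 - cmod z"

lemma bdist_le_dist: "bdist z \<le> bdist a + dist a z"
  using norm_triangle_ineq2[of a z] by (simp add: dist_norm norm_minus_commute)

text \<open>Euclidean balls whose radius is a fixed fraction of the distance to the circle stand in
  for hyperbolic discs. Separation ranges over ordered pairs, so it holds with the larger of the two
  distances.\<close>

locale disc_lattice =
  fixes A :: "complex set"
  assumes subset_disc: "A \<subseteq> disc"
    and separated: "\<And>a b. a \<in> A \<Longrightarrow> b \<in> A \<Longrightarrow> a \<noteq> b \<Longrightarrow> bdist a / 8 \<le> dist a b"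
    and covering: "\<And>z. z \<in> disc \<Longrightarrow> \<exists>a\<in>A. z \<in> ball a (bdist a / 4)"

text \<open>A separated set that is maximal, by Zorn's lemma, must cover: a point left uncovered
  could be added to it.\<close>

lemma ex_disc_lattice: "\<exists>A. disc_lattice A"
proof -
  define \<S> where "\<S> = {A. A \<subseteq> disc \<and> (\<forall>a\<in>A. \<forall>b\<in>A. a \<noteq> b \<longrightarrow> bdist a / 8 \<le> dist a b)}"
  have "\<exists>M\<in>\<S>. \<forall>X\<in>\<S>. M \<subseteq> X \<longrightarrow> X = M"
  proof (rule subset_Zorn')
    fix C assume C: "subset.chain \<S> C"
    have "bdist a / 8 \<le> dist a b" if ab: "a \<in> \<Union>C" "b \<in> \<Union>C" "a \<noteq> b" for a b
    proof -
      obtain X Y where "X \<in> C" "Y \<in> C" "a \<in> X" "b \<in> Y" using ab by auto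
      then have "\<exists>Z\<in>C. a \<in> Z \<and> b \<in> Z"
        using C unfolding subset.chain_def by blast
      then show ?thesis
        using C ab(3) unfolding subset.chain_def \<S>_def by blast
    qed
    then show "\<Union>C \<in> \<S>"
      using C unfolding subset.chain_def \<S>_def by auto
  qed
  then obtain A where A: "A \<in> \<S>" and mx: "\<And>X. X \<in> \<S> \<Longrightarrow> A \<subseteq> X \<Longrightarrow> X = A" by blast
  have "disc_lattice A"
  proof
    show "A \<subseteq> disc" using A by (simp add: \<S>_def)
    show "bdist a / 8 \<le> dist a b" if "a \<in> A" "b \<in> A" "a \<noteq> b" for a b
      using A that by (simp add: \<S>_def)
    fix z assume z: "z \<in> disc"
    show "\<exists>a\<in>A. z \<in> ball a (bdist a / 4)"
    proof (cases "z \<in> A")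
      case True
      then show ?thesis using z by (intro bexI[of _ z]) auto
    next
      case False
      then have "insert z A \<notin> \<S>" using mx[of "insert z A"] by auto
      then obtain x y where xy: "x \<in> insert z A" "y \<in> insert z A" "x \<noteq> y" "dist x y < bdist x / 8"
        using A z by (auto simp: \<S>_def not_le)
      have "\<not> (x \<in> A \<and> y \<in> A)"
        using A xy(3,4) unfolding \<S>_def by fastforce
      then obtain a where a: "a \<in> A" and or: "dist a z < bdist a / 8 \<or> dist a z < bdist z / 8"
        using xy by (auto simp: dist_commute)
      have "a \<in> disc" using A a by (auto simp: \<S>_def)
      \<comment> \<open>In the second case \<open>bdist z\<close> is at most
        \<open>bdist a + dist a z\<close>, which gives dist a z < (1 - |a|) / 7. The covering
        fraction therefore exceeds the separation fraction 1/8; the value 1/4 leaves room.\<close>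
      then have "dist a z < bdist a / 4"
        using or bdist_le_dist[of z a] by auto
      then show ?thesis using a by auto
    qed
  qed
  then show ?thesis ..
qed

context disc_lattice
begin

lemma bdist_pos: "a \<in> A \<Longrightarrow> 0 < bdist a"
  using subset_disc by auto

lemma disjoint_balls:
  assumes "a \<in> A" "b \<in> A" "a \<noteq> b"
  shows "ball a (bdist a / 16) \<inter> ball b (bdist b / 16) = {}"
proof -
  have "bdist a / 8 \<le> dist a b" "bdist b / 8 \<le> dist a b"
    using separated[of a b] separated[of b a] assms by (auto simp: dist_commute)
  then show ?thesis
    by (intro disjoint_ballI) linarith
qed

lemma countable: "countable A"
proof -
  let ?B = "\<lambda>a. ball a (bdist a / 16)"
  have ne: "a \<in> ?B a" if "a \<in> A" for a
    using bdist_pos[OF that] by simp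
  have "inj_on ?B A"
    using disjoint_balls ne by (fastforce intro!: inj_onI)
  moreover have "countable (?B ` A)"
    using disjoint_balls by (intro countable_disjoint_open_subsets) (auto simp: pairwise_def disjnt_def)
  ultimately show ?thesis
    using countable_image_inj_on by blast
qed

text \<open>Lattice sums are compared with area integrals: the balls of radius
  \<open>bdist a / 16\<close> are disjoint and have area pi (1 - |a|)^2 / 256.\<close>

lemma sum_le_nn_integral:
  assumes F: "finite F" "F \<subseteq> A" and [measurable]: "g \<in> borel_measurable borel"
    and le: "\<And>a w. a \<in> F \<Longrightarrow> w \<in> ball a (bdist a / 16) \<Longrightarrow> h a \<le> g w"
  shows "(\<Sum>a\<in>F. h a * ennreal ((bdist a)\<^sup>2)) \<le> ennreal (256 / pi) * (\<integral>\<^sup>+w. g w \<partial>lborel)"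
proof -
  let ?B = "\<lambda>a. ball a (bdist a / 16)"
  have [measurable]: "?B a \<in> sets borel" for a by simp
  have "(\<Sum>a\<in>F. h a * ennreal ((bdist a)\<^sup>2)) \<le> (\<Sum>a\<in>F. ennreal (256 / pi) * (\<integral>\<^sup>+w. g w * indicator (?B a) w \<partial>lborel))"
  proof (intro sum_mono)
    fix a assume a: "a \<in> F"
    then have b: "bdist a > 0" using F bdist_pos by auto
    have "ennreal ((bdist a)\<^sup>2) = ennreal (256 / pi) * ennreal (pi * (bdist a / 16)\<^sup>2)"
      by (simp add: power_divide flip: ennreal_mult)
    also have "ennreal (pi * (bdist a / 16)\<^sup>2) = emeasure lborel (?B a)"
      using b by (subst emeasure_ball_complex) auto
    finally have eq: "h a * ennreal ((bdist a)\<^sup>2) = ennreal (256 / pi) * (h a * emeasure lborel (?B a))"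
      by (simp add: mult_ac)
    have "h a * emeasure lborel (?B a) = (\<integral>\<^sup>+w. h a * indicator (?B a) w \<partial>lborel)"
      by (simp add: nn_integral_cmult_indicator)
    also have "\<dots> \<le> (\<integral>\<^sup>+w. g w * indicator (?B a) w \<partial>lborel)"
      using le[OF a] by (intro nn_integral_mono) (auto simp: indicator_def)
    finally show "h a * ennreal ((bdist a)\<^sup>2) \<le> ennreal (256 / pi) * (\<integral>\<^sup>+w. g w * indicator (?B a) w \<partial>lborel)"
      unfolding eq by (rule mult_left_mono) simp
  qed
  also have "\<dots> = ennreal (256 / pi) * (\<integral>\<^sup>+w. (\<Sum>a\<in>F. g w * indicator (?B a) w) \<partial>lborel)"
    by (subst nn_integral_sum) (auto simp: sum_distrib_left)
  also have "\<dots> \<le> ennreal (256 / pi) * (\<integral>\<^sup>+w. g w \<partial>lborel)"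
  proof (intro mult_left_mono nn_integral_mono)
    fix w
    show "(\<Sum>a\<in>F. g w * indicator (?B a) w) \<le> g w"
    proof (cases "\<exists>a\<in>F. w \<in> ?B a")
      case True
      then obtain a where a: "a \<in> F" "w \<in> ?B a" by blast
      have "(\<Sum>b\<in>F. g w * indicator (?B b) w) = (\<Sum>b\<in>{a}. g w * indicator (?B b) w)"
        using F a disjoint_balls[of a] by (intro sum.mono_neutral_right) (auto simp: indicator_def disjoint_iff subset_eq)
      also have "\<dots> = g w * indicator (?B a) w"
        by (subst sum.insert) simp_all
      finally show ?thesis using a by simp
    next
      case False
      then have "(\<Sum>a\<in>F. g w * indicator (?B a) w) = 0"
        by (intro sum.neutral) auto
      then show ?thesis by simp
    qed
  qed simp
  finally show ?thesis .
qed

text \<open>Volume count: the centres of the balls that contain z have distance to the circle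
  between 2/3 and 2 times \<open>bdist z\<close>, and their disjoint small balls fit into the ball
  of radius \<open>2 * bdist z\<close> around z. This yields 2304 = 1024 / (4/9). The radius here is
  twice the covering radius because the local estimates spill over into these larger balls.\<close>

lemma overlap:
  assumes z: "z \<in> disc"
  shows "finite {a\<in>A. z \<in> ball a (bdist a / 2)}" "card {a\<in>A. z \<in> ball a (bdist a / 2)} \<le> 2304"
proof -
  have "card G \<le> 2304" if G: "G \<subseteq> {a\<in>A. z \<in> ball a (bdist a / 2)}" "finite G" for G
  proof -
    have zp: "bdist z > 0" using z by simp
    have near: "2/3 * bdist z \<le> bdist a" "bdist a \<le> 2 * bdist z" if "a \<in> G" for a
      using G that bdist_le_dist[of a z] bdist_le_dist[of z a] by (auto simp: dist_commute)
    have "(\<Sum>a\<in>G. 1 * ennreal ((bdist a)\<^sup>2)) \<le> ennreal (256 / pi) * (\<integral>\<^sup>+w. indicator (ball z (2 * bdist z)) w \<partial>lborel)"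
    proof (rule sum_le_nn_integral)
      fix a w assume a: "a \<in> G" and w: "w \<in> ball a (bdist a / 16)"
      then have "dist z w < 2 * bdist z"
        using near[OF a] G dist_triangle[of z w a] zp by (auto simp: dist_commute)
      then show "1 \<le> (indicator (ball z (2 * bdist z)) w :: ennreal)" by simp
    next
      show "(indicator (ball z (2 * bdist z)) :: complex \<Rightarrow> ennreal) \<in> borel_measurable borel"
        by (rule borel_measurable_indicator) simp
    qed (use G in auto)
    also have "\<dots> = ennreal (256 / pi) * ennreal (pi * (2 * bdist z)\<^sup>2)"
      using zp by (simp add: emeasure_ball_complex)
    also have "\<dots> = ennreal (1024 * (bdist z)\<^sup>2)"
    proof -
      have eq: "1024 * (bdist z)\<^sup>2 = 256 / pi * (pi * (2 * bdist z)\<^sup>2)"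
        by (simp add: power2_eq_square algebra_simps)
      show ?thesis
        unfolding eq by (rule ennreal_mult[symmetric]) auto
    qed
    finally have "ennreal (\<Sum>a\<in>G. (bdist a)\<^sup>2) \<le> ennreal (1024 * (bdist z)\<^sup>2)"
      by (simp add: sum_ennreal)
    then have 1: "(\<Sum>a\<in>G. (bdist a)\<^sup>2) \<le> 1024 * (bdist z)\<^sup>2"
      by (subst (asm) ennreal_le_iff) auto
    have "of_nat (card G) * (2/3 * bdist z)\<^sup>2 \<le> (\<Sum>a\<in>G. (bdist a)\<^sup>2)"
      using near zp by (intro sum_bounded_below power_mono) auto
    moreover have "(2/3 * bdist z)\<^sup>2 = 4/9 * (bdist z)\<^sup>2"
      unfolding power_mult_distrib by (simp add: power_divide)
    ultimately have "(real (card G) * (4/9)) * (bdist z)\<^sup>2 \<le> 1024 * (bdist z)\<^sup>2"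
      using 1 by (simp only: mult.assoc)
    then have "real (card G) * (4/9) \<le> 1024"
      using zp by (subst (asm) mult_le_cancel_right) auto
    then show ?thesis by simp
  qed
  then have "finite {a\<in>A. z \<in> ball a (bdist a / 2)} \<and> card {a\<in>A. z \<in> ball a (bdist a / 2)} \<le> 2304"
    by (rule finite_if_finite_subsets_card_bdd)
  then show "finite {a\<in>A. z \<in> ball a (bdist a / 2)}" "card {a\<in>A. z \<in> ball a (bdist a / 2)} \<le> 2304"
    by auto
qed

lemma sum_indicator_le:
  assumes F: "finite F" "F \<subseteq> A" and z: "z \<in> disc" and M: "\<And>a. a \<in> F \<Longrightarrow> z \<in> ball a (bdist a / 2) \<Longrightarrow> h a \<le> M"
    and h: "\<And>a. a \<in> F \<Longrightarrow> z \<notin> ball a (bdist a / 2) \<Longrightarrow> h a = 0"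
  shows "(\<Sum>a\<in>F. h a) \<le> 2304 * (M :: ennreal)"
proof -
  have "(\<Sum>a\<in>F. h a) = (\<Sum>a\<in>F \<inter> {a\<in>A. z \<in> ball a (bdist a / 2)}. h a)"
    using F h by (intro sum.mono_neutral_right) auto
  also have "\<dots> \<le> of_nat (card (F \<inter> {a\<in>A. z \<in> ball a (bdist a / 2)})) * M"
    using M by (intro sum_bounded_above) auto
  also have "\<dots> \<le> of_nat 2304 * M"
    using order_trans[OF card_mono[OF overlap(1)[OF z]] overlap(2)[OF z]]
    by (intro mult_right_mono of_nat_mono) auto
  finally show ?thesis by simp
qed

text \<open>Moving from a to a point w of its small ball changes |z - a| by less than
  \<open>bdist a\<close>, which the first summand of the kernel absorbs; this reduces the sum to the
  plane kernel. It evaluates the total weight in Schur's test.\<close>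

lemma sum_kernel_le:
  assumes F: "finite F" "F \<subseteq> A" and z: "z \<in> disc" and \<sigma>: "\<sigma> > 0"
  shows "(\<Sum>a\<in>F. (bdist a)\<^sup>2 * (bdist a + bdist z + cmod (z - a)) powr (-2 - \<sigma>))
     \<le> 4096 / (pi * \<sigma>\<^sup>2) * bdist z powr (-\<sigma>)"
proof -
  have zp: "bdist z > 0" using z by simp
  let ?K = "\<lambda>a. (bdist a + bdist z + cmod (z - a)) powr (-2 - \<sigma>)"
  have "ennreal (\<Sum>a\<in>F. (bdist a)\<^sup>2 * ?K a) = (\<Sum>a\<in>F. ennreal (?K a) * ennreal ((bdist a)\<^sup>2))"
    by (simp add: sum_ennreal mult.commute flip: ennreal_mult)
  also have "\<dots> \<le> ennreal (256 / pi) * (\<integral>\<^sup>+w. ennreal ((bdist z + cmod (w - z)) powr (-2 - \<sigma>)) \<partial>lborel)"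
  proof (rule sum_le_nn_integral[OF F])
    fix a w assume a: "a \<in> F" and w: "w \<in> ball a (bdist a / 16)"
    have "0 < bdist a" using a F bdist_pos by auto
    then have "cmod (w - z) \<le> bdist a + cmod (z - a)"
      using w dist_triangle[of z w a] by (auto simp: dist_norm norm_minus_commute)
    then show "ennreal (?K a) \<le> ennreal ((bdist z + cmod (w - z)) powr (-2 - \<sigma>))"
      using zp \<sigma> norm_ge_zero[of "w - z"] by (intro ennreal_leI powr_mono2') (auto simp del: norm_ge_zero)
  qed measurable
  also have "\<dots> \<le> ennreal (256 / pi) * ennreal (16 / \<sigma>\<^sup>2 * bdist z powr (-\<sigma>))"
    by (intro mult_left_mono nn_integral_plane_kernel_le zp \<sigma>) auto
  also have "\<dots> = ennreal (4096 / (pi * \<sigma>\<^sup>2) * bdist z powr (-\<sigma>))"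
    by (simp flip: ennreal_mult)
  finally show ?thesis
    by (subst (asm) ennreal_le_iff) auto
qed

end

section \<open>Power inequalities for finite sums\<close>

lemma powr_sum_le_sum_powr:
  fixes y :: "'a \<Rightarrow> real"
  assumes F: "finite F" and y: "\<And>a. a \<in> F \<Longrightarrow> y a \<ge> 0" and p: "0 < p" "p \<le> 1"
  shows "(\<Sum>a\<in>F. y a) powr p \<le> (\<Sum>a\<in>F. y a powr p)"
proof (cases "(\<Sum>a\<in>F. y a) = 0")
  case True
  then show ?thesis by (simp add: sum_nonneg)
next
  case False
  define S where "S = (\<Sum>a\<in>F. y a)"
  have S: "S > 0" using False sum_nonneg[of F y] y by (simp add: S_def order_less_le)
  have "S powr p = S powr p * (\<Sum>a\<in>F. y a / S)"
    using S by (simp add: S_def flip: sum_divide_distrib)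
  also have "\<dots> \<le> S powr p * (\<Sum>a\<in>F. (y a / S) powr p)"
  proof (intro mult_left_mono sum_mono)
    fix a assume a: "a \<in> F"
    have "y a \<le> S" unfolding S_def using F a y by (intro member_le_sum) auto
    then have "(y a / S) powr 1 \<le> (y a / S) powr p"
      using S y[OF a] p by (intro powr_mono') (auto simp: field_simps)
    then show "y a / S \<le> (y a / S) powr p" using S y[OF a] by simp
  qed simp
  also have "\<dots> = (\<Sum>a\<in>F. y a powr p)"
    using S y by (simp add: sum_distrib_left powr_divide)
  finally show ?thesis by (simp add: S_def)
qed

text \<open>Hoelder's inequality with weights, up to the factor 2^p. The threshold splitting is
  applied to each quotient y/w with T = S / (2 W), so that the sum of the w T is half of S and is
  absorbed.\<close>

lemma powr_sum_weighted_le: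
  fixes y w :: "'a \<Rightarrow> real"
  assumes F: "finite F" "F \<noteq> {}" and y: "\<And>a. a \<in> F \<Longrightarrow> y a \<ge> 0" and w: "\<And>a. a \<in> F \<Longrightarrow> w a > 0" and p: "1 \<le> p"
  shows "(\<Sum>a\<in>F. y a) powr p \<le> 2 powr p * (\<Sum>a\<in>F. w a) powr (p - 1) * (\<Sum>a\<in>F. w a powr (1 - p) * y a powr p)"
proof (cases "(\<Sum>a\<in>F. y a) = 0")
  case True
  then show ?thesis by (simp add: sum_nonneg)
next
  case False
  define S where "S = (\<Sum>a\<in>F. y a)"
  define W where "W = (\<Sum>a\<in>F. w a)"
  define V where "V = (\<Sum>a\<in>F. w a powr (1 - p) * y a powr p)"
  have S: "S > 0" using False sum_nonneg[of F y] y by (simp add: S_def order_less_le)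
  have W: "W > 0" unfolding W_def using F w by (intro sum_pos) auto
  define T where "T = S / (2 * W)"
  have T: "T > 0" using S W by (simp add: T_def)
  have "S \<le> (\<Sum>a\<in>F. w a * (T + (y a / w a) powr p * T powr (1 - p)))"
    unfolding S_def
  proof (intro sum_mono)
    fix a assume a: "a \<in> F"
    have "y a = w a * (y a / w a)" using w[OF a] by simp
    also have "\<dots> \<le> w a * (T + (y a / w a) powr p * T powr (1 - p))"
      using w[OF a] y[OF a] T p by (intro mult_left_mono le_add_powr_scaled) auto
    finally show "y a \<le> w a * (T + (y a / w a) powr p * T powr (1 - p))" .
  qed
  also have "\<dots> = (\<Sum>a\<in>F. w a * T + T powr (1 - p) * (w a powr (1 - p) * y a powr p))"
  proof (intro sum.cong refl)
    fix a assume a: "a \<in> F"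
    have "w a * (y a / w a) powr p = w a powr (1 - p) * y a powr p"
      using w[OF a] y[OF a] by (simp add: powr_divide powr_diff field_simps)
    then show "w a * (T + (y a / w a) powr p * T powr (1 - p)) = w a * T + T powr (1 - p) * (w a powr (1 - p) * y a powr p)"
      by (simp add: algebra_simps)
  qed
  also have "\<dots> = W * T + T powr (1 - p) * V"
    by (simp add: sum.distrib W_def V_def sum_distrib_left sum_distrib_right)
  finally have "T * W \<le> T powr (1 - p) * V"
    using W by (simp add: T_def field_simps)
  then have "T powr p * W \<le> V" by (rule powr_le_cancel[OF T])
  then have "2 powr p * W powr (p - 1) * (T powr p * W) \<le> 2 powr p * W powr (p - 1) * V"
    by (intro mult_left_mono) auto
  moreover have "2 powr p * W powr (p - 1) * (T powr p * W) = S powr p"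
  proof -
    have "W powr (p - 1) * W = W powr p" using W powr_add[of W "p - 1" 1] by simp
    then have "2 powr p * W powr (p - 1) * (T powr p * W) = 2 powr p * W powr p * T powr p"
      by (simp add: mult_ac)
    also have "\<dots> = S powr p"
      using S W by (simp add: T_def powr_divide powr_mult)
    finally show ?thesis .
  qed
  ultimately show ?thesis
    unfolding S_def[symmetric] W_def[symmetric] V_def[symmetric] by linarith
qed

section \<open>Test functions and their synthesis\<close>

text \<open>The usual kernel at a has its pole at 1 / cnj a. Moving it to distance bdist a from the disc on the
  ray through a keeps the pole near the disc also for a near 0.\<close>

definition pole :: "complex \<Rightarrow> complex" where
  "pole a = (1 + bdist a) *\<^sub>R (if a = 0 then 1 else sgn a)"

lemma norm_pole:
  assumes "a \<in> disc"
  shows "cmod (pole a) = 1 + bdist a"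
  using assms by (auto simp: pole_def norm_sgn)

lemma norm_pole_diff:
  assumes "a \<in> disc"
  shows "cmod (pole a - a) = 2 * bdist a"
proof (cases "a = 0")
  case False
  have "pole a - a = (1 + bdist a) *\<^sub>R sgn a - cmod a *\<^sub>R sgn a"
    using False by (simp add: pole_def sgn_div_norm)
  also have "\<dots> = (2 * bdist a) *\<^sub>R sgn a"
    unfolding scaleR_left_diff_distrib[symmetric] by (rule arg_cong[of _ _ "\<lambda>x. x *\<^sub>R sgn a"]) simp
  finally have "pole a - a = (2 * bdist a) *\<^sub>R sgn a" .
  then show ?thesis using assms False by (simp add: norm_sgn)
qed (simp add: pole_def)

text \<open>With P the pole, 1 - |a| and 1 - |z| add up to at most |P - z|, and |z - a| exceeds |P -
  z| by at most 2 (1 - |a|). The symmetric quantity on the left is the one in the kernel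
  estimates.\<close>

lemma pole_far:
  assumes a: "a \<in> disc" and z: "z \<in> disc"
  shows "bdist a + bdist z + cmod (z - a) \<le> 4 * cmod (pole a - z)"
proof -
  have 1: "bdist a + bdist z \<le> cmod (pole a - z)"
    using norm_triangle_ineq2[of "pole a" z] norm_pole[OF a] by simp
  have "cmod (z - a) \<le> cmod (z - pole a) + cmod (pole a - a)"
    by (metis diff_add_cancel add_diff_eq norm_triangle_ineq)
  then have "cmod (z - a) \<le> cmod (pole a - z) + 2 * bdist a"
    using norm_pole_diff[OF a] by (simp add: norm_minus_commute)
  with 1 z show ?thesis by simp
qed

lemma pole_outside:
  assumes "a \<in> disc" "z \<in> disc"
  shows "pole a - z \<noteq> 0"
  using norm_pole[OF assms(1)] assms by auto

lemma pole_near: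
  assumes a: "a \<in> disc" and z: "z \<in> ball a (bdist a / 4)"
  shows "cmod (pole a - z) \<le> 3 * bdist a"
proof -
  have "cmod (pole a - z) \<le> cmod (pole a - a) + cmod (a - z)"
    by (metis diff_add_cancel add_diff_eq norm_triangle_ineq)
  then show ?thesis using z a by (simp add: norm_pole_diff[OF a] dist_norm)
qed

text \<open>On the covering ball around a, of area comparable to (1 - |a|)^2, the modulus is
  comparable to (1 - |a|)^(-2/p). The power of \<open>bdist a\<close> thus normalises the p-th
  integral uniformly in a when m p > 2.\<close>

definition atom :: "real \<Rightarrow> nat \<Rightarrow> complex \<Rightarrow> complex \<Rightarrow> complex" where
  "atom p m a z = of_real (bdist a powr (m - 2 / p)) * inverse (pole a - z) ^ m"

lemma norm_atom_le:
  assumes a: "a \<in> disc" and z: "z \<in> disc"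
  shows "cmod (atom p m a z)
    \<le> 4 ^ m * (bdist a powr (m - 2 / p) * (bdist a + bdist z + cmod (z - a)) powr (- real m))"
proof -
  let ?D = "bdist a + bdist z + cmod (z - a)"
  have D: "?D > 0" using a z by (simp add: add_pos_nonneg)
  have "inverse (cmod (pole a - z)) \<le> 4 * inverse ?D"
    using pole_far[OF a z] D pole_outside[OF a z] by (simp add: field_simps)
  then have "inverse (cmod (pole a - z)) ^ m \<le> (4 * inverse ?D) ^ m"
    by (intro power_mono) auto
  also have "\<dots> = 4 ^ m * ?D powr (- real m)"
    using D by (simp add: power_mult_distrib powr_minus powr_realpow power_inverse)
  finally have "bdist a powr (m - 2 / p) * inverse (cmod (pole a - z)) ^ m
      \<le> bdist a powr (m - 2 / p) * (4 ^ m * ?D powr (- real m))"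
    by (intro mult_left_mono) auto
  then show ?thesis
    by (simp add: atom_def norm_mult norm_power norm_inverse mult_ac)
qed

lemma holomorphic_atom: "a \<in> disc \<Longrightarrow> atom p m a holomorphic_on disc"
  unfolding atom_def using pole_outside by (auto intro!: holomorphic_intros)

lemma has_field_derivative_inverse_power:
  fixes P z :: complex
  assumes "P - z \<noteq> 0"
  shows "((\<lambda>z. inverse (P - z) ^ j) has_field_derivative of_nat j * inverse (P - z) ^ Suc j) (at z)"
proof (cases j)
  case (Suc i)
  have "((\<lambda>z. inverse (P - z)) has_field_derivative inverse (P - z) * inverse (P - z)) (at z)"
    using assms by (auto intro!: derivative_eq_intros)
  from DERIV_power[OF this, of j] show ?thesis
    by (simp add: Suc mult_ac)
qed simp

text \<open>The sign of the inner derivative cancels that of the exponent, so the factors m, m + 1,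
  ... accumulate to a Pochhammer symbol. The sum goes through the induction as a whole, since
  \<open>deriv\<close> commutes with sums only where the summands are differentiable.\<close>

lemma higher_deriv_sum_inverse_power:
  fixes P :: "'a \<Rightarrow> complex"
  assumes F: "\<And>a z. a \<in> F \<Longrightarrow> z \<in> S \<Longrightarrow> P a - z \<noteq> 0" and S: "open S" and z: "z \<in> S"
  shows "(deriv ^^ k) (\<lambda>z. \<Sum>a\<in>F. c a * inverse (P a - z) ^ m) z
    = (\<Sum>a\<in>F. c a * (pochhammer (of_nat m) k * inverse (P a - z) ^ (m + k)))"
  using z
proof (induction k arbitrary: z)
  case (Suc k)
  let ?g = "\<lambda>z. \<Sum>a\<in>F. c a * (pochhammer (of_nat m) k * inverse (P a - z) ^ (m + k))"
  have "(?g has_field_derivative (\<Sum>a\<in>F. c a * (pochhammer (of_nat m) k * (of_nat (m + k) * inverse (P a - z) ^ Suc (m + k))))) (at z)"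
    using F Suc.prems by (intro DERIV_sum DERIV_cmult has_field_derivative_inverse_power) auto
  then have "((deriv ^^ k) (\<lambda>z. \<Sum>a\<in>F. c a * inverse (P a - z) ^ m) has_field_derivative
      (\<Sum>a\<in>F. c a * (pochhammer (of_nat m) k * (of_nat (m + k) * inverse (P a - z) ^ Suc (m + k))))) (at z)"
    by (rule has_field_derivative_transform_within_open[OF _ S Suc.prems]) (simp add: Suc.IH)
  then show ?case
    by (simp add: DERIV_imp_deriv pochhammer_Suc mult_ac)
qed simp

lemma higher_deriv_atoms:
  assumes "F \<subseteq> disc" "z \<in> disc"
  shows "(deriv ^^ k) (\<lambda>z. \<Sum>a\<in>F. c a * atom p m a z) z
    = (\<Sum>a\<in>F. c a * (of_real (bdist a powr (m - 2 / p)) * (pochhammer (of_nat m) k * inverse (pole a - z) ^ (m + k))))"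
proof -
  have "(deriv ^^ k) (\<lambda>z. \<Sum>a\<in>F. (c a * of_real (bdist a powr (m - 2 / p))) * inverse (pole a - z) ^ m) z
    = (\<Sum>a\<in>F. (c a * of_real (bdist a powr (m - 2 / p))) * (pochhammer (of_nat m) k * inverse (pole a - z) ^ (m + k)))"
    using assms pole_outside by (intro higher_deriv_sum_inverse_power[where S = disc]) blast+
  then show ?thesis
    by (simp only: atom_def mult.assoc)
qed

text \<open>Once the power -m of P - z is pulled out, the quantities u k z (P - z)^(-k) in the
  remaining sum do not depend on m; only their Pochhammer coefficients do. Different m thus give a
  linear system for the same unknowns.\<close>

lemma sobolev_op_atom:
  assumes "a \<in> disc" "z \<in> disc"
  shows "sobolev_op n u (atom p m a) z = of_real (bdist a powr (m - 2 / p)) * inverse (pole a - z) ^ m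
     * (\<Sum>k\<le>n. pochhammer (of_nat m) k * (u k z * inverse (pole a - z) ^ k))"
  using higher_deriv_atoms[of "{a}" z _ "\<lambda>_. 1" p m] assms
  by (simp add: sobolev_op_def sum_distrib_left power_add mult_ac)

lemma sobolev_op_atoms:
  assumes "F \<subseteq> disc" "z \<in> disc"
  shows "sobolev_op n u (\<lambda>z. \<Sum>a\<in>F. c a * atom p m a z) z = (\<Sum>a\<in>F. c a * sobolev_op n u (atom p m a) z)"
proof -
  have "(deriv ^^ k) (\<lambda>z. \<Sum>a\<in>F. c a * atom p m a z) z = (\<Sum>a\<in>F. c a * (deriv ^^ k) (atom p m a) z)" for k
    unfolding higher_deriv_atoms[OF assms]
    using higher_deriv_atoms[of "{a}" z k "\<lambda>_. 1" p m for a] assms by (intro sum.cong) auto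
  then show ?thesis
    unfolding sobolev_op_def
    by (simp add: sum_distrib_left mult.left_commute sum.swap[of _ "{..n}"])
qed

section \<open>Norm estimates for sums of atoms\<close>

context disc_lattice
begin

text \<open>For p <= 1 subadditivity of x^p separates the atoms, and each is integrated over the
  whole plane; m p > 2 makes this integral converge.\<close>

lemma synthesis_kernel_le1:
  assumes p: "0 < p" "p \<le> 1" and m: "m * p > 2"
    and F: "finite F" "F \<subseteq> A" and l: "\<And>a. a \<in> F \<Longrightarrow> l a \<ge> 0"
  shows "(\<integral>\<^sup>+z\<in>disc. ennreal ((\<Sum>a\<in>F. l a * (bdist a powr (m - 2 / p)
        * (bdist a + bdist z + cmod (z - a)) powr (- real m))) powr p) \<partial>lborel)
    \<le> ennreal (16 / (m * p - 2)\<^sup>2 * (\<Sum>a\<in>F. l a powr p))"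
proof -
  let ?K = "\<lambda>a z. (bdist a + cmod (z - a)) powr (-2 - (m * p - 2))"
  have pw: "ennreal ((\<Sum>a\<in>F. l a * (bdist a powr (m - 2 / p)
        * (bdist a + bdist z + cmod (z - a)) powr (- real m))) powr p) * indicator disc z
     \<le> (\<Sum>a\<in>F. ennreal (l a powr p * bdist a powr (m * p - 2)) * ennreal (?K a z))" for z
  proof (cases "z \<in> disc")
    case True
    have "(\<Sum>a\<in>F. l a * (bdist a powr (m - 2 / p) * (bdist a + bdist z + cmod (z - a)) powr (- real m))) powr p
      \<le> (\<Sum>a\<in>F. (l a * (bdist a powr (m - 2 / p) * (bdist a + bdist z + cmod (z - a)) powr (- real m))) powr p)"
      using l by (intro powr_sum_le_sum_powr F p) auto
    also have "\<dots> \<le> (\<Sum>a\<in>F. l a powr p * bdist a powr (m * p - 2) * ?K a z)"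
    proof (intro sum_mono)
      fix a assume a: "a \<in> F"
      then have b: "bdist a > 0" using F bdist_pos by auto
      have "(l a * (bdist a powr (m - 2 / p) * (bdist a + bdist z + cmod (z - a)) powr (- real m))) powr p
        = l a powr p * (bdist a powr ((m - 2/p) * p) * (bdist a + bdist z + cmod (z - a)) powr (- real m * p))"
        using l[OF a] by (simp add: powr_mult powr_powr)
      also have "(m - 2/p) * p = m * p - 2" using p by (simp add: field_simps)
      also have "(bdist a + bdist z + cmod (z - a)) powr (- real m * p) \<le> ?K a z"
      proof -
        have "0 < bdist a + cmod (z - a)" using b norm_ge_zero[of "z - a"] by linarith
        then have "(bdist a + bdist z + cmod (z - a)) powr (- real m * p) \<le> (bdist a + cmod (z - a)) powr (- real m * p)"
          using True m by (intro powr_mono2') auto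
        then show ?thesis by simp
      qed
      finally show "(l a * (bdist a powr (m - 2 / p) * (bdist a + bdist z + cmod (z - a)) powr (- real m))) powr p
        \<le> l a powr p * bdist a powr (m * p - 2) * ?K a z"
        by (simp add: mult.assoc mult_left_mono)
    qed
    finally show ?thesis using True
      by (simp add: sum_ennreal ennreal_leI flip: ennreal_mult)
  qed simp
  have "(\<integral>\<^sup>+z\<in>disc. ennreal ((\<Sum>a\<in>F. l a * (bdist a powr (m - 2 / p)
        * (bdist a + bdist z + cmod (z - a)) powr (- real m))) powr p) \<partial>lborel)
     \<le> (\<integral>\<^sup>+z. (\<Sum>a\<in>F. ennreal (l a powr p * bdist a powr (m * p - 2)) * ennreal (?K a z)) \<partial>lborel)"
    by (intro nn_integral_mono pw)
  also have "\<dots> = (\<Sum>a\<in>F. ennreal (l a powr p * bdist a powr (m * p - 2)) * (\<integral>\<^sup>+z. ennreal (?K a z) \<partial>lborel))"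
    by (simp add: nn_integral_sum nn_integral_cmult)
  also have "\<dots> \<le> (\<Sum>a\<in>F. ennreal (16 / (m * p - 2)\<^sup>2 * l a powr p))"
  proof (intro sum_mono)
    fix a assume a: "a \<in> F"
    then have b: "bdist a > 0" using F bdist_pos by auto
    have "ennreal (l a powr p * bdist a powr (m * p - 2)) * (\<integral>\<^sup>+z. ennreal (?K a z) \<partial>lborel)
      \<le> ennreal (l a powr p * bdist a powr (m * p - 2)) * ennreal (16 / (m * p - 2)\<^sup>2 * bdist a powr (-(m * p - 2)))"
      using m by (intro mult_left_mono nn_integral_plane_kernel_le b) auto
    also have "\<dots> = ennreal ((l a powr p * bdist a powr (m * p - 2)) * (16 / (m * p - 2)\<^sup>2 * bdist a powr (-(m * p - 2))))"
      by (rule ennreal_mult[symmetric]) auto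
    also have "(l a powr p * bdist a powr (m * p - 2)) * (16 / (m * p - 2)\<^sup>2 * bdist a powr (-(m * p - 2)))
      = 16 / (m * p - 2)\<^sup>2 * l a powr p * (bdist a powr (m * p - 2) * bdist a powr (-(m * p - 2)))"
      by simp
    also have "bdist a powr (m * p - 2) * bdist a powr (-(m * p - 2)) = 1"
      using b by (simp flip: powr_add)
    finally show "ennreal (l a powr p * bdist a powr (m * p - 2)) * (\<integral>\<^sup>+z. ennreal (?K a z) \<partial>lborel)
      \<le> ennreal (16 / (m * p - 2)\<^sup>2 * l a powr p)" by simp
  qed
  also have "\<dots> = ennreal (16 / (m * p - 2)\<^sup>2 * (\<Sum>a\<in>F. l a powr p))"
    by (simp add: sum_ennreal sum_distrib_left)
  finally show ?thesis .
qed

text \<open>For p > 1 this is Schur's test with the weights (bdist a)^2 * D powr (-2 - \<sigma>).\<close>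

lemma synthesis_kernel_gt1:
  assumes p: "1 < p" and m: "m \<ge> 3"
    and F: "finite F" "F \<subseteq> A" and l: "\<And>a. a \<in> F \<Longrightarrow> l a \<ge> 0"
    and \<sigma>: "\<sigma> = 1 / (2 * (p - 1))" and \<tau>: "\<tau> = p * (real m - 2)"
  shows "(\<integral>\<^sup>+z\<in>disc. ennreal ((\<Sum>a\<in>F. l a * (bdist a powr (m - 2 / p)
        * (bdist a + bdist z + cmod (z - a)) powr (- real m))) powr p) \<partial>lborel)
    \<le> ennreal (2 powr p * (4096 / (pi * \<sigma>\<^sup>2)) powr (p - 1) * (256 / (\<tau> - 1)) * (\<Sum>a\<in>F. l a powr p))"
proof (cases "F = {}")
  case False
  \<comment> \<open>The value of \<sigma> is chosen so that the total weight, of size (1 -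
    |z|)^(-\<sigma>), becomes (1 - |z|)^(-1/2) after raising to the power p - 1: integrable up to
    the circle, and the exponent of \<open>nn_integral_disc_kernel_le\<close>.\<close>
  have \<sigma>0: "\<sigma> > 0" and \<sigma>1: "\<sigma> * (p - 1) = 1/2" using p by (auto simp: \<sigma>)
  have "p * 1 \<le> p * (real m - 2)" using p m by (intro mult_left_mono) auto
  then have \<tau>1: "\<tau> > 1" unfolding \<tau> using p by linarith
  define C1 where "C1 = 4096 / (pi * \<sigma>\<^sup>2)"
  have C1: "C1 > 0" using \<sigma>0 by (simp add: C1_def)
  define c where "c = 2 powr p * C1 powr (p - 1)"
  have c: "c \<ge> 0" by (simp add: c_def)
  let ?D = "\<lambda>a z. bdist a + bdist z + cmod (z - a)"
  let ?K = "\<lambda>a z. bdist z powr (-1/2) * ?D a z powr (-3/2 - \<tau>)"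
  have pw: "ennreal ((\<Sum>a\<in>F. l a * (bdist a powr (m - 2 / p) * ?D a z powr (- real m))) powr p) * indicator disc z
     \<le> (\<Sum>a\<in>F. ennreal (c * l a powr p * bdist a powr \<tau>) * (ennreal (?K a z) * indicator disc z))" for z
  proof (cases "z \<in> disc")
    case True
    then have zp: "bdist z > 0" by simp
    have D: "?D a z > 0" if "a \<in> F" for a
      using bdist_pos[OF subsetD[OF F(2) that]] zp norm_ge_zero[of "z - a"] by linarith
    define w where "w = (\<lambda>a. (bdist a)\<^sup>2 * ?D a z powr (-2 - \<sigma>))"
    have w: "w a > 0" if "a \<in> F" for a
      using bdist_pos[of a] that F D[OF that] by (auto simp: w_def)
    have W0: "(\<Sum>a\<in>F. w a) > 0" using w F False by (intro sum_pos) auto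
    have "(\<Sum>a\<in>F. w a) powr (p - 1) \<le> (C1 * bdist z powr (-\<sigma>)) powr (p - 1)"
      using sum_kernel_le[OF F True \<sigma>0] p W0 by (intro powr_mono2) (auto simp: w_def C1_def)
    also have "\<dots> = C1 powr (p - 1) * bdist z powr (-1/2)"
    proof -
      have "-\<sigma> * (p - 1) = -1/2" using \<sigma>1 by linarith
      then show ?thesis using C1 by (simp only: powr_mult powr_powr)
    qed
    finally have W: "(\<Sum>a\<in>F. w a) powr (p - 1) \<le> C1 powr (p - 1) * bdist z powr (-1/2)" .
    \<comment> \<open>Raising to the power p and dividing by w^(p - 1) leaves \<open>?D a z\<close>
      with the exponent -3/2 - \<tau>, where \<tau> = p (m - 2). Since m >= 3 and p > 1, \<tau>
      exceeds 1, as the disc kernel requires.\<close>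
    have e: "w a powr (1 - p) * (l a * (bdist a powr (m - 2 / p) * ?D a z powr (- real m))) powr p
       = l a powr p * bdist a powr \<tau> * ?D a z powr (-3/2 - \<tau>)" if a: "a \<in> F" for a
    proof -
      have b: "bdist a > 0" using a F bdist_pos by auto
      have w': "w a = bdist a powr 2 * ?D a z powr (-2 - \<sigma>)" using b by (simp add: w_def)
      have "w a powr (1 - p) * (l a * (bdist a powr (m - 2 / p) * ?D a z powr (- real m))) powr p
        = l a powr p * (bdist a powr (2 * (1 - p)) * bdist a powr ((m - 2/p) * p))
          * (?D a z powr ((-2 - \<sigma>) * (1 - p)) * ?D a z powr (- real m * p))"
        using l[OF a] by (simp add: w' powr_mult powr_powr mult_ac)
      also have "bdist a powr (2 * (1 - p)) * bdist a powr ((m - 2/p) * p) = bdist a powr \<tau>"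
        using p by (simp add: \<tau> field_simps flip: powr_add)
      also have "?D a z powr ((-2 - \<sigma>) * (1 - p)) * ?D a z powr (- real m * p) = ?D a z powr ((-2 - \<sigma>) * (1 - p) - m * p)"
        by (simp flip: powr_add)
      also have "(-2 - \<sigma>) * (1 - p) - m * p = -3/2 - \<tau>"
        using \<sigma>1 by (simp add: \<tau> algebra_simps)
      finally show ?thesis .
    qed
    have "(\<Sum>a\<in>F. l a * (bdist a powr (m - 2 / p) * ?D a z powr (- real m))) powr p
      \<le> 2 powr p * (\<Sum>a\<in>F. w a) powr (p - 1) * (\<Sum>a\<in>F. w a powr (1 - p) * (l a * (bdist a powr (m - 2 / p) * ?D a z powr (- real m))) powr p)"
      using l p w False by (intro powr_sum_weighted_le F) auto
    also have "\<dots> = 2 powr p * (\<Sum>a\<in>F. w a) powr (p - 1) * (\<Sum>a\<in>F. l a powr p * bdist a powr \<tau> * ?D a z powr (-3/2 - \<tau>))"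
      using e by simp
    also have "\<dots> \<le> 2 powr p * (C1 powr (p - 1) * bdist z powr (-1/2)) * (\<Sum>a\<in>F. l a powr p * bdist a powr \<tau> * ?D a z powr (-3/2 - \<tau>))"
      by (intro mult_right_mono mult_left_mono W sum_nonneg) auto
    also have "\<dots> = (\<Sum>a\<in>F. (c * l a powr p * bdist a powr \<tau>) * ?K a z)"
      by (simp add: sum_distrib_left c_def mult_ac)
    finally show ?thesis using True c
      by (simp add: sum_ennreal ennreal_leI flip: ennreal_mult)
  qed simp
  have [measurable]: "disc \<in> sets borel" by simp
  have "(\<integral>\<^sup>+z\<in>disc. ennreal ((\<Sum>a\<in>F. l a * (bdist a powr (m - 2 / p) * ?D a z powr (- real m))) powr p) \<partial>lborel)
     \<le> (\<integral>\<^sup>+z. (\<Sum>a\<in>F. ennreal (c * l a powr p * bdist a powr \<tau>) * (ennreal (?K a z) * indicator disc z)) \<partial>lborel)"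
    by (intro nn_integral_mono pw)
  also have "\<dots> = (\<Sum>a\<in>F. ennreal (c * l a powr p * bdist a powr \<tau>) * (\<integral>\<^sup>+z\<in>disc. ennreal (?K a z) \<partial>lborel))"
    by (simp add: nn_integral_sum nn_integral_cmult)
  also have "\<dots> \<le> (\<Sum>a\<in>F. ennreal (c * (256 / (\<tau> - 1)) * l a powr p))"
  proof (intro sum_mono)
    fix a assume a: "a \<in> F"
    then have b: "bdist a > 0" using F bdist_pos by auto
    have "ennreal (c * l a powr p * bdist a powr \<tau>) * (\<integral>\<^sup>+z\<in>disc. ennreal (?K a z) \<partial>lborel)
      \<le> ennreal (c * l a powr p * bdist a powr \<tau>) * ennreal (256 / (\<tau> - 1) * bdist a powr (-\<tau>))"
      using b \<tau>1 by (intro mult_left_mono nn_integral_disc_kernel_le) auto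
    also have "\<dots> = ennreal ((c * l a powr p * bdist a powr \<tau>) * (256 / (\<tau> - 1) * bdist a powr (-\<tau>)))"
      using c \<tau>1 by (intro ennreal_mult[symmetric]) auto
    also have "(c * l a powr p * bdist a powr \<tau>) * (256 / (\<tau> - 1) * bdist a powr (-\<tau>))
      = c * (256 / (\<tau> - 1)) * l a powr p * (bdist a powr \<tau> * bdist a powr (-\<tau>))"
      by simp
    also have "bdist a powr \<tau> * bdist a powr (-\<tau>) = 1"
      using b by (simp flip: powr_add)
    finally show "ennreal (c * l a powr p * bdist a powr \<tau>) * (\<integral>\<^sup>+z\<in>disc. ennreal (?K a z) \<partial>lborel)
      \<le> ennreal (c * (256 / (\<tau> - 1)) * l a powr p)" by simp
  qed
  also have "\<dots> = ennreal (c * (256 / (\<tau> - 1)) * (\<Sum>a\<in>F. l a powr p))"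
    using c \<tau>1 by (simp add: sum_ennreal sum_distrib_left)
  finally show ?thesis unfolding c_def C1_def .
qed simp

text \<open>The atoms are replaced by the positive kernels that dominate them, so only the moduli of
  the coefficients enter and arbitrary signs become admissible. The constant is fixed before F and
  c.\<close>

lemma synthesis:
  assumes p: "0 < p" and m: "m \<ge> 3" "m * p > 2"
  obtains C where "C > 0" and "\<And>F c. finite F \<Longrightarrow> F \<subseteq> A \<Longrightarrow>
     (\<integral>\<^sup>+z\<in>disc. ennreal (cmod (\<Sum>a\<in>F. c a * atom p m a z) powr p) \<partial>lborel)
       \<le> ennreal (C * (\<Sum>a\<in>F. cmod (c a) powr p))"
proof -
  let ?X = "\<lambda>a z. bdist a powr (m - 2 / p) * (bdist a + bdist z + cmod (z - a)) powr (- real m)"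
  obtain C where C: "C > 0" and bound: "\<And>F l. finite F \<Longrightarrow> F \<subseteq> A \<Longrightarrow> (\<And>a. a \<in> F \<Longrightarrow> l a \<ge> 0) \<Longrightarrow>
     (\<integral>\<^sup>+z\<in>disc. ennreal ((\<Sum>a\<in>F. l a * ?X a z) powr p) \<partial>lborel) \<le> ennreal (C * (\<Sum>a\<in>F. l a powr p))"
  proof (cases "p \<le> 1")
    case True
    show ?thesis
      by (rule that[of "16 / (m * p - 2)\<^sup>2"]) (use synthesis_kernel_le1[OF p True m(2)] m in auto)
  next
    case False
    then have p1: "1 < p" by simp
    define \<sigma> where "\<sigma> = 1 / (2 * (p - 1))"
    define \<tau> where "\<tau> = p * (real m - 2)"
    have "p * 1 \<le> p * (real m - 2)" using p m by (intro mult_left_mono) auto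
    then have \<tau>1: "\<tau> > 1" unfolding \<tau>_def using p1 by linarith
    have \<sigma>0: "\<sigma> > 0" using p1 by (simp add: \<sigma>_def)
    show ?thesis
    proof (rule that)
      show "2 powr p * (4096 / (pi * \<sigma>\<^sup>2)) powr (p - 1) * (256 / (\<tau> - 1)) > 0"
        using \<sigma>0 \<tau>1 by auto
    qed (rule synthesis_kernel_gt1[OF p1 m(1) _ _ _ \<sigma>_def \<tau>_def])
  qed
  show thesis
  proof (rule that)
    show "4 powr (m * p) * C > 0" using C by simp
    fix F c assume F: "finite F" "F \<subseteq> A"
    have le: "cmod (\<Sum>a\<in>F. c a * atom p m a z) \<le> (\<Sum>a\<in>F. (4 ^ m * cmod (c a)) * ?X a z)" if z: "z \<in> disc" for z
    proof (rule sum_norm_le)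
      fix a assume a: "a \<in> F"
      then have "cmod (c a) * cmod (atom p m a z) \<le> cmod (c a) * (4 ^ m * ?X a z)"
        using F subset_disc z by (intro mult_left_mono norm_atom_le) auto
      then show "cmod (c a * atom p m a z) \<le> (4 ^ m * cmod (c a)) * ?X a z"
        by (simp add: norm_mult mult_ac)
    qed
    have "(\<integral>\<^sup>+z\<in>disc. ennreal (cmod (\<Sum>a\<in>F. c a * atom p m a z) powr p) \<partial>lborel)
      \<le> (\<integral>\<^sup>+z\<in>disc. ennreal ((\<Sum>a\<in>F. (4 ^ m * cmod (c a)) * ?X a z) powr p) \<partial>lborel)"
      using le p by (intro nn_integral_mono) (auto simp: indicator_def intro!: ennreal_leI powr_mono2)
    also have "\<dots> \<le> ennreal (C * (\<Sum>a\<in>F. (4 ^ m * cmod (c a)) powr p))"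
      by (rule bound[OF F]) simp
    also have "(\<Sum>a\<in>F. (4 ^ m * cmod (c a)) powr p) = 4 powr (m * p) * (\<Sum>a\<in>F. cmod (c a) powr p)"
      by (simp add: powr_mult sum_distrib_left powr_powr flip: powr_realpow)
    finally show "(\<integral>\<^sup>+z\<in>disc. ennreal (cmod (\<Sum>a\<in>F. c a * atom p m a z) powr p) \<partial>lborel)
      \<le> ennreal (4 powr (m * p) * C * (\<Sum>a\<in>F. cmod (c a) powr p))"
      by (simp add: mult_ac)
  qed
qed

end

section \<open>Necessity of Luecking's condition\<close>

text \<open>\<open>enn2real\<close> sends infinity to 0, so the norm gives back the integral only
  for members of the space.\<close>

lemma nn_integral_bergman_space:
  assumes p: "0 < p" and f: "f \<in> bergman_space p"
  shows "(\<integral>\<^sup>+z\<in>disc. ennreal (cmod (f z) powr p) \<partial>lborel) = ennreal (pi * bergman_norm p f powr p)"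
proof -
  let ?I = "\<integral>\<^sup>+z\<in>disc. ennreal (cmod (f z) powr p) \<partial>lborel"
  have "?I / ennreal pi < \<infinity>"
    using f by (simp add: bergman_space_def bergman_pnorm_pow_def)
  then have "?I \<noteq> \<infinity>" by (auto simp: ennreal_top_divide)
  then obtain r where r: "?I = ennreal r" "r \<ge> 0"
    by (metis enn2real_nonneg ennreal_enn2real infinity_ennreal_def less_top)
  have "bergman_pnorm_pow p f = ennreal (r / pi)"
    using r by (simp add: bergman_pnorm_pow_def divide_ennreal)
  then have "bergman_norm p f powr p = r / pi"
    using r p by (simp add: bergman_norm_def powr_powr)
  then show ?thesis using r by simp
qed

lemma bergman_space_boundI:
  assumes p: "0 < p" and q: "0 \<le> q" and f: "f holomorphic_on disc" and N: "N \<ge> 0"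
    and le: "(\<integral>\<^sup>+z\<in>disc. ennreal (cmod (f z) powr p) \<partial>lborel) \<le> ennreal N"
  shows "f \<in> bergman_space p" "bergman_norm p f powr q \<le> N powr (q / p)"
proof -
  let ?I = "\<integral>\<^sup>+z\<in>disc. ennreal (cmod (f z) powr p) \<partial>lborel"
  obtain r where r: "?I = ennreal r" "r \<ge> 0"
    using le by (cases "?I" rule: ennreal_cases) (auto simp: top_unique)
  then have rN: "r \<le> N" using le N by simp
  have e: "bergman_pnorm_pow p f = ennreal (r / pi)"
    using r by (simp add: bergman_pnorm_pow_def divide_ennreal)
  then show "f \<in> bergman_space p" using f by (simp add: bergman_space_def)
  have "r / pi \<le> r / 1" using r(2) pi_ge_two by (intro divide_left_mono) auto
  then have "r / pi \<le> N" using rN by simp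
  moreover have "bergman_norm p f powr q = (r / pi) powr (q / p)"
    using e r by (simp add: bergman_norm_def powr_powr)
  ultimately show "bergman_norm p f powr q \<le> N powr (q / p)"
    using r p q by (auto intro!: powr_mono2)
qed

lemma space_disc_borel_measure: "disc_borel_measure \<mu> \<Longrightarrow> space \<mu> = disc"
  unfolding disc_borel_measure_def by (drule sets_eq_imp_space_eq) (simp add: space_restrict_space)

lemma measurable_disc_borel_measure:
  assumes "disc_borel_measure \<mu>" "f \<in> borel_measurable borel"
  shows "f \<in> borel_measurable \<mu>"
proof -
  have "f \<in> borel_measurable (restrict_space borel disc)"
    using assms(2) by (rule measurable_restrict_space1)
  then show ?thesis
    using assms(1) measurable_cong_sets unfolding disc_borel_measure_def by blast
qed

lemma measurable_holomorphic_disc: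
  assumes "disc_borel_measure \<mu>" "f holomorphic_on disc"
  shows "f \<in> borel_measurable \<mu>"
proof -
  have "f \<in> borel_measurable (restrict_space borel disc)"
    using assms(2) by (intro borel_measurable_continuous_on_restrict holomorphic_on_imp_continuous_on)
  then show ?thesis
    using assms(1) measurable_cong_sets unfolding disc_borel_measure_def by blast
qed

lemma holomorphic_sobolev_op:
  assumes "\<And>k. k \<le> n \<Longrightarrow> u k holomorphic_on disc" "f holomorphic_on disc"
  shows "sobolev_op n u f holomorphic_on disc"
  unfolding sobolev_op_def using assms
  by (intro holomorphic_intros holomorphic_higher_deriv) auto

text \<open>Comparison with the largest summand treats q below and above 1 alike, at the price of a
  constant that grows with the number of summands.\<close>

lemma powr_sum_le_card:
  fixes x :: "'a \<Rightarrow> real"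
  assumes I: "finite I" and x: "\<And>i. i \<in> I \<Longrightarrow> x i \<ge> 0" and q: "q > 0"
  shows "(\<Sum>i\<in>I. x i) powr q \<le> real (card I) powr q * (\<Sum>i\<in>I. x i powr q)"
proof (cases "I = {}")
  case False
  obtain j where j: "j \<in> I" and mx: "\<And>i. i \<in> I \<Longrightarrow> x i \<le> x j"
  proof -
    have "Max (x ` I) \<in> x ` I" using I False by (intro Max_in) auto
    then obtain j where "j \<in> I" "Max (x ` I) = x j" by auto
    then show thesis using that[of j] I by (metis Max_ge finite_imageI imageI)
  qed
  have "(\<Sum>i\<in>I. x i) \<le> real (card I) * x j"
    using mx by (intro sum_bounded_above) auto
  then have "(\<Sum>i\<in>I. x i) powr q \<le> (real (card I) * x j) powr q"
    using x q by (intro powr_mono2 sum_nonneg) auto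
  also have "\<dots> = real (card I) powr q * x j powr q"
    using x[OF j] by (simp add: powr_mult)
  also have "\<dots> \<le> real (card I) powr q * (\<Sum>i\<in>I. x i powr q)"
    using I j by (intro mult_left_mono member_le_sum) auto
  finally show ?thesis .
qed simp

text \<open>The elementary substitute for Khinchine's inequality: flipping only the sign of c a0 already
  bounds the average from below.\<close>

lemma sign_average_ge:
  fixes c :: "'a \<Rightarrow> complex"
  assumes F: "finite F" and a0: "a0 \<in> F" and q: "q > 0"
  shows "2 ^ card F * cmod (c a0) powr q \<le> 2 * (\<Sum>E\<in>Pow F. cmod (\<Sum>a\<in>F. (if a \<in> E then 1 else -1) * c a) powr q)"
proof -
  define G where "G = F - {a0}"
  have G: "F = insert a0 G" "a0 \<notin> G" "finite G" using F a0 by (auto simp: G_def)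
  define h where "h = (\<lambda>E. cmod (\<Sum>a\<in>F. (if a \<in> E then 1 else -1) * c a) powr q)"
  have inj: "inj_on (insert a0) (Pow G)"
    using G(2) by (auto simp: inj_on_def)
  have "(\<Sum>E\<in>Pow F. h E) = (\<Sum>E\<in>Pow G. h E) + (\<Sum>E\<in>insert a0 ` Pow G. h E)"
    unfolding G(1) Pow_insert using G by (intro sum.union_disjoint) auto
  also have "(\<Sum>E\<in>insert a0 ` Pow G. h E) = (\<Sum>E\<in>Pow G. h (insert a0 E))"
    by (simp add: sum.reindex[OF inj])
  finally have "(\<Sum>E\<in>Pow F. h E) = (\<Sum>E\<in>Pow G. h E + h (insert a0 E))"
    by (simp add: sum.distrib)
  also have "\<dots> \<ge> of_nat (card (Pow G)) * cmod (c a0) powr q"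
  proof (rule sum_bounded_below)
    fix E assume E: "E \<in> Pow G"
    define R where "R = (\<Sum>a\<in>G. (if a \<in> E then 1 else -1) * c a)"
    have "h E = cmod (R - c a0) powr q"
      unfolding h_def G(1) using G E by (subst sum.insert) (auto simp: R_def)
    moreover have "h (insert a0 E) = cmod (R + c a0) powr q"
    proof -
      have "(\<Sum>a\<in>G. (if a \<in> insert a0 E then 1 else -1) * c a) = R"
        unfolding R_def using G by (intro sum.cong) auto
      then show ?thesis
        unfolding h_def G(1) using G by (subst sum.insert) (auto simp: add.commute)
    qed
    \<comment> \<open>The two sums differ by 2 c a0, so one of them has modulus at least |c a0|
      whatever R is. There are half as many pairs as subsets, whence the factor 2 in the
      statement.\<close>
    moreover have "cmod (c a0) powr q \<le> cmod (R - c a0) powr q + cmod (R + c a0) powr q"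
    proof -
      have "cmod ((R + c a0) - (R - c a0)) \<le> cmod (R + c a0) + cmod (R - c a0)"
        by (rule norm_triangle_ineq4)
      moreover have "(R + c a0) - (R - c a0) = 2 * c a0" by simp
      ultimately have "2 * cmod (c a0) \<le> cmod (R + c a0) + cmod (R - c a0)"
        by (simp only: norm_mult norm_numeral)
      then have "cmod (c a0) \<le> cmod (R - c a0) \<or> cmod (c a0) \<le> cmod (R + c a0)" by linarith
      then have "cmod (c a0) powr q \<le> cmod (R - c a0) powr q \<or> cmod (c a0) powr q \<le> cmod (R + c a0) powr q"
        using q by (auto intro: powr_mono2)
      then show ?thesis
        using powr_ge_zero[of "cmod (R - c a0)" q] powr_ge_zero[of "cmod (R + c a0)" q] by linarith
    qed
    ultimately show "cmod (c a0) powr q \<le> h E + h (insert a0 E)" by simp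
  qed
  finally have "2 ^ card G * cmod (c a0) powr q \<le> (\<Sum>E\<in>Pow F. h E)"
    using G by (simp add: card_Pow)
  moreover have "card F = Suc (card G)" using G by simp
  ultimately show ?thesis by (simp add: h_def)
qed

text \<open>Inverting the system in v by differencing in M, which lowers the degree of the
  Pochhammer polynomials by one.\<close>

lemma pochhammer_system_bound:
  "\<exists>C>0. \<forall>v :: nat \<Rightarrow> complex. \<forall>k\<le>n. cmod (v k)
    \<le> C * (\<Sum>i\<le>n. cmod (\<Sum>k\<le>n. pochhammer (of_nat (M + i)) k * v k))"
\<comment> \<open>Differencing the equations moves the base point from M to M + 1, so the induction
  runs over all M.\<close>
proof (induction n arbitrary: M)
  case 0
  show ?case by (intro exI[of _ 1]) auto
next
  case (Suc n)
  obtain C where C: "C > 0" and IH: "\<And>v k. k \<le> n \<Longrightarrow> cmod (v k)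
    \<le> C * (\<Sum>i\<le>n. cmod (\<Sum>k\<le>n. pochhammer (of_nat (Suc M + i)) k * v k :: complex))"
    using Suc[of "Suc M"] by blast
  define B where "B = (\<Sum>k\<le>n. cmod (pochhammer (of_nat M) (Suc k)))"
  have B: "B \<ge> 0" by (simp add: B_def sum_nonneg)
  have "cmod (v k) \<le> (2 * C + 1 + B * (2 * C)) * (\<Sum>i\<le>Suc n. cmod (\<Sum>k\<le>Suc n. pochhammer (of_nat (M + i)) k * v k))"
    if k: "k \<le> Suc n" for v :: "nat \<Rightarrow> complex" and k
  proof -
    define X where "X = (\<lambda>i. \<Sum>k\<le>Suc n. pochhammer (of_nat (M + i)) k * v k)"
    define T where "T = (\<Sum>i\<le>Suc n. cmod (X i))"
    have T: "T \<ge> 0" by (simp add: T_def sum_nonneg)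
    have poch: "pochhammer (x + 1) (Suc k) - pochhammer x (Suc k) = of_nat (Suc k) * pochhammer (x + 1) k" for x :: complex and k
    proof -
      have "pochhammer x (Suc k) = x * pochhammer (x + 1) k" by (rule pochhammer_rec)
      moreover have "pochhammer (x + 1) (Suc k) = pochhammer (x + 1) k * (x + 1 + of_nat k)" by (rule pochhammer_Suc)
      ultimately show ?thesis by (simp add: algebra_simps)
    qed
    \<comment> \<open>The term of order 0 is constant in i and drops out: the differences form a
      system of the same kind, of degree n, for the unknowns (k + 1) v (k + 1).\<close>
    have diff: "X (Suc i) - X i = (\<Sum>k\<le>n. pochhammer (of_nat (Suc M + i)) k * (of_nat (Suc k) * v (Suc k)))" for i
    proof -
      have "X (Suc i) - X i = (\<Sum>k\<le>n. (pochhammer (of_nat (M + i) + 1) (Suc k) - pochhammer (of_nat (M + i)) (Suc k)) * v (Suc k))"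
        unfolding X_def sum.atMost_Suc_shift by (simp add: algebra_simps sum_subtractf del: pochhammer_Suc)
      also have "\<dots> = (\<Sum>k\<le>n. pochhammer (of_nat (Suc M + i)) k * (of_nat (Suc k) * v (Suc k)))"
        unfolding poch by (simp add: mult_ac add_ac)
      finally show ?thesis .
    qed
    have sh: "cmod (v (Suc j)) \<le> 2 * C * T" if "j \<le> n" for j
    proof -
      have "cmod (v (Suc j)) \<le> cmod (of_nat (Suc j) * v (Suc j))"
        unfolding norm_mult by (simp del: of_nat_Suc add: mult_le_cancel_right1)
      also have "\<dots> \<le> C * (\<Sum>i\<le>n. cmod (X (Suc i) - X i))"
        unfolding diff by (rule IH[OF that])
      also have "(\<Sum>i\<le>n. cmod (X (Suc i) - X i)) \<le> (\<Sum>i\<le>n. cmod (X (Suc i)) + cmod (X i))"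
        by (intro sum_mono norm_triangle_ineq4)
      also have "\<dots> = (\<Sum>i\<le>n. cmod (X (Suc i))) + (\<Sum>i\<le>n. cmod (X i))"
        by (rule sum.distrib)
      also have "(\<Sum>i\<le>n. cmod (X (Suc i))) \<le> T"
        unfolding T_def sum.atMost_Suc_shift by simp
      also have "(\<Sum>i\<le>n. cmod (X i)) \<le> T" unfolding T_def by simp
      finally show ?thesis using C by (simp add: mult_left_mono)
    qed
    show ?thesis
    proof (cases k)
      case 0
      \<comment> \<open>v 0 is recovered last, from the equation i = 0 alone, once the other
        unknowns are bounded.\<close>
      have "X 0 = v 0 + (\<Sum>k\<le>n. pochhammer (of_nat M) (Suc k) * v (Suc k))"
        unfolding X_def sum.atMost_Suc_shift by simp
      then have "cmod (v 0) \<le> cmod (X 0) + cmod (\<Sum>k\<le>n. pochhammer (of_nat M) (Suc k) * v (Suc k))"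
        by (metis add_diff_cancel_right' norm_triangle_ineq4)
      also have "cmod (X 0) \<le> T"
        unfolding T_def by (rule member_le_sum[of 0 _ "\<lambda>i. cmod (X i)"]) auto
      also have "cmod (\<Sum>k\<le>n. pochhammer (of_nat M) (Suc k) * v (Suc k)) \<le> (\<Sum>k\<le>n. cmod (pochhammer (of_nat M) (Suc k)) * (2 * C * T))"
        using sh by (intro sum_norm_le) (auto simp: norm_mult intro!: mult_left_mono)
      also have "\<dots> = B * (2 * C * T)" by (simp add: B_def sum_distrib_right)
      finally have "cmod (v 0) \<le> T + B * (2 * C * T)" by simp
      also have "\<dots> \<le> (2 * C + 1 + B * (2 * C)) * T" using C T by (simp add: algebra_simps)
      finally show ?thesis using 0 by (simp add: T_def X_def)
    next
      case (Suc j)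
      have "2 * C * T \<le> (2 * C + 1 + B * (2 * C)) * T"
        using B C T by (intro mult_right_mono) auto
      then show ?thesis using sh[of j] k Suc unfolding T_def X_def by simp
    qed
  qed
  moreover have "2 * C + 1 + B * (2 * C) > 0" using B C by (simp add: add_pos_nonneg)
  ultimately show ?case by blast
qed

text \<open>Invert the Pochhammer system for v k = u k z (P - z)^(-k), with P the pole of a, and
  scale back. On the covering ball |P - z| <= 3 (1 - |a|), which turns powers of P - z into powers
  of \<open>bdist a\<close>. The constant is chosen before u, a and z, so all lattice points share
  it.\<close>

lemma coefficient_le_sobolev_atoms:
  assumes q: "q > 0"
  shows "\<exists>C>0. \<forall>u k a z. k \<le> n \<longrightarrow> a \<in> disc \<longrightarrow> z \<in> disc \<longrightarrow> z \<in> ball a (bdist a / 4) \<longrightarrow>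
    cmod (u k z) powr q * bdist a powr (- (k * q) - 2 * q / p)
      \<le> C * (\<Sum>i\<le>n. cmod (sobolev_op n u (atom p (M + i) a) z) powr q)"
proof -
  obtain C where C: "C > 0" and inv: "\<And>v k. k \<le> n \<Longrightarrow> cmod (v k)
    \<le> C * (\<Sum>i\<le>n. cmod (\<Sum>k\<le>n. pochhammer (of_nat (M + i)) k * v k :: complex))"
    using pochhammer_system_bound[of n M] by blast
  \<comment> \<open>3^n comes from scaling back by the k-th power of P with k <= n, 3^(M + n) from
    clearing the powers M + i of its inverse, and C from the inverted system.\<close>
  define C' where "C' = 3 ^ n * C * 3 ^ (M + n)"
  have C': "C' > 0" using C by (simp add: C'_def)
  show ?thesis
  proof (intro exI[of _ "C' powr q * real (Suc n) powr q"] conjI allI impI)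
    show "C' powr q * real (Suc n) powr q > 0" using C' by simp
    fix u :: "nat \<Rightarrow> complex \<Rightarrow> complex" and k a z
    assume k: "k \<le> n" and a: "a \<in> disc" and z: "z \<in> disc" and za: "z \<in> ball a (bdist a / 4)"
    have d: "bdist a > 0" using a by simp
    define P where "P = pole a - z"
    have P0: "P \<noteq> 0" using pole_outside[OF a z] by (simp add: P_def)
    have P3: "cmod P \<le> 3 * bdist a" using pole_near[OF a za] by (simp add: P_def)
    define S where "S = (\<lambda>i. sobolev_op n u (atom p (M + i) a) z)"
    define v where "v = (\<lambda>k. u k z * inverse P ^ k)"
    have X: "cmod (\<Sum>k\<le>n. pochhammer (of_nat (M + i)) k * v k) \<le> 3 ^ (M + n) * bdist a powr (2 / p) * cmod (S i)"
      if i: "i \<le> n" for i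
    proof -
      let ?m = "M + i"
      have Seq: "S i = of_real (bdist a powr (?m - 2 / p)) * inverse P ^ ?m * (\<Sum>k\<le>n. pochhammer (of_nat ?m) k * v k)"
        unfolding S_def v_def P_def by (rule sobolev_op_atom[OF a z])
      have "cmod (\<Sum>k\<le>n. pochhammer (of_nat ?m) k * v k) = bdist a powr (2 / p - ?m) * cmod P ^ ?m * cmod (S i)"
      proof -
        have "bdist a powr (2 / p - ?m) * bdist a powr (?m - 2 / p) = 1"
          using d by (simp flip: powr_add)
        moreover have "cmod P ^ ?m * inverse (cmod P) ^ ?m = 1"
          using P0 by (simp flip: power_mult_distrib)
        moreover have "cmod (S i) = bdist a powr (?m - 2 / p) * inverse (cmod P) ^ ?m * cmod (\<Sum>k\<le>n. pochhammer (of_nat ?m) k * v k)"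
          unfolding Seq by (simp add: norm_mult norm_power norm_inverse)
        then have "bdist a powr (2 / p - ?m) * cmod P ^ ?m * cmod (S i)
          = (bdist a powr (2 / p - ?m) * bdist a powr (?m - 2 / p)) * (cmod P ^ ?m * inverse (cmod P) ^ ?m)
             * cmod (\<Sum>k\<le>n. pochhammer (of_nat ?m) k * v k)"
          by (simp only: mult_ac)
        ultimately show ?thesis by simp
      qed
      also have "\<dots> \<le> bdist a powr (2 / p - ?m) * (3 * bdist a) ^ ?m * cmod (S i)"
        using P3 by (intro mult_right_mono mult_left_mono power_mono) auto
      also have "bdist a powr (2 / p - ?m) * (3 * bdist a) ^ ?m = 3 ^ ?m * (bdist a powr (2 / p - ?m) * bdist a powr ?m)"
        unfolding powr_realpow[OF d] by (simp only: power_mult_distrib mult_ac)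
      also have "bdist a powr (2 / p - ?m) * bdist a powr ?m = bdist a powr (2 / p)"
        by (simp flip: powr_add)
      also have "3 ^ ?m * bdist a powr (2 / p) * cmod (S i) \<le> 3 ^ (M + n) * bdist a powr (2 / p) * cmod (S i)"
        using i by (intro mult_right_mono power_increasing) auto
      finally show ?thesis .
    qed
    have "u k z = v k * P ^ k" using P0 by (simp add: v_def power_inverse)
    then have "cmod (u k z) = cmod (v k) * cmod P ^ k" by (simp add: norm_mult norm_power)
    also have "\<dots> \<le> cmod (v k) * (3 * bdist a) ^ k"
      using P3 by (intro mult_left_mono power_mono) auto
    also have "\<dots> \<le> (C * (\<Sum>i\<le>n. 3 ^ (M + n) * bdist a powr (2 / p) * cmod (S i))) * (3 * bdist a) ^ k"
    proof (intro mult_right_mono)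
      have "cmod (v k) \<le> C * (\<Sum>i\<le>n. cmod (\<Sum>k\<le>n. pochhammer (of_nat (M + i)) k * v k))"
        by (rule inv[OF k])
      also have "\<dots> \<le> C * (\<Sum>i\<le>n. 3 ^ (M + n) * bdist a powr (2 / p) * cmod (S i))"
        using C by (intro mult_left_mono sum_mono X) auto
      finally show "cmod (v k) \<le> C * (\<Sum>i\<le>n. 3 ^ (M + n) * bdist a powr (2 / p) * cmod (S i))" .
    qed (use d in auto)
    also have "\<dots> = (3 ^ k * C * 3 ^ (M + n)) * (bdist a powr (2 / p) * bdist a ^ k) * (\<Sum>i\<le>n. cmod (S i))"
      unfolding sum_distrib_left[symmetric] power_mult_distrib by (simp only: mult_ac)
    also have "\<dots> \<le> C' * (bdist a powr (2 / p) * bdist a ^ k) * (\<Sum>i\<le>n. cmod (S i))"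
      unfolding C'_def using k C d by (intro mult_right_mono power_increasing) (auto intro: sum_nonneg)
    also have "bdist a powr (2 / p) * bdist a ^ k = bdist a powr (2 / p + k)"
      using d by (simp add: powr_add powr_realpow)
    finally have "cmod (u k z) powr q \<le> (C' * bdist a powr (2 / p + k) * (\<Sum>i\<le>n. cmod (S i))) powr q"
      using q by (intro powr_mono2) auto
    also have "\<dots> = C' powr q * bdist a powr ((2 / p + k) * q) * (\<Sum>i\<le>n. cmod (S i)) powr q"
      using C' by (simp add: powr_mult powr_powr sum_nonneg)
    also have "\<dots> \<le> C' powr q * bdist a powr ((2 / p + k) * q) * (real (Suc n) powr q * (\<Sum>i\<le>n. cmod (S i) powr q))"
      using powr_sum_le_card[of "{..n}" "\<lambda>i. cmod (S i)" q] q by (intro mult_left_mono) auto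
    finally have "cmod (u k z) powr q * bdist a powr (- (k * q) - 2 * q / p)
       \<le> (C' powr q * bdist a powr ((2 / p + k) * q) * (real (Suc n) powr q * (\<Sum>i\<le>n. cmod (S i) powr q)))
           * bdist a powr (- (k * q) - 2 * q / p)"
      by (intro mult_right_mono) auto
    also have "\<dots> = C' powr q * real (Suc n) powr q * (\<Sum>i\<le>n. cmod (S i) powr q)
       * (bdist a powr ((2 / p + k) * q) * bdist a powr (- (k * q) - 2 * q / p))"
      by (simp only: mult_ac)
    also have "bdist a powr ((2 / p + k) * q) * bdist a powr (- (k * q) - 2 * q / p) = 1"
      using d by (simp add: algebra_simps flip: powr_add)
    finally show "cmod (u k z) powr q * bdist a powr (- (k * q) - 2 * q / p)
      \<le> C' powr q * real (Suc n) powr q * (\<Sum>i\<le>n. cmod (sobolev_op n u (atom p (M + i) a) z) powr q)"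
      by (simp add: S_def)
  qed
qed

text \<open>Luecking's condition is that the sum of lattice_mass powr (p / (p - q)) over the lattice is finite.\<close>

definition lattice_mass :: "complex measure \<Rightarrow> (complex \<Rightarrow> complex) \<Rightarrow> nat \<Rightarrow> real \<Rightarrow> real \<Rightarrow> complex \<Rightarrow> ennreal" where
  "lattice_mass \<mu> v k p q a = (\<integral>\<^sup>+z\<in>ball a (bdist a / 4). ennreal (cmod (v z) powr q) \<partial>\<mu>)
     * ennreal (bdist a powr (- (k * q) - 2 * q / p))"

section \<open>Duality for the lattice masses\<close>

context disc_lattice
begin

text \<open>Apply the Carleson inequality to a sum of atoms with coefficients l a or - l a, and
  average over all choices of signs: the right side does not see them. On the left the average
  dominates each single term, and at most 2304 balls meet at a point, so the sum over a costs 2304;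
  with the 2 of \<open>sign_average_ge\<close> this gives 4608.\<close>

lemma sobolev_carleson_atoms:
  assumes sc: "sobolev_carleson n u p q \<mu>" and u: "\<And>k. k \<le> n \<Longrightarrow> u k holomorphic_on disc"
    and \<mu>: "disc_borel_measure \<mu>" and p: "0 < p" and q: "0 < q" and m: "m \<ge> 3" "m * p > 2"
  obtains K where "K > 0" and "\<And>F l. finite F \<Longrightarrow> F \<subseteq> A \<Longrightarrow> (\<And>a. a \<in> F \<Longrightarrow> l a \<ge> 0) \<Longrightarrow>
    (\<Sum>a\<in>F. ennreal (l a powr q) * (\<integral>\<^sup>+z\<in>ball a (bdist a / 4). ennreal (cmod (sobolev_op n u (atom p m a) z) powr q) \<partial>\<mu>))
      \<le> ennreal (K * (\<Sum>a\<in>F. l a powr p) powr (q / p))"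
proof -
  obtain C where C: "C > 0" and syn: "\<And>F c. finite F \<Longrightarrow> F \<subseteq> A \<Longrightarrow>
     (\<integral>\<^sup>+z\<in>disc. ennreal (cmod (\<Sum>a\<in>F. c a * atom p m a z) powr p) \<partial>lborel)
       \<le> ennreal (C * (\<Sum>a\<in>F. cmod (c a) powr p))"
    using synthesis[OF p m] by blast
  obtain C2 where C2: "C2 > 0" and car: "\<And>f. f \<in> bergman_space p \<Longrightarrow>
      (\<integral>\<^sup>+z. ennreal (cmod (sobolev_op n u f z) powr q) \<partial>\<mu>) \<le> ennreal (C2 * bergman_norm p f powr q)"
    using sc unfolding sobolev_carleson_def by blast
  show thesis
  proof (rule that)
    show "4608 * (C2 * C powr (q / p)) > 0" using C C2 by simp
    fix F and l :: "complex \<Rightarrow> real"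
    assume F: "finite F" "F \<subseteq> A" and l: "\<And>a. a \<in> F \<Longrightarrow> l a \<ge> 0"
    have Fd: "F \<subseteq> disc" using F subset_disc by auto
    define R where "R = C2 * (C * (\<Sum>a\<in>F. l a powr p)) powr (q / p)"
    define e where "e = (\<lambda>E a. (if a \<in> E then 1 else -1) * complex_of_real (l a))"
    define f where "f = (\<lambda>E z. \<Sum>a\<in>F. e E a * atom p m a z)"
    define S where "S = (\<lambda>a. sobolev_op n u (atom p m a))"
    have f_hol: "f E holomorphic_on disc" for E
      unfolding f_def using Fd by (intro holomorphic_intros holomorphic_atom) auto
    have S_meas [measurable]: "S a \<in> borel_measurable \<mu>" if "a \<in> F" for a
      unfolding S_def using that Fd u
      by (intro measurable_holomorphic_disc[OF \<mu>] holomorphic_sobolev_op holomorphic_atom) auto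
    have Sf_meas [measurable]: "sobolev_op n u (f E) \<in> borel_measurable \<mu>" for E
      using u f_hol by (intro measurable_holomorphic_disc[OF \<mu>] holomorphic_sobolev_op) auto
    have B_meas [measurable]: "(indicator (ball a r) :: complex \<Rightarrow> ennreal) \<in> borel_measurable \<mu>" for a r
      by (intro measurable_disc_borel_measure[OF \<mu>] borel_measurable_indicator) simp
    have int: "(\<integral>\<^sup>+z. ennreal (cmod (sobolev_op n u (f E) z) powr q) \<partial>\<mu>) \<le> ennreal R" for E
    proof -
      have "(\<integral>\<^sup>+z\<in>disc. ennreal (cmod (f E z) powr p) \<partial>lborel) \<le> ennreal (C * (\<Sum>a\<in>F. cmod (e E a) powr p))"
        unfolding f_def by (rule syn[OF F])
      also have "(\<Sum>a\<in>F. cmod (e E a) powr p) = (\<Sum>a\<in>F. l a powr p)"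
        using l by (intro sum.cong) (auto simp: e_def norm_mult)
      finally have bd: "(\<integral>\<^sup>+z\<in>disc. ennreal (cmod (f E z) powr p) \<partial>lborel) \<le> ennreal (C * (\<Sum>a\<in>F. l a powr p))" .
      have nn: "0 \<le> C * (\<Sum>a\<in>F. l a powr p)" using C by (simp add: sum_nonneg)
      note b = bergman_space_boundI[OF p less_imp_le[OF q] f_hol nn bd]
      show ?thesis
        using car[OF b(1)] b(2) C2 unfolding R_def
        by (elim order_trans) (intro ennreal_leI mult_left_mono, auto)
    qed
    have pw: "(\<Sum>a\<in>F. ennreal (l a powr q) * (ennreal (cmod (S a z) powr q) * indicator (ball a (bdist a / 4)) z))
       \<le> 2304 * (\<Sum>E\<in>Pow F. ennreal (2 / 2 ^ card F) * ennreal (cmod (sobolev_op n u (f E) z) powr q))"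
      if z: "z \<in> disc" for z
    proof (rule sum_indicator_le[OF F z])
      fix a assume a: "a \<in> F"
      have "sobolev_op n u (f E) z = (\<Sum>b\<in>F. (if b \<in> E then 1 else -1) * (complex_of_real (l b) * S b z))" for E
        using sobolev_op_atoms[OF Fd z, of n u "e E" p m] unfolding f_def S_def e_def by (simp only: mult.assoc)
      then have "2 ^ card F * cmod (complex_of_real (l a) * S a z) powr q
         \<le> 2 * (\<Sum>E\<in>Pow F. cmod (sobolev_op n u (f E) z) powr q)"
        using sign_average_ge[OF F(1) a q, of "\<lambda>b. complex_of_real (l b) * S b z"] by simp
      then have "l a powr q * cmod (S a z) powr q \<le> 2 / 2 ^ card F * (\<Sum>E\<in>Pow F. cmod (sobolev_op n u (f E) z) powr q)"
        using l[OF a] by (simp add: norm_mult powr_mult field_simps)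
      then have "ennreal (l a powr q * cmod (S a z) powr q) \<le> ennreal (\<Sum>E\<in>Pow F. 2 / 2 ^ card F * cmod (sobolev_op n u (f E) z) powr q)"
        by (intro ennreal_leI) (simp add: sum_distrib_left)
      also have "\<dots> = (\<Sum>E\<in>Pow F. ennreal (2 / 2 ^ card F) * ennreal (cmod (sobolev_op n u (f E) z) powr q))"
        by (simp add: sum_ennreal flip: ennreal_mult)
      finally show "ennreal (l a powr q) * (ennreal (cmod (S a z) powr q) * indicator (ball a (bdist a / 4)) z)
         \<le> (\<Sum>E\<in>Pow F. ennreal (2 / 2 ^ card F) * ennreal (cmod (sobolev_op n u (f E) z) powr q))"
        by (auto simp: indicator_def ennreal_mult)
    next
      fix a assume a: "a \<in> F" and "z \<notin> ball a (bdist a / 2)"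
      then show "ennreal (l a powr q) * (ennreal (cmod (S a z) powr q) * indicator (ball a (bdist a / 4)) z) = 0"
        using bdist_pos[of a] F by (auto simp: indicator_def)
    qed
    have "(\<Sum>a\<in>F. ennreal (l a powr q) * (\<integral>\<^sup>+z\<in>ball a (bdist a / 4). ennreal (cmod (S a z) powr q) \<partial>\<mu>))
       = (\<integral>\<^sup>+z. (\<Sum>a\<in>F. ennreal (l a powr q) * (ennreal (cmod (S a z) powr q) * indicator (ball a (bdist a / 4)) z)) \<partial>\<mu>)"
      by (subst nn_integral_sum) (auto simp: nn_integral_cmult)
    also have "\<dots> \<le> (\<integral>\<^sup>+z. 2304 * (\<Sum>E\<in>Pow F. ennreal (2 / 2 ^ card F) * ennreal (cmod (sobolev_op n u (f E) z) powr q)) \<partial>\<mu>)"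
      using pw by (intro nn_integral_mono) (simp add: space_disc_borel_measure[OF \<mu>])
    also have "\<dots> = 2304 * (\<Sum>E\<in>Pow F. ennreal (2 / 2 ^ card F) * (\<integral>\<^sup>+z. ennreal (cmod (sobolev_op n u (f E) z) powr q) \<partial>\<mu>))"
      by (simp add: nn_integral_cmult nn_integral_sum)
    also have "\<dots> \<le> 2304 * (\<Sum>E\<in>Pow F. ennreal (2 / 2 ^ card F) * ennreal R)"
      by (intro mult_left_mono sum_mono int) auto
    also have "\<dots> = 2304 * (\<Sum>E\<in>Pow F. ennreal (2 / 2 ^ card F * R))"
      by (subst ennreal_mult') auto
    also have "\<dots> = 2304 * ennreal (\<Sum>E\<in>Pow F. 2 / 2 ^ card F * R)"
      using C2 by (subst sum_ennreal) (auto simp: R_def)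
    also have "(\<Sum>E\<in>Pow F. 2 / 2 ^ card F * R) = 2 * R"
      using F by (simp add: card_Pow)
    also have "2304 * ennreal (2 * R) = ennreal (4608 * R)"
    proof -
      have "ennreal (2304 * (2 * R)) = ennreal 2304 * ennreal (2 * R)" by (rule ennreal_mult') simp
      then show ?thesis by simp
    qed
    also have "4608 * R = 4608 * (C2 * C powr (q / p)) * (\<Sum>a\<in>F. l a powr p) powr (q / p)"
      using C by (simp add: R_def powr_mult sum_nonneg)
    finally show "(\<Sum>a\<in>F. ennreal (l a powr q) * (\<integral>\<^sup>+z\<in>ball a (bdist a / 4). ennreal (cmod (sobolev_op n u (atom p m a) z) powr q) \<partial>\<mu>))
      \<le> ennreal (4608 * (C2 * C powr (q / p)) * (\<Sum>a\<in>F. l a powr p) powr (q / p))"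
      by (simp add: S_def)
  qed
qed

text \<open>Adding the inequalities for n + 1 consecutive exponents undoes the interference of the
  orders k. The result says that the masses act boundedly on the sequences (l a)^q, which are
  measured in l^(p/q); the dual exponent is p / (p - q).\<close>

lemma lattice_mass_duality:
  assumes sc: "sobolev_carleson n u p q \<mu>" and u: "\<And>k. k \<le> n \<Longrightarrow> u k holomorphic_on disc"
    and \<mu>: "disc_borel_measure \<mu>" and p: "0 < p" and q: "0 < q" and k: "k \<le> n"
  obtains K where "K > 0" and "\<And>F l. finite F \<Longrightarrow> F \<subseteq> A \<Longrightarrow> (\<And>a. a \<in> F \<Longrightarrow> l a \<ge> 0) \<Longrightarrow>
    (\<Sum>a\<in>F. ennreal (l a powr q) * lattice_mass \<mu> (u k) k p q a) \<le> ennreal (K * (\<Sum>a\<in>F. l a powr p) powr (q / p))"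
proof -
  \<comment> \<open>Each exponent M + i is then at least 3 and larger than 2/p, as
    \<open>synthesis\<close> demands.\<close>
  define M where "M = 3 + nat \<lceil>2 / p\<rceil>"
  have m: "M + i \<ge> 3" "real (M + i) * p > 2" for i
  proof -
    have "2 / p < real (M + i)" unfolding M_def by linarith
    then show "real (M + i) * p > 2" using p by (simp add: field_simps)
  qed (simp add: M_def)
  obtain C where C: "C > 0" and coeff: "\<And>u k a z. k \<le> n \<Longrightarrow> a \<in> disc \<Longrightarrow> z \<in> disc \<Longrightarrow> z \<in> ball a (bdist a / 4) \<Longrightarrow>
    cmod (u k z) powr q * bdist a powr (- (k * q) - 2 * q / p)
      \<le> C * (\<Sum>i\<le>n. cmod (sobolev_op n u (atom p (M + i) a) z) powr q)"
    using coefficient_le_sobolev_atoms[OF q, of n p M] by metis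
  define \<Phi> where "\<Phi> = (\<lambda>i a. \<integral>\<^sup>+z\<in>ball a (bdist a / 4). ennreal (cmod (sobolev_op n u (atom p (M + i) a) z) powr q) \<partial>\<mu>)"
  define P where "P = (\<lambda>i K. K > 0 \<and> (\<forall>F l. finite F \<longrightarrow> F \<subseteq> A \<longrightarrow> (\<forall>a\<in>F. l a \<ge> 0) \<longrightarrow>
    (\<Sum>a\<in>F. ennreal (l a powr q) * \<Phi> i a) \<le> ennreal (K * (\<Sum>a\<in>F. l a powr p) powr (q / p))))"
  have "\<exists>K. P i K" for i
  proof -
    show ?thesis
    proof (rule sobolev_carleson_atoms[OF sc u \<mu> p q m[of i]])
      fix K :: real
      assume "K > 0" and "\<And>F l. finite F \<Longrightarrow> F \<subseteq> A \<Longrightarrow> (\<And>a. a \<in> F \<Longrightarrow> l a \<ge> 0) \<Longrightarrow>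
        (\<Sum>a\<in>F. ennreal (l a powr q) * (\<integral>\<^sup>+z\<in>ball a (bdist a / 4). ennreal (cmod (sobolev_op n u (atom p (M + i) a) z) powr q) \<partial>\<mu>))
          \<le> ennreal (K * (\<Sum>a\<in>F. l a powr p) powr (q / p))"
      then show ?thesis unfolding P_def \<Phi>_def by (intro exI[of _ K]) simp
    qed
  qed
  then obtain K where PK: "\<And>i. P i (K i)" by metis
  have K: "K i > 0" for i using PK[of i] by (simp add: P_def)
  have KF: "(\<Sum>a\<in>F. ennreal (l a powr q) * \<Phi> i a) \<le> ennreal (K i * (\<Sum>a\<in>F. l a powr p) powr (q / p))"
    if "finite F" "F \<subseteq> A" "\<And>a. a \<in> F \<Longrightarrow> l a \<ge> 0" for i F l
    using PK[of i] that unfolding P_def by simp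
  have B_meas [measurable]: "(indicator (ball a r) :: complex \<Rightarrow> ennreal) \<in> borel_measurable \<mu>" for a r
    by (intro measurable_disc_borel_measure[OF \<mu>] borel_measurable_indicator) simp
  have [measurable]: "u k \<in> borel_measurable \<mu>"
    by (intro measurable_holomorphic_disc[OF \<mu>] u k)
  have mass: "lattice_mass \<mu> (u k) k p q a \<le> ennreal C * (\<Sum>i\<le>n. \<Phi> i a)" if a: "a \<in> A" for a
  proof -
    have ad: "a \<in> disc" using a subset_disc by auto
    have S_meas [measurable]: "sobolev_op n u (atom p (M + i) a) \<in> borel_measurable \<mu>" for i
      using ad u by (intro measurable_holomorphic_disc[OF \<mu>] holomorphic_sobolev_op holomorphic_atom) auto
    have "lattice_mass \<mu> (u k) k p q a = (\<integral>\<^sup>+z. ennreal (cmod (u k z) powr q) * indicator (ball a (bdist a / 4)) z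
       * ennreal (bdist a powr (- (k * q) - 2 * q / p)) \<partial>\<mu>)"
      unfolding lattice_mass_def by (subst nn_integral_multc) auto
    also have "\<dots> \<le> (\<integral>\<^sup>+z. ennreal C * (\<Sum>i\<le>n. ennreal (cmod (sobolev_op n u (atom p (M + i) a) z) powr q) * indicator (ball a (bdist a / 4)) z) \<partial>\<mu>)"
    proof (intro nn_integral_mono)
      fix z assume "z \<in> space \<mu>"
      then have z: "z \<in> disc" by (simp add: space_disc_borel_measure[OF \<mu>])
      show "ennreal (cmod (u k z) powr q) * indicator (ball a (bdist a / 4)) z * ennreal (bdist a powr (- (k * q) - 2 * q / p))
         \<le> ennreal C * (\<Sum>i\<le>n. ennreal (cmod (sobolev_op n u (atom p (M + i) a) z) powr q) * indicator (ball a (bdist a / 4)) z)"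
      proof (cases "z \<in> ball a (bdist a / 4)")
        case True
        from coeff[OF k ad z True, of u] C show ?thesis
          using True by (simp add: sum_ennreal ennreal_leI sum_nonneg flip: ennreal_mult)
      qed simp
    qed
    also have "\<dots> = ennreal C * (\<Sum>i\<le>n. \<Phi> i a)"
      unfolding \<Phi>_def
      by (subst nn_integral_cmult, measurable, subst nn_integral_sum) auto
    finally show ?thesis .
  qed
  show thesis
  proof (rule that)
    show "C * (\<Sum>i\<le>n. K i) > 0" using C K by (intro mult_pos_pos sum_pos) auto
    fix F l assume F: "finite F" "F \<subseteq> A" and l: "\<And>a. a \<in> F \<Longrightarrow> l a \<ge> (0::real)"
    let ?T = "(\<Sum>a\<in>F. l a powr p) powr (q / p)"
    have "(\<Sum>a\<in>F. ennreal (l a powr q) * lattice_mass \<mu> (u k) k p q a)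
      \<le> (\<Sum>a\<in>F. ennreal (l a powr q) * (ennreal C * (\<Sum>i\<le>n. \<Phi> i a)))"
      using F by (intro sum_mono mult_left_mono mass) auto
    also have "\<dots> = ennreal C * (\<Sum>i\<le>n. \<Sum>a\<in>F. ennreal (l a powr q) * \<Phi> i a)"
      by (subst sum.swap) (simp add: sum_distrib_left mult_ac)
    also have "\<dots> \<le> ennreal C * (\<Sum>i\<le>n. ennreal (K i * ?T))"
      by (intro mult_left_mono sum_mono KF F l) auto
    also have "\<dots> = ennreal (C * (\<Sum>i\<le>n. K i) * ?T)"
      using C K by (simp add: sum_ennreal less_imp_le sum_nonneg sum_distrib_right mult.assoc flip: ennreal_mult)
    finally show "(\<Sum>a\<in>F. ennreal (l a powr q) * lattice_mass \<mu> (u k) k p q a) \<le> ennreal (C * (\<Sum>i\<le>n. K i) * ?T)" .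
  qed
qed

text \<open>Put s = p / (p - q). The choice l = y^(1/(p - q)) is extremal for the duality: both l^q
  y and l^p equal y^s, so the bound becomes T <= K T^(q/p) for the sum T of the y^s over F. T is
  finite because F is, hence it can be cancelled, and the resulting bound K^s is the same for all
  F.\<close>

lemma lattice_mass_summable:
  assumes sc: "sobolev_carleson n u p q \<mu>" and u: "\<And>k. k \<le> n \<Longrightarrow> u k holomorphic_on disc"
    and \<mu>: "disc_borel_measure \<mu>" and q: "0 < q" and pq: "q < p" and k: "k \<le> n"
  obtains y K where "\<And>a. a \<in> A \<Longrightarrow> lattice_mass \<mu> (u k) k p q a = ennreal (y a)" "\<And>a. y a \<ge> 0"
    "\<And>F. finite F \<Longrightarrow> F \<subseteq> A \<Longrightarrow> (\<Sum>a\<in>F. y a powr (p / (p - q))) \<le> K"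
proof -
  have p: "p > 0" using q pq by simp
  obtain K where K: "K > 0" and KF: "\<And>F l. finite F \<Longrightarrow> F \<subseteq> A \<Longrightarrow> (\<And>a. a \<in> F \<Longrightarrow> l a \<ge> 0) \<Longrightarrow>
    (\<Sum>a\<in>F. ennreal (l a powr q) * lattice_mass \<mu> (u k) k p q a) \<le> ennreal (K * (\<Sum>a\<in>F. l a powr p) powr (q / p))"
    using lattice_mass_duality[OF sc u \<mu> p q k] by blast
  define y where "y = (\<lambda>a. enn2real (lattice_mass \<mu> (u k) k p q a))"
  have y0: "y a \<ge> 0" for a by (simp add: y_def)
  have y: "lattice_mass \<mu> (u k) k p q a = ennreal (y a)" if "a \<in> A" for a
  proof -
    \<comment> \<open>Testing on a single point makes each mass finite, so that a real number y can
      replace it.\<close>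
    have "lattice_mass \<mu> (u k) k p q a \<le> ennreal K"
      using KF[of "{a}" "\<lambda>_. 1"] that by simp
    then show ?thesis
      unfolding y_def by (metis ennreal_enn2real ennreal_less_top order_le_less_trans)
  qed
  define s where "s = p / (p - q)"
  have s: "s > 0" using p pq by (simp add: s_def)
  have "(\<Sum>a\<in>F. y a powr s) \<le> K powr s" if F: "finite F" "F \<subseteq> A" for F
  proof (cases "(\<Sum>a\<in>F. y a powr s) = 0")
    case False
    define T where "T = (\<Sum>a\<in>F. y a powr s)"
    have T: "T > 0" using False sum_nonneg[of F "\<lambda>a. y a powr s"] by (simp add: T_def order_less_le)
    define l where "l = (\<lambda>a. y a powr (1 / (p - q)))"
    have "(\<Sum>a\<in>F. ennreal (l a powr q) * lattice_mass \<mu> (u k) k p q a) = (\<Sum>a\<in>F. ennreal (y a powr s))"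
    proof (intro sum.cong refl)
      fix a assume "a \<in> F"
      then have "a \<in> A" using F by auto
      have "l a powr q * y a = y a powr s"
      proof (cases "y a = 0")
        case False
        then have "y a > 0" using y0[of a] by linarith
        have "l a powr q * y a = y a powr (q / (p - q)) * y a"
          by (simp add: l_def powr_powr)
        also have "\<dots> = y a powr (q / (p - q) + 1)"
          using \<open>y a > 0\<close> by (simp add: powr_add)
        also have "q / (p - q) + 1 = s"
          using pq by (simp add: s_def field_simps)
        finally show ?thesis .
      qed simp
      then show "ennreal (l a powr q) * lattice_mass \<mu> (u k) k p q a = ennreal (y a powr s)"
        using y0 by (simp add: y[OF \<open>a \<in> A\<close>] flip: ennreal_mult)
    qed
    also have "\<dots> = ennreal T" by (simp add: T_def sum_ennreal)
    finally have "ennreal T \<le> ennreal (K * (\<Sum>a\<in>F. l a powr p) powr (q / p))"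
      using KF[OF F, of l] by (simp add: l_def)
    also have "(\<Sum>a\<in>F. l a powr p) = T"
      by (simp add: l_def T_def s_def powr_powr)
    finally have "T \<le> K * T powr (q / p)"
      using K by (subst (asm) ennreal_le_iff) auto
    then have "T * T powr (- (q / p)) \<le> K * T powr (q / p) * T powr (- (q / p))"
      by (intro mult_right_mono) auto
    moreover have "T * T powr (- (q / p)) = T powr (1 - q / p)"
      using T powr_add[of T 1 "- (q / p)"] by simp
    moreover have "T powr (q / p) * T powr (- (q / p)) = 1"
      using T by (simp flip: powr_add)
    ultimately have "T powr (1 - q / p) \<le> K" by (simp add: mult.assoc)
    then have "(T powr (1 - q / p)) powr s \<le> K powr s"
      using s by (intro powr_mono2) auto
    moreover have "(1 - q / p) * s = 1" using p pq by (simp add: s_def field_simps)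
    ultimately show ?thesis using T by (simp add: powr_powr T_def)
  qed (use K in simp)
  then show thesis
    using that[of y "K powr s"] y y0 unfolding s_def by blast
qed

end

section \<open>Sufficiency of Luecking's condition\<close>

text \<open>Young's inequality with the exponents p/q and p/(p - q), where the minimum is kept
  instead of its second entry alone: the second entry is a majorant free of i, the first forces the
  minimum to 0 when i tends to 0.\<close>

lemma mult_powr_le_split:
  fixes y i \<epsilon> :: real
  assumes y: "y \<ge> 0" and i: "i \<ge> 0" and \<epsilon>: "\<epsilon> > 0" and q: "0 < q" "q < p"
  shows "y * i powr (q / p) \<le> \<epsilon> * i + min (y * i powr (q / p)) (\<epsilon> powr (- (q / (p - q))) * y powr (p / (p - q)))"
proof (cases "y * i powr (q / p) \<le> \<epsilon> * i")
  case True
  have "0 \<le> min (y * i powr (q / p)) (\<epsilon> powr (- (q / (p - q))) * y powr (p / (p - q)))"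
    using y by simp
  with True show ?thesis by linarith
next
  case False
  then have i0: "i > 0" and y0: "y > 0" using y i \<epsilon> by (auto simp: order_less_le)
  have qp: "1 - q / p > 0" using q by (simp add: field_simps)
  have "\<epsilon> * i powr (1 - q / p) * i powr (q / p) < y * i powr (q / p)"
    using False i0 by (simp add: mult.assoc flip: powr_add)
  then have "\<epsilon> * i powr (1 - q / p) < y" using i0 by simp
  then have "i powr (1 - q / p) < y / \<epsilon>" using \<epsilon> by (simp add: field_simps)
  then have "(i powr (1 - q / p)) powr (q / (p - q)) \<le> (y / \<epsilon>) powr (q / (p - q))"
    using q by (intro powr_mono2) auto
  also have "(i powr (1 - q / p)) powr (q / (p - q)) = i powr (q / p)"
  proof -
    have "1 - q / p = (p - q) / p" using q by (simp add: diff_divide_distrib)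
    then have "(1 - q / p) * (q / (p - q)) = q / p" using q by simp
    then show ?thesis by (simp only: powr_powr)
  qed
  finally have "y * i powr (q / p) \<le> y * (y / \<epsilon>) powr (q / (p - q))"
    using y by (intro mult_left_mono)
  also have "\<dots> = \<epsilon> powr (- (q / (p - q))) * (y * y powr (q / (p - q)))"
    using y0 \<epsilon> by (simp add: powr_divide powr_minus field_simps)
  also have "y * y powr (q / (p - q)) = y powr (1 + q / (p - q))"
    using y0 by (simp add: powr_add)
  also have "1 + q / (p - q) = p / (p - q)"
    using q by (simp add: field_simps)
  finally show ?thesis using \<epsilon> i by (simp add: min_def)
qed

section \<open>Lattice sums as integrals over the counting measure\<close>

lemma nn_integral_count_space_le:
  fixes f :: "'a \<Rightarrow> ennreal"
  assumes A: "countable A" and le: "\<And>F. finite F \<Longrightarrow> F \<subseteq> A \<Longrightarrow> (\<Sum>a\<in>F. f a) \<le> K"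
  shows "(\<integral>\<^sup>+a. f a \<partial>count_space A) \<le> K"
proof (cases "finite A")
  case True
  then show ?thesis using le by (simp add: nn_integral_count_space_finite)
next
  case False
  note bij = bij_betw_from_nat_into[OF A False]
  have "(\<integral>\<^sup>+a. f a \<partial>count_space A) = (\<Sum>j. f (from_nat_into A j))"
    by (simp add: nn_integral_bij_count_space[OF bij, symmetric] nn_integral_count_space_nat)
  also have "\<dots> \<le> K"
  proof (rule suminf_le_const)
    fix j
    have inj: "inj_on (from_nat_into A) {..<j}"
      using bij by (auto simp: bij_betw_def intro: inj_on_subset)
    have "sum f (from_nat_into A ` {..<j}) \<le> K"
      using bij by (intro le) (auto simp: bij_betw_def)
    then show "(\<Sum>j<j. f (from_nat_into A j)) \<le> K"
      by (simp add: sum.reindex[OF inj])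
  qed simp
  finally show ?thesis .
qed

text \<open>The radius is twice that of \<open>lattice_mass\<close>: for z in the ball used there,
  the ball of radius \<open>bdist a / 4\<close> around z stays inside this one, which leaves room
  for the local derivative estimate.\<close>

definition local_mass :: "real \<Rightarrow> (complex \<Rightarrow> complex) \<Rightarrow> complex \<Rightarrow> real" where
  "local_mass p f a = enn2real (\<integral>\<^sup>+z\<in>ball a (bdist a / 2). ennreal (cmod (f z) powr p) \<partial>lborel)"

lemma local_mass_nonneg: "local_mass p f a \<ge> 0"
  by (simp add: local_mass_def)

context disc_lattice
begin

lemma ball_subset_disc:
  assumes "a \<in> A"
  shows "ball a (bdist a / 2) \<subseteq> disc" "cball a (bdist a / 2) \<subseteq> disc"
proof -
  have "cmod z < 1" if "dist a z \<le> bdist a / 2" for z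
    using bdist_le_dist[of a z] that bdist_pos[OF assms] by (simp add: dist_commute)
  then show "ball a (bdist a / 2) \<subseteq> disc" "cball a (bdist a / 2) \<subseteq> disc" by auto
qed

lemma ennreal_local_mass:
  assumes p: "0 < p" and f: "f \<in> bergman_space p" and a: "a \<in> A"
  shows "ennreal (local_mass p f a) = (\<integral>\<^sup>+z\<in>ball a (bdist a / 2). ennreal (cmod (f z) powr p) \<partial>lborel)"
proof -
  have "(\<integral>\<^sup>+z\<in>ball a (bdist a / 2). ennreal (cmod (f z) powr p) \<partial>lborel) \<le> (\<integral>\<^sup>+z\<in>disc. ennreal (cmod (f z) powr p) \<partial>lborel)"
    using ball_subset_disc(1)[OF a] by (intro nn_integral_mono) (auto simp: indicator_def)
  also have "\<dots> = ennreal (pi * bergman_norm p f powr p)"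
    by (rule nn_integral_bergman_space[OF p f])
  also have "\<dots> < top" by simp
  finally show ?thesis unfolding local_mass_def by simp
qed

text \<open>By Tonelli the sum over a becomes the integral of |f|^p times the number of balls that
  contain z, which is at most 2304.\<close>

lemma nn_integral_local_mass_le:
  assumes p: "0 < p" and f: "f \<in> bergman_space p"
  shows "(\<integral>\<^sup>+a. ennreal (local_mass p f a) \<partial>count_space A) \<le> ennreal (2304 * pi * bergman_norm p f powr p)"
proof -
  have hol: "f holomorphic_on disc" using f by (simp add: bergman_space_def)
  define g where "g = (\<lambda>z. ennreal (cmod (f z) powr p) * indicator disc z)"
  have [measurable]: "g \<in> borel_measurable borel"
    unfolding g_def by (rule borel_measurable_holomorphic_indicator[OF hol]) simp
  have [measurable]: "ball a r \<in> sets borel" for a :: complex and r by simp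
  have "(\<integral>\<^sup>+a. ennreal (local_mass p f a) \<partial>count_space A)
     = (\<integral>\<^sup>+a. \<integral>\<^sup>+z. g z * indicator (ball a (bdist a / 2)) z \<partial>lborel \<partial>count_space A)"
  proof (intro nn_integral_cong)
    fix a assume "a \<in> space (count_space A)"
    then have a: "a \<in> A" by simp
    show "ennreal (local_mass p f a) = (\<integral>\<^sup>+z. g z * indicator (ball a (bdist a / 2)) z \<partial>lborel)"
      unfolding ennreal_local_mass[OF p f a] g_def using ball_subset_disc(1)[OF a]
      by (intro nn_integral_cong) (auto simp: indicator_def)
  qed
  also have "\<dots> = (\<integral>\<^sup>+z. \<integral>\<^sup>+a. g z * indicator (ball a (bdist a / 2)) z \<partial>count_space A \<partial>lborel)"
    by (intro nn_integral_count_space_nn_integral[symmetric] countable) measurable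
  also have "\<dots> \<le> (\<integral>\<^sup>+z. 2304 * g z \<partial>lborel)"
  proof (intro nn_integral_mono nn_integral_count_space_le countable)
    fix z F assume F: "finite F" "F \<subseteq> A"
    show "(\<Sum>a\<in>F. g z * indicator (ball a (bdist a / 2)) z) \<le> 2304 * g z"
    proof (cases "z \<in> disc")
      case True
      then show ?thesis by (intro sum_indicator_le[OF F]) (auto simp: indicator_def)
    qed (simp add: g_def)
  qed
  also have "\<dots> = 2304 * (\<integral>\<^sup>+z. g z \<partial>lborel)"
    by (rule nn_integral_cmult) measurable
  also have "(\<integral>\<^sup>+z. g z \<partial>lborel) = ennreal (pi * bergman_norm p f powr p)"
    unfolding g_def by (rule nn_integral_bergman_space[OF p f])
  also have "2304 * ennreal (pi * bergman_norm p f powr p) = ennreal (2304 * pi * bergman_norm p f powr p)"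
  proof -
    have "ennreal (2304 * (pi * bergman_norm p f powr p)) = ennreal 2304 * ennreal (pi * bergman_norm p f powr p)"
      by (rule ennreal_mult') simp
    then show ?thesis by (simp add: mult.assoc)
  qed
  finally show ?thesis .
qed

text \<open>On each covering ball the local estimate, raised to the power q/p, bounds the q-th power
  of the k-th derivative by that of the local mass times (1 - |a|)^(- k q - 2 q / p). This is the
  scaling built into \<open>lattice_mass\<close>, so summing over the covering yields the lattice
  sum.\<close>

lemma weighted_deriv_integral_le:
  assumes \<mu>: "disc_borel_measure \<mu>" and v: "v holomorphic_on disc" and p: "0 < p" and q: "0 < q"
    and y: "\<And>a. a \<in> A \<Longrightarrow> lattice_mass \<mu> v k p q a = ennreal (y a)" "\<And>a. y a \<ge> 0"
  obtains C where "C > 0" and "\<And>f. f \<in> bergman_space p \<Longrightarrow>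
    (\<integral>\<^sup>+z. ennreal (cmod (v z * (deriv ^^ k) f z) powr q) \<partial>\<mu>)
      \<le> ennreal C * (\<integral>\<^sup>+a. ennreal (y a * local_mass p f a powr (q / p)) \<partial>count_space A)"
proof -
  obtain C where C: "C > 0" and est: "\<And>f z r. f holomorphic_on ball z r \<Longrightarrow> r > 0 \<Longrightarrow>
    ennreal (cmod ((deriv ^^ k) f z) powr p)
      \<le> ennreal (C * r powr (-2 - k * p)) * (\<integral>\<^sup>+w\<in>ball z r. ennreal (cmod (f w) powr p) \<partial>lborel)"
    using higher_deriv_local_estimate[OF p, of k] by blast
  define C' where "C' = (C * (1/4) powr (-2 - k * p)) powr (q / p)"
  have C': "C' > 0" using C by (simp add: C'_def)
  show thesis
  proof (rule that[OF C'])
    fix f assume f: "f \<in> bergman_space p"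
    then have hol: "f holomorphic_on disc" by (simp add: bergman_space_def)
    have pw: "cmod ((deriv ^^ k) f z) powr q \<le> C' * bdist a powr (- (k * q) - 2 * q / p) * local_mass p f a powr (q / p)"
      if a: "a \<in> A" and z: "z \<in> ball a (bdist a / 4)" for a z
    proof -
      have d: "bdist a > 0" using bdist_pos[OF a] .
      have sub: "ball z (bdist a / 4) \<subseteq> ball a (bdist a / 2)"
      proof
        fix w assume "w \<in> ball z (bdist a / 4)"
        then show "w \<in> ball a (bdist a / 2)" using z dist_triangle[of a w z] by simp
      qed
      have "ennreal (cmod ((deriv ^^ k) f z) powr p)
         \<le> ennreal (C * (bdist a / 4) powr (-2 - k * p)) * (\<integral>\<^sup>+w\<in>ball z (bdist a / 4). ennreal (cmod (f w) powr p) \<partial>lborel)"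
        using sub ball_subset_disc(1)[OF a] d by (intro est holomorphic_on_subset[OF hol]) auto
      also have "\<dots> \<le> ennreal (C * (bdist a / 4) powr (-2 - k * p)) * ennreal (local_mass p f a)"
        unfolding ennreal_local_mass[OF p f a] using sub
        by (intro mult_left_mono nn_integral_mono) (auto simp: indicator_def)
      also have "\<dots> = ennreal (C * (bdist a / 4) powr (-2 - k * p) * local_mass p f a)"
        using C local_mass_nonneg by (intro ennreal_mult[symmetric]) auto
      finally have "cmod ((deriv ^^ k) f z) powr p \<le> C * (bdist a / 4) powr (-2 - k * p) * local_mass p f a"
        using C local_mass_nonneg by (subst (asm) ennreal_le_iff) auto
      then have "(cmod ((deriv ^^ k) f z) powr p) powr (q / p) \<le> (C * (bdist a / 4) powr (-2 - k * p) * local_mass p f a) powr (q / p)"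
        using p q by (intro powr_mono2) auto
      also have "(cmod ((deriv ^^ k) f z) powr p) powr (q / p) = cmod ((deriv ^^ k) f z) powr q"
        using p by (simp add: powr_powr)
      also have "(bdist a / 4) powr (-2 - k * p) = (1/4) powr (-2 - k * p) * bdist a powr (-2 - k * p)"
        using d powr_mult[of "1/4" "bdist a" "-2 - k * p"] by simp
      also have "(C * ((1/4) powr (-2 - k * p) * bdist a powr (-2 - k * p)) * local_mass p f a) powr (q / p)
        = C' * (bdist a powr (-2 - k * p)) powr (q / p) * local_mass p f a powr (q / p)"
        using C local_mass_nonneg[of p f a] by (simp add: C'_def powr_mult mult.assoc)
      also have "(bdist a powr (-2 - k * p)) powr (q / p) = bdist a powr (- (k * q) - 2 * q / p)"
      proof -
        have "(-2 - k * p) * (q / p) = - (k * q) - 2 * q / p" using p by (simp add: field_simps)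
        then show ?thesis by (simp only: powr_powr)
      qed
      finally show ?thesis .
    qed
    define h where "h = (\<lambda>z. ennreal (cmod (v z * (deriv ^^ k) f z) powr q))"
    have v_meas [measurable]: "v \<in> borel_measurable \<mu>" by (rule measurable_holomorphic_disc[OF \<mu> v])
    have [measurable]: "(deriv ^^ k) f \<in> borel_measurable \<mu>"
      by (intro measurable_holomorphic_disc[OF \<mu>] holomorphic_higher_deriv hol) simp
    have [measurable]: "h \<in> borel_measurable \<mu>" unfolding h_def by measurable
    have B_meas [measurable]: "(indicator (ball a r) :: complex \<Rightarrow> ennreal) \<in> borel_measurable \<mu>" for a r
      by (intro measurable_disc_borel_measure[OF \<mu>] borel_measurable_indicator) simp
    have "(\<integral>\<^sup>+z. h z \<partial>\<mu>) \<le> (\<integral>\<^sup>+z. \<integral>\<^sup>+a. h z * indicator (ball a (bdist a / 4)) z \<partial>count_space A \<partial>\<mu>)"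
    proof (intro nn_integral_mono)
      fix z assume "z \<in> space \<mu>"
      then have "z \<in> disc" by (simp add: space_disc_borel_measure[OF \<mu>])
      then obtain a where a: "a \<in> A" "z \<in> ball a (bdist a / 4)" using covering by blast
      then have "h z = h z * indicator (ball a (bdist a / 4)) z" by simp
      also have "\<dots> \<le> (\<integral>\<^sup>+a. h z * indicator (ball a (bdist a / 4)) z \<partial>count_space A)"
        by (rule nn_integral_ge_point[OF a(1)])
      finally show "h z \<le> (\<integral>\<^sup>+a. h z * indicator (ball a (bdist a / 4)) z \<partial>count_space A)" .
    qed
    also have "\<dots> = (\<integral>\<^sup>+a. \<integral>\<^sup>+z. h z * indicator (ball a (bdist a / 4)) z \<partial>\<mu> \<partial>count_space A)"
      by (intro nn_integral_count_space_nn_integral countable) measurable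
    also have "\<dots> \<le> (\<integral>\<^sup>+a. ennreal C' * ennreal (y a * local_mass p f a powr (q / p)) \<partial>count_space A)"
    proof (intro nn_integral_mono)
      fix a assume "a \<in> space (count_space A)"
      then have a: "a \<in> A" by simp
      let ?c = "ennreal (C' * local_mass p f a powr (q / p))"
      let ?d = "ennreal (bdist a powr (- (k * q) - 2 * q / p))"
      have "(\<integral>\<^sup>+z. h z * indicator (ball a (bdist a / 4)) z \<partial>\<mu>)
        \<le> (\<integral>\<^sup>+z. (?c * ?d) * (ennreal (cmod (v z) powr q) * indicator (ball a (bdist a / 4)) z) \<partial>\<mu>)"
      proof (intro nn_integral_mono)
        fix z
        show "h z * indicator (ball a (bdist a / 4)) z \<le> (?c * ?d) * (ennreal (cmod (v z) powr q) * indicator (ball a (bdist a / 4)) z)"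
        proof (cases "z \<in> ball a (bdist a / 4)")
          case True
          have "cmod (v z * (deriv ^^ k) f z) powr q = cmod ((deriv ^^ k) f z) powr q * cmod (v z) powr q"
            by (simp add: norm_mult powr_mult)
          also have "\<dots> \<le> C' * bdist a powr (- (k * q) - 2 * q / p) * local_mass p f a powr (q / p) * cmod (v z) powr q"
            by (intro mult_right_mono pw[OF a True]) auto
          also have "\<dots> = (C' * local_mass p f a powr (q / p)) * bdist a powr (- (k * q) - 2 * q / p) * cmod (v z) powr q"
            by (simp only: mult_ac)
          finally have "h z \<le> ennreal ((C' * local_mass p f a powr (q / p)) * bdist a powr (- (k * q) - 2 * q / p) * cmod (v z) powr q)"
            unfolding h_def by (rule ennreal_leI)
          also have "\<dots> = ?c * ?d * ennreal (cmod (v z) powr q)"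
            using C' by (simp only: ennreal_mult'' powr_ge_zero)
          finally show ?thesis using True by simp
        qed simp
      qed
      also have "\<dots> = ?c * lattice_mass \<mu> v k p q a"
        unfolding lattice_mass_def by (subst nn_integral_cmult) (auto simp: mult_ac)
      also have "\<dots> = ennreal C' * ennreal (y a * local_mass p f a powr (q / p))"
        unfolding y(1)[OF a] using C' y(2) by (simp add: mult_ac flip: ennreal_mult)
      finally show "(\<integral>\<^sup>+z. h z * indicator (ball a (bdist a / 4)) z \<partial>\<mu>) \<le> ennreal C' * ennreal (y a * local_mass p f a powr (q / p))" .
    qed
    also have "\<dots> = ennreal C' * (\<integral>\<^sup>+a. ennreal (y a * local_mass p f a powr (q / p)) \<partial>count_space A)"
      by (rule nn_integral_cmult) simp
    finally show "(\<integral>\<^sup>+z. ennreal (cmod (v z * (deriv ^^ k) f z) powr q) \<partial>\<mu>)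
      \<le> ennreal C' * (\<integral>\<^sup>+a. ennreal (y a * local_mass p f a powr (q / p)) \<partial>count_space A)"
      unfolding h_def .
  qed
qed

lemma local_mass_split:
  assumes f: "f \<in> bergman_space p" and q: "0 < q" "q < p" and y: "\<And>a. y a \<ge> 0" and \<epsilon>: "\<epsilon> > 0"
  shows "(\<integral>\<^sup>+a. ennreal (y a * local_mass p f a powr (q / p)) \<partial>count_space A)
    \<le> ennreal (\<epsilon> * (2304 * pi * bergman_norm p f powr p))
     + (\<integral>\<^sup>+a. ennreal (min (y a * local_mass p f a powr (q / p)) (\<epsilon> powr (- (q / (p - q))) * y a powr (p / (p - q)))) \<partial>count_space A)"
proof -
  let ?m = "\<lambda>a. min (y a * local_mass p f a powr (q / p)) (\<epsilon> powr (- (q / (p - q))) * y a powr (p / (p - q)))"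
  have "(\<integral>\<^sup>+a. ennreal (y a * local_mass p f a powr (q / p)) \<partial>count_space A)
     \<le> (\<integral>\<^sup>+a. ennreal \<epsilon> * ennreal (local_mass p f a) + ennreal (?m a) \<partial>count_space A)"
  proof (intro nn_integral_mono)
    fix a
    have "ennreal (y a * local_mass p f a powr (q / p)) \<le> ennreal (\<epsilon> * local_mass p f a + ?m a)"
      by (intro ennreal_leI mult_powr_le_split y local_mass_nonneg \<epsilon> q)
    also have "\<dots> = ennreal \<epsilon> * ennreal (local_mass p f a) + ennreal (?m a)"
      using \<epsilon> local_mass_nonneg y by (subst ennreal_plus) (auto simp: ennreal_mult)
    finally show "ennreal (y a * local_mass p f a powr (q / p)) \<le> ennreal \<epsilon> * ennreal (local_mass p f a) + ennreal (?m a)" .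
  qed
  also have "\<dots> = ennreal \<epsilon> * (\<integral>\<^sup>+a. ennreal (local_mass p f a) \<partial>count_space A) + (\<integral>\<^sup>+a. ennreal (?m a) \<partial>count_space A)"
    by (simp add: nn_integral_add nn_integral_cmult)
  also have "\<dots> \<le> ennreal \<epsilon> * ennreal (2304 * pi * bergman_norm p f powr p) + (\<integral>\<^sup>+a. ennreal (?m a) \<partial>count_space A)"
    using q by (intro add_right_mono mult_left_mono nn_integral_local_mass_le f) auto
  also have "ennreal \<epsilon> * ennreal (2304 * pi * bergman_norm p f powr p) = ennreal (\<epsilon> * (2304 * pi * bergman_norm p f powr p))"
    using \<epsilon> by (intro ennreal_mult[symmetric]) auto
  finally show ?thesis .
qed

lemma nn_integral_dominating:
  assumes "\<And>F. finite F \<Longrightarrow> F \<subseteq> A \<Longrightarrow> (\<Sum>a\<in>F. y a powr s) \<le> K" and c: "c \<ge> (0::real)"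
  shows "(\<integral>\<^sup>+a. ennreal (c * y a powr s) \<partial>count_space A) \<le> ennreal (c * K)"
proof (rule nn_integral_count_space_le[OF countable])
  fix F assume "finite F" "F \<subseteq> A"
  then have "ennreal (c * (\<Sum>a\<in>F. y a powr s)) \<le> ennreal (c * K)"
    using assms by (intro ennreal_leI mult_left_mono) auto
  then show "(\<Sum>a\<in>F. ennreal (c * y a powr s)) \<le> ennreal (c * K)"
    using c by (simp add: sum_ennreal sum_distrib_left)
qed

lemma local_mass_bound:
  assumes f: "f \<in> bergman_space p" and q: "0 < q" "q < p" and y: "\<And>a. y a \<ge> 0"
    and K: "\<And>F. finite F \<Longrightarrow> F \<subseteq> A \<Longrightarrow> (\<Sum>a\<in>F. y a powr (p / (p - q))) \<le> K"
  shows "(\<integral>\<^sup>+a. ennreal (y a * local_mass p f a powr (q / p)) \<partial>count_space A)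
    \<le> ennreal ((2304 * pi + K) * bergman_norm p f powr q)"
proof -
  have p: "p > 0" using q by simp
  define N where "N = bergman_norm p f"
  have N0: "N \<ge> 0" by (simp add: N_def bergman_norm_def)
  have K0: "K \<ge> 0" using K[of "{}"] by simp
  show ?thesis
  proof (cases "N = 0")
    case True
    have "local_mass p f a = 0" if a: "a \<in> A" for a
    proof -
      have "(\<integral>\<^sup>+z\<in>ball a (bdist a / 2). ennreal (cmod (f z) powr p) \<partial>lborel) \<le> (\<integral>\<^sup>+z\<in>disc. ennreal (cmod (f z) powr p) \<partial>lborel)"
        using ball_subset_disc(1)[OF a] by (intro nn_integral_mono) (auto simp: indicator_def)
      also have "\<dots> = 0"
        using nn_integral_bergman_space[OF p f] True p by (simp add: N_def)
      finally show ?thesis by (simp add: local_mass_def)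
    qed
    then have "(\<integral>\<^sup>+a. ennreal (y a * local_mass p f a powr (q / p)) \<partial>count_space A) = (\<integral>\<^sup>+a. 0 \<partial>count_space A)"
      by (intro nn_integral_cong) simp
    then show ?thesis by simp
  next
    case False
    then have N: "N > 0" using N0 by simp
    \<comment> \<open>This balances the two parts: \<epsilon> N^p and \<epsilon>^(-q/(p - q)) both
      equal N^q. It requires N > 0, hence the separate case.\<close>
    define \<epsilon> where "\<epsilon> = N powr (q - p)"
    have \<epsilon>: "\<epsilon> > 0" using N by (simp add: \<epsilon>_def)
    have e1: "\<epsilon> * N powr p = N powr q" using N by (simp add: \<epsilon>_def flip: powr_add)
    have e2: "\<epsilon> powr (- (q / (p - q))) = N powr q"
    proof -
      have "(q - p) * (- (q / (p - q))) = q" using q by (simp add: field_simps)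
      then show ?thesis unfolding \<epsilon>_def powr_powr by simp
    qed
    have "(\<integral>\<^sup>+a. ennreal (y a * local_mass p f a powr (q / p)) \<partial>count_space A)
      \<le> ennreal (\<epsilon> * (2304 * pi * N powr p))
       + (\<integral>\<^sup>+a. ennreal (min (y a * local_mass p f a powr (q / p)) (\<epsilon> powr (- (q / (p - q))) * y a powr (p / (p - q)))) \<partial>count_space A)"
      unfolding N_def by (rule local_mass_split[OF f q y \<epsilon>])
    also have "\<dots> \<le> ennreal (\<epsilon> * (2304 * pi * N powr p)) + (\<integral>\<^sup>+a. ennreal (N powr q * y a powr (p / (p - q))) \<partial>count_space A)"
      unfolding e2 by (intro add_left_mono nn_integral_mono ennreal_leI) simp
    also have "\<dots> \<le> ennreal (\<epsilon> * (2304 * pi * N powr p)) + ennreal (N powr q * K)"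
      by (intro add_left_mono nn_integral_dominating K) auto
    also have "\<epsilon> * (2304 * pi * N powr p) = 2304 * pi * N powr q"
      using e1 by (simp add: mult.left_commute)
    also have "ennreal (2304 * pi * N powr q) + ennreal (N powr q * K) = ennreal ((2304 * pi + K) * N powr q)"
      using K0 by (subst ennreal_plus[symmetric]) (auto simp: algebra_simps)
    finally show ?thesis by (simp add: N_def)
  qed
qed

lemma local_mass_tendsto_0:
  assumes p: "0 < p" and F: "bdd_loc_unif_null p F" and a: "a \<in> A"
  shows "(\<lambda>j. local_mass p (F j) a) \<longlonglongrightarrow> 0"
proof -
  have d: "bdist a > 0" using bdist_pos[OF a] .
  have "uniform_limit (cball a (bdist a / 2)) F (\<lambda>_. 0) sequentially"
    using F ball_subset_disc(2)[OF a] unfolding bdd_loc_unif_null_def by auto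
  then have U: "\<And>e. e > 0 \<Longrightarrow> \<forall>\<^sub>F j in sequentially. \<forall>z\<in>cball a (bdist a / 2). dist (F j z) 0 < e"
    unfolding uniform_limit_iff by blast
  have "\<forall>\<^sub>F j in sequentially. dist (local_mass p (F j) a) 0 < e" if e: "e > 0" for e
  proof -
    define c where "c = pi * (bdist a / 2)\<^sup>2"
    have c: "c > 0" using d by (simp add: c_def)
    \<comment> \<open>t^p times the area c of the ball is e/2, strictly below e.\<close>
    define t where "t = (e / (2 * c)) powr (1 / p)"
    have t: "t > 0" using e c by (simp add: t_def)
    have tp: "t powr p = e / (2 * c)" using e c p by (simp add: t_def powr_powr)
    show ?thesis
      using U[OF t]
    proof eventually_elim
      case (elim j)
      then have le: "cmod (F j z) \<le> t" if "dist a z * 2 < bdist a" for z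
        using that by (simp add: less_imp_le)
      have "(\<integral>\<^sup>+z\<in>ball a (bdist a / 2). ennreal (cmod (F j z) powr p) \<partial>lborel)
         \<le> (\<integral>\<^sup>+z. ennreal (t powr p) * indicator (ball a (bdist a / 2)) z \<partial>lborel)"
        using le p by (intro nn_integral_mono) (auto simp: indicator_def intro!: ennreal_leI powr_mono2)
      also have "\<dots> = ennreal (t powr p) * ennreal c"
        using d by (simp add: nn_integral_cmult_indicator emeasure_ball_complex c_def)
      also have "\<dots> = ennreal (t powr p * c)"
        using c by (intro ennreal_mult[symmetric]) auto
      also have "t powr p * c = e / 2" using c by (simp add: tp)
      finally have "local_mass p (F j) a \<le> e / 2"
        unfolding local_mass_def using e by (intro enn2real_leI) auto
      then show ?case using e local_mass_nonneg[of p "F j" a] by (simp add: dist_real_def)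
    qed
  qed
  then show ?thesis by (rule tendstoI)
qed

text \<open>The lattice sums for different j need not have a common summable majorant, as y lies
  only in l^s with s = p / (p - q). The part \<epsilon> times the local mass is therefore split off;
  it is small uniformly in j by the norm bound. Dominated convergence applies to the remaining
  minimum, which is at most a constant times y^s.\<close>

lemma local_mass_vanishing:
  assumes F: "bdd_loc_unif_null p F" and q: "0 < q" "q < p" and y: "\<And>a. y a \<ge> 0"
    and K: "\<And>F. finite F \<Longrightarrow> F \<subseteq> A \<Longrightarrow> (\<Sum>a\<in>F. y a powr (p / (p - q))) \<le> K"
  shows "(\<lambda>j. \<integral>\<^sup>+a. ennreal (y a * local_mass p (F j) a powr (q / p)) \<partial>count_space A) \<longlonglongrightarrow> 0"
proof (rule tendsto_zero_ennreal)
  fix r :: real assume r: "0 < r"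
  have p: "p > 0" using q by simp
  obtain M where M: "\<And>j. bergman_norm p (F j) \<le> M" and Fb: "\<And>j. F j \<in> bergman_space p"
    using F unfolding bdd_loc_unif_null_def by blast
  have N0: "bergman_norm p f \<ge> 0" for f by (simp add: bergman_norm_def)
  define B where "B = 2304 * pi * M powr p"
  have B: "B \<ge> 0" by (simp add: B_def)
  \<comment> \<open>\<open>B\<close> may vanish, hence B + 1. The split-off part and the convergent
    part each get r/4, so their sum stays strictly below r.\<close>
  define \<epsilon> where "\<epsilon> = r / 4 / (B + 1)"
  have \<epsilon>: "\<epsilon> > 0" using r B by (simp add: \<epsilon>_def)
  have \<epsilon>B: "\<epsilon> * B \<le> r / 4"
  proof -
    have "\<epsilon> * B \<le> \<epsilon> * (B + 1)" using \<epsilon> by (intro mult_left_mono) auto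
    also have "\<dots> = r / 4"
    proof -
      have "B + 1 \<noteq> 0" using B by linarith
      from iffD1[OF nonzero_eq_divide_eq[OF this] \<epsilon>_def] show ?thesis .
    qed
    finally show ?thesis .
  qed
  define c where "c = \<epsilon> powr (- (q / (p - q)))"
  define m where "m = (\<lambda>j a. ennreal (min (y a * local_mass p (F j) a powr (q / p)) (c * y a powr (p / (p - q)))))"
  have "(\<lambda>j. \<integral>\<^sup>+a. m j a \<partial>count_space A) \<longlonglongrightarrow> (\<integral>\<^sup>+a. 0 \<partial>count_space A)"
  proof (rule nn_integral_dominated_convergence)
    show "AE a in count_space A. m j a \<le> ennreal (c * y a powr (p / (p - q)))" for j
      by (intro AE_I2) (auto simp: m_def intro!: ennreal_leI)
    have "(\<integral>\<^sup>+a. ennreal (c * y a powr (p / (p - q))) \<partial>count_space A) \<le> ennreal (c * K)"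
      by (intro nn_integral_dominating K) (auto simp: c_def)
    also have "\<dots> < \<infinity>" by simp
    finally show "(\<integral>\<^sup>+a. ennreal (c * y a powr (p / (p - q))) \<partial>count_space A) < \<infinity>" .
    show "AE a in count_space A. (\<lambda>j. m j a) \<longlonglongrightarrow> 0"
    proof (intro AE_I2)
      fix a assume "a \<in> space (count_space A)"
      then have a: "a \<in> A" by simp
      have "(\<lambda>j. local_mass p (F j) a powr (q / p)) \<longlonglongrightarrow> 0 powr (q / p)"
        using p q local_mass_nonneg by (intro tendsto_powr' local_mass_tendsto_0[OF p F a] tendsto_const) auto
      then have "(\<lambda>j. y a * local_mass p (F j) a powr (q / p)) \<longlonglongrightarrow> y a * 0"
        by (intro tendsto_mult_left) simp
      then have "(\<lambda>j. ennreal (y a * local_mass p (F j) a powr (q / p))) \<longlonglongrightarrow> ennreal 0"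
        by (intro tendsto_ennrealI) simp
      then have *: "(\<lambda>j. ennreal (y a * local_mass p (F j) a powr (q / p))) \<longlonglongrightarrow> 0" by simp
      show "(\<lambda>j. m j a) \<longlonglongrightarrow> 0"
        by (rule tendsto_sandwich[OF _ _ tendsto_const *]) (auto simp: m_def intro!: always_eventually ennreal_leI)
    qed
  qed auto
  then have "(\<lambda>j. \<integral>\<^sup>+a. m j a \<partial>count_space A) \<longlonglongrightarrow> 0" by simp
  then have "\<forall>\<^sub>F j in sequentially. (\<integral>\<^sup>+a. m j a \<partial>count_space A) < ennreal (r / 4)"
    using r by (intro order_tendstoD(2)) auto
  then show "\<forall>\<^sub>F j in sequentially. (\<integral>\<^sup>+a. ennreal (y a * local_mass p (F j) a powr (q / p)) \<partial>count_space A) < ennreal r"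
  proof eventually_elim
    case (elim j)
    have "(\<integral>\<^sup>+a. ennreal (y a * local_mass p (F j) a powr (q / p)) \<partial>count_space A)
      \<le> ennreal (\<epsilon> * (2304 * pi * bergman_norm p (F j) powr p)) + (\<integral>\<^sup>+a. m j a \<partial>count_space A)"
      unfolding m_def c_def by (rule local_mass_split[OF Fb q y \<epsilon>])
    also have "\<epsilon> * (2304 * pi * bergman_norm p (F j) powr p) \<le> \<epsilon> * B"
      unfolding B_def using \<epsilon> p M N0 by (intro mult_left_mono powr_mono2) auto
    also note \<epsilon>B
    also have "ennreal (r / 4) + (\<integral>\<^sup>+a. m j a \<partial>count_space A) \<le> ennreal (r / 4) + ennreal (r / 4)"
      using elim by (intro add_left_mono less_imp_le)
    also have "\<dots> = ennreal (r / 2)" using r by (subst ennreal_plus[symmetric]) auto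
    also have "\<dots> < ennreal r" using r by (simp add: ennreal_less_iff)
    finally show ?case by (simp add: ennreal_leI add_right_mono)
  qed
qed

end

section \<open>The implications between the four conditions\<close>

lemma nn_integral_weighted:
  assumes \<mu>: "disc_borel_measure \<mu>" and w: "w holomorphic_on disc" and f: "f holomorphic_on disc"
  shows "(\<integral>\<^sup>+z. ennreal (cmod ((deriv ^^ k) f z) powr q) \<partial>weighted \<mu> w q)
    = (\<integral>\<^sup>+z. ennreal (cmod (w z * (deriv ^^ k) f z) powr q) \<partial>\<mu>)"
proof -
  have [measurable]: "w \<in> borel_measurable \<mu>" by (rule measurable_holomorphic_disc[OF \<mu> w])
  have [measurable]: "(deriv ^^ k) f \<in> borel_measurable \<mu>"
    by (intro measurable_holomorphic_disc[OF \<mu>] holomorphic_higher_deriv f) simp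
  show ?thesis
    unfolding weighted_def
    by (subst nn_integral_density) (auto simp: norm_mult powr_mult ennreal_mult)
qed

text \<open>One inequality serves both (c) to (a) and (d) to (b): the finite sum on the right is
  bounded, or tends to 0, as soon as each of its terms does.\<close>

lemma nn_integral_sobolev_op_le:
  assumes \<mu>: "disc_borel_measure \<mu>" and u: "\<And>k. k \<le> n \<Longrightarrow> u k holomorphic_on disc"
    and f: "f holomorphic_on disc" and q: "0 < q"
  shows "(\<integral>\<^sup>+z. ennreal (cmod (sobolev_op n u f z) powr q) \<partial>\<mu>)
    \<le> ennreal (real (Suc n) powr q) * (\<Sum>k\<le>n. \<integral>\<^sup>+z. ennreal (cmod ((deriv ^^ k) f z) powr q) \<partial>weighted \<mu> (u k) q)"
proof -
  have [measurable]: "u k \<in> borel_measurable \<mu>" if "k \<le> n" for k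
    by (rule measurable_holomorphic_disc[OF \<mu> u[OF that]])
  have [measurable]: "(deriv ^^ k) f \<in> borel_measurable \<mu>" for k
    by (intro measurable_holomorphic_disc[OF \<mu>] holomorphic_higher_deriv f) simp
  have "(\<integral>\<^sup>+z. ennreal (cmod (sobolev_op n u f z) powr q) \<partial>\<mu>)
    \<le> (\<integral>\<^sup>+z. ennreal (real (Suc n) powr q) * (\<Sum>k\<le>n. ennreal (cmod (u k z * (deriv ^^ k) f z) powr q)) \<partial>\<mu>)"
  proof (intro nn_integral_mono)
    fix z
    have "cmod (sobolev_op n u f z) powr q \<le> (\<Sum>k\<le>n. cmod (u k z * (deriv ^^ k) f z)) powr q"
      unfolding sobolev_op_def using q by (intro powr_mono2 norm_sum) auto
    also have "\<dots> \<le> real (Suc n) powr q * (\<Sum>k\<le>n. cmod (u k z * (deriv ^^ k) f z) powr q)"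
      using powr_sum_le_card[of "{..n}" "\<lambda>k. cmod (u k z * (deriv ^^ k) f z)" q] q by simp
    finally have "ennreal (cmod (sobolev_op n u f z) powr q)
      \<le> ennreal (real (Suc n) powr q * (\<Sum>k\<le>n. cmod (u k z * (deriv ^^ k) f z) powr q))"
      by (rule ennreal_leI)
    also have "\<dots> = ennreal (real (Suc n) powr q) * (\<Sum>k\<le>n. ennreal (cmod (u k z * (deriv ^^ k) f z) powr q))"
      by (subst ennreal_mult) (auto simp: sum_ennreal sum_nonneg)
    finally show "ennreal (cmod (sobolev_op n u f z) powr q)
      \<le> ennreal (real (Suc n) powr q) * (\<Sum>k\<le>n. ennreal (cmod (u k z * (deriv ^^ k) f z) powr q))" .
  qed
  also have "\<dots> = ennreal (real (Suc n) powr q) * (\<Sum>k\<le>n. \<integral>\<^sup>+z. ennreal (cmod (u k z * (deriv ^^ k) f z) powr q) \<partial>\<mu>)"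
    by (subst nn_integral_cmult, measurable, subst nn_integral_sum) auto
  also have "(\<Sum>k\<le>n. \<integral>\<^sup>+z. ennreal (cmod (u k z * (deriv ^^ k) f z) powr q) \<partial>\<mu>)
     = (\<Sum>k\<le>n. \<integral>\<^sup>+z. ennreal (cmod ((deriv ^^ k) f z) powr q) \<partial>weighted \<mu> (u k) q)"
    using u by (intro sum.cong) (auto simp: nn_integral_weighted[OF \<mu> _ f])
  finally show ?thesis .
qed

text \<open>Both conclusions come from one majorant, the lattice sum of y times a power of the local
  masses: it is bounded by the q-th power of the norm up to a constant, and it tends to 0 along
  admissible sequences. The lattice is auxiliary and is chosen only here.\<close>

lemma sobolev_carleson_imp_weighted:
  assumes sc: "sobolev_carleson n u p q \<mu>" and u: "\<And>k. k \<le> n \<Longrightarrow> u k holomorphic_on disc"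
    and \<mu>: "disc_borel_measure \<mu>" and q: "0 < q" "q < p" and k: "k \<le> n"
  shows "carleson k p q (weighted \<mu> (u k) q)" "vanishing_carleson k p q (weighted \<mu> (u k) q)"
proof -
  have p: "p > 0" using q by simp
  obtain A where "disc_lattice A" using ex_disc_lattice by blast
  then interpret disc_lattice A .
  obtain y K where y: "\<And>a. a \<in> A \<Longrightarrow> lattice_mass \<mu> (u k) k p q a = ennreal (y a)" "\<And>a. y a \<ge> 0"
    and K: "\<And>F. finite F \<Longrightarrow> F \<subseteq> A \<Longrightarrow> (\<Sum>a\<in>F. y a powr (p / (p - q))) \<le> K"
    using lattice_mass_summable[OF sc u \<mu> q k] by blast
  obtain C where C: "C > 0" and bound: "\<And>f. f \<in> bergman_space p \<Longrightarrow>
    (\<integral>\<^sup>+z. ennreal (cmod (u k z * (deriv ^^ k) f z) powr q) \<partial>\<mu>)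
      \<le> ennreal C * (\<integral>\<^sup>+a. ennreal (y a * local_mass p f a powr (q / p)) \<partial>count_space A)"
    using weighted_deriv_integral_le[OF \<mu> u[OF k] p q(1) y] by blast
  have w: "(\<integral>\<^sup>+z. ennreal (cmod ((deriv ^^ k) f z) powr q) \<partial>weighted \<mu> (u k) q)
      \<le> ennreal C * (\<integral>\<^sup>+a. ennreal (y a * local_mass p f a powr (q / p)) \<partial>count_space A)"
    if "f \<in> bergman_space p" for f
    using bound[OF that] nn_integral_weighted[OF \<mu> u[OF k], where f = f and k = k and q = q] that by (simp add: bergman_space_def)
  have K0: "K \<ge> 0" using K[of "{}"] by simp
  show "carleson k p q (weighted \<mu> (u k) q)"
    unfolding carleson_def
  proof (intro exI[of _ "C * (2304 * pi + K)"] conjI ballI)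
    show "C * (2304 * pi + K) > 0" using C K0 by (simp add: add_pos_nonneg)
    fix f assume f: "f \<in> bergman_space p"
    have "(\<integral>\<^sup>+z. ennreal (cmod ((deriv ^^ k) f z) powr q) \<partial>weighted \<mu> (u k) q)
       \<le> ennreal C * ennreal ((2304 * pi + K) * bergman_norm p f powr q)"
      using w[OF f] by (rule order_trans) (intro mult_left_mono local_mass_bound f q y K; simp)
    also have "\<dots> = ennreal (C * (2304 * pi + K) * bergman_norm p f powr q)"
      using C K0 by (simp add: mult.assoc flip: ennreal_mult)
    finally show "(\<integral>\<^sup>+z. ennreal (cmod ((deriv ^^ k) f z) powr q) \<partial>weighted \<mu> (u k) q)
       \<le> ennreal (C * (2304 * pi + K) * bergman_norm p f powr q)" .
  qed
  show "vanishing_carleson k p q (weighted \<mu> (u k) q)"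
    unfolding vanishing_carleson_def
  proof (intro allI impI)
    fix F assume F: "bdd_loc_unif_null p F"
    have "(\<lambda>j. ennreal C * (\<integral>\<^sup>+a. ennreal (y a * local_mass p (F j) a powr (q / p)) \<partial>count_space A)) \<longlonglongrightarrow> ennreal C * 0"
      by (intro ennreal_tendsto_cmult local_mass_vanishing[OF F q y(2) K]) auto
    then have "(\<lambda>j. ennreal C * (\<integral>\<^sup>+a. ennreal (y a * local_mass p (F j) a powr (q / p)) \<partial>count_space A)) \<longlonglongrightarrow> 0"
      by simp
    from tendsto_sandwich[OF _ _ tendsto_const this]
    show "(\<lambda>j. \<integral>\<^sup>+z. ennreal (cmod ((deriv ^^ k) (F j) z) powr q) \<partial>weighted \<mu> (u k) q) \<longlonglongrightarrow> 0"
      using F w by (auto simp: bdd_loc_unif_null_def intro!: always_eventually)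
  qed
qed

lemma carleson_imp_sobolev_carleson:
  assumes \<mu>: "disc_borel_measure \<mu>" and u: "\<And>k. k \<le> n \<Longrightarrow> u k holomorphic_on disc" and q: "0 < q"
    and c: "\<And>k. k \<le> n \<Longrightarrow> carleson k p q (weighted \<mu> (u k) q)"
  shows "sobolev_carleson n u p q \<mu>"
proof -
  have "\<forall>k\<in>{..n}. \<exists>C. C > 0 \<and> (\<forall>f\<in>bergman_space p.
      (\<integral>\<^sup>+z. ennreal (cmod ((deriv ^^ k) f z) powr q) \<partial>weighted \<mu> (u k) q) \<le> ennreal (C * bergman_norm p f powr q))"
    using c unfolding carleson_def by simp
  from bchoice[OF this] obtain C where C: "\<And>k. k \<le> n \<Longrightarrow> C k > 0"
    and le: "\<And>k f. k \<le> n \<Longrightarrow> f \<in> bergman_space p \<Longrightarrow>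
      (\<integral>\<^sup>+z. ennreal (cmod ((deriv ^^ k) f z) powr q) \<partial>weighted \<mu> (u k) q) \<le> ennreal (C k * bergman_norm p f powr q)"
    by auto
  have S: "(\<Sum>k\<le>n. C k) > 0" using C by (intro sum_pos) auto
  show ?thesis
    unfolding sobolev_carleson_def
  proof (intro exI[of _ "real (Suc n) powr q * (\<Sum>k\<le>n. C k)"] conjI ballI)
    show "real (Suc n) powr q * (\<Sum>k\<le>n. C k) > 0" using S by simp
    fix f assume f: "f \<in> bergman_space p"
    then have hol: "f holomorphic_on disc" by (simp add: bergman_space_def)
    have "(\<integral>\<^sup>+z. ennreal (cmod (sobolev_op n u f z) powr q) \<partial>\<mu>)
      \<le> ennreal (real (Suc n) powr q) * (\<Sum>k\<le>n. \<integral>\<^sup>+z. ennreal (cmod ((deriv ^^ k) f z) powr q) \<partial>weighted \<mu> (u k) q)"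
      by (rule nn_integral_sobolev_op_le[OF \<mu> u hol q])
    also have "\<dots> \<le> ennreal (real (Suc n) powr q) * (\<Sum>k\<le>n. ennreal (C k * bergman_norm p f powr q))"
      using le f by (intro mult_left_mono sum_mono) auto
    also have "(\<Sum>k\<le>n. ennreal (C k * bergman_norm p f powr q)) = ennreal ((\<Sum>k\<le>n. C k) * bergman_norm p f powr q)"
      using C by (subst sum_ennreal) (auto simp: sum_distrib_right less_imp_le)
    also have "ennreal (real (Suc n) powr q) * \<dots> = ennreal (real (Suc n) powr q * (\<Sum>k\<le>n. C k) * bergman_norm p f powr q)"
      using S unfolding mult.assoc by (intro ennreal_mult[symmetric]) auto
    finally show "(\<integral>\<^sup>+z. ennreal (cmod (sobolev_op n u f z) powr q) \<partial>\<mu>)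
       \<le> ennreal (real (Suc n) powr q * (\<Sum>k\<le>n. C k) * bergman_norm p f powr q)" .
  qed
qed

lemma vanishing_carleson_imp_vanishing_sobolev_carleson:
  assumes \<mu>: "disc_borel_measure \<mu>" and u: "\<And>k. k \<le> n \<Longrightarrow> u k holomorphic_on disc" and q: "0 < q"
    and c: "\<And>k. k \<le> n \<Longrightarrow> vanishing_carleson k p q (weighted \<mu> (u k) q)"
  shows "vanishing_sobolev_carleson n u p q \<mu>"
  unfolding vanishing_sobolev_carleson_def
proof (intro allI impI)
  fix F assume F: "bdd_loc_unif_null p F"
  then have hol: "F j holomorphic_on disc" for j
    by (simp add: bdd_loc_unif_null_def bergman_space_def)
  let ?I = "\<lambda>k j. \<integral>\<^sup>+z. ennreal (cmod ((deriv ^^ k) (F j) z) powr q) \<partial>weighted \<mu> (u k) q"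
  have lim: "?I k \<longlonglongrightarrow> 0" if "k \<le> n" for k
    using c[OF that] F unfolding vanishing_carleson_def by blast
  have "(\<lambda>j. \<Sum>k\<le>n. ?I k j) \<longlonglongrightarrow> (\<Sum>k\<le>n. 0)"
    using lim by (intro tendsto_sum) auto
  then have "(\<lambda>j. ennreal (real (Suc n) powr q) * (\<Sum>k\<le>n. ?I k j)) \<longlonglongrightarrow> ennreal (real (Suc n) powr q) * (\<Sum>k\<le>n. 0)"
    by (intro ennreal_tendsto_cmult) auto
  then have "(\<lambda>j. ennreal (real (Suc n) powr q) * (\<Sum>k\<le>n. ?I k j)) \<longlonglongrightarrow> 0"
    by simp
  from tendsto_sandwich[OF _ _ tendsto_const this]
  show "(\<lambda>j. \<integral>\<^sup>+z. ennreal (cmod (sobolev_op n u (F j) z) powr q) \<partial>\<mu>) \<longlonglongrightarrow> 0"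
    using nn_integral_sobolev_op_le[OF \<mu> u hol q] by (auto intro!: always_eventually)
qed

text \<open>Balls of one common radius around the points of a compact K stay in the disc, so the
  submean property turns convergence of the integrals to 0 into uniform convergence on K.\<close>

lemma bdd_loc_unif_nullI:
  assumes p: "0 < p" and F: "\<And>j. F j holomorphic_on disc"
    and le: "\<And>j. (\<integral>\<^sup>+z\<in>disc. ennreal (cmod (F j z) powr p) \<partial>lborel) \<le> ennreal (c j)"
    and c: "\<And>j. 0 \<le> c j" "\<And>j. c j \<le> B" and lim: "c \<longlonglongrightarrow> 0"
  shows "bdd_loc_unif_null p F"
  unfolding bdd_loc_unif_null_def
proof (intro conjI allI impI exI)
  note b = bergman_space_boundI[OF p, of 1, OF _ F c(1) le]
  show "F j \<in> bergman_space p" for j using b(1) by simp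
  show "bergman_norm p (F j) \<le> B powr (1 / p)" for j
  proof -
    have "bergman_norm p (F j) \<ge> 0" by (simp add: bergman_norm_def)
    then have "bergman_norm p (F j) \<le> c j powr (1 / p)" using b(2)[of j] by simp
    also have "\<dots> \<le> B powr (1 / p)" using p c by (intro powr_mono2) auto
    finally show ?thesis .
  qed
  fix K assume K: "compact K \<and> K \<subseteq> disc"
  obtain r where r: "r > 0" and sub: "(\<Union>z\<in>K. ball z r) \<subseteq> disc"
    using compact_subset_open_imp_ball_epsilon_subset[of K disc] K by auto
  obtain C where C: "C > 0" and est: "\<And>f z r. f holomorphic_on ball z r \<Longrightarrow> r > 0 \<Longrightarrow>
    ennreal (cmod (f z) powr p) \<le> ennreal (C * r powr (-2)) * (\<integral>\<^sup>+w\<in>ball z r. ennreal (cmod (f w) powr p) \<partial>lborel)"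
    using powr_submean[OF p] by blast
  have pt: "cmod (F j z) \<le> (C * r powr (-2) * c j) powr (1 / p)" if z: "z \<in> K" for j z
  proof -
    have bs: "ball z r \<subseteq> disc" using sub z by auto
    have "ennreal (cmod (F j z) powr p) \<le> ennreal (C * r powr (-2)) * (\<integral>\<^sup>+w\<in>ball z r. ennreal (cmod (F j w) powr p) \<partial>lborel)"
      by (intro est holomorphic_on_subset[OF F bs] r)
    also have "(\<integral>\<^sup>+w\<in>ball z r. ennreal (cmod (F j w) powr p) \<partial>lborel) \<le> (\<integral>\<^sup>+w\<in>disc. ennreal (cmod (F j w) powr p) \<partial>lborel)"
      using bs by (intro nn_integral_mono) (auto simp: indicator_def)
    also note le
    also have "ennreal (C * r powr (-2)) * ennreal (c j) = ennreal (C * r powr (-2) * c j)"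
      using C c by (intro ennreal_mult[symmetric]) auto
    finally have "ennreal (cmod (F j z) powr p) \<le> ennreal (C * r powr (-2) * c j)"
      by (simp add: mult_left_mono)
    then have "cmod (F j z) powr p \<le> C * r powr (-2) * c j"
      using C c by (subst (asm) ennreal_le_iff) auto
    then have "(cmod (F j z) powr p) powr (1 / p) \<le> (C * r powr (-2) * c j) powr (1 / p)"
      using p by (intro powr_mono2) auto
    then show ?thesis using p by (simp add: powr_powr)
  qed
  have "(\<lambda>j. (C * r powr (-2) * c j) powr (1 / p)) \<longlonglongrightarrow> (C * r powr (-2) * 0) powr (1 / p)"
    using p C c by (intro tendsto_powr' tendsto_mult_left lim tendsto_const) auto
  then have lim0: "(\<lambda>j. (C * r powr (-2) * c j) powr (1 / p)) \<longlonglongrightarrow> 0" by simp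
  show "uniform_limit K F (\<lambda>_. 0) sequentially"
    unfolding uniform_limit_iff
  proof (intro allI impI)
    fix e :: real assume "e > 0"
    with lim0 have "\<forall>\<^sub>F j in sequentially. (C * r powr (-2) * c j) powr (1 / p) < e"
      by (rule order_tendstoD(2))
    then show "\<forall>\<^sub>F j in sequentially. \<forall>z\<in>K. dist (F j z) 0 < e"
    proof eventually_elim
      case (elim j)
      then show ?case using order_le_less_trans[OF pt] by simp
    qed
  qed
qed

text \<open>Functions of norm tending to zero form an admissible sequence, so an unbounded operator would
  violate the vanishing condition after rescaling.\<close>

lemma vanishing_sobolev_carleson_imp_sobolev_carleson:
  assumes van: "vanishing_sobolev_carleson n u p q \<mu>" and \<mu>: "disc_borel_measure \<mu>"
    and u: "\<And>k. k \<le> n \<Longrightarrow> u k holomorphic_on disc"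
    and p: "0 < p" and q: "0 < q"
  shows "sobolev_carleson n u p q \<mu>"
proof (rule ccontr)
  let ?I = "\<lambda>f. \<integral>\<^sup>+z. ennreal (cmod (sobolev_op n u f z) powr q) \<partial>\<mu>"
  assume neg: "\<not> sobolev_carleson n u p q \<mu>"
  \<comment> \<open>The failing constants are q-th powers of j + 1, so that the factor 1 / (j + 1)
    in the rescaling below cancels them exactly.\<close>
  have "\<exists>f. f \<in> bergman_space p \<and> ennreal (real (Suc j) powr q * bergman_norm p f powr q) < ?I f" for j
  proof -
    have "real (Suc j) powr q > 0" by simp
    then show ?thesis using neg unfolding sobolev_carleson_def by (meson not_le)
  qed
  then obtain f where f: "\<And>j. f j \<in> bergman_space p"
    and big: "\<And>j. ennreal (real (Suc j) powr q * bergman_norm p (f j) powr q) < ?I (f j)"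
    by metis
  define N where "N = (\<lambda>j. bergman_norm p (f j))"
  have hol: "f j holomorphic_on disc" for j using f by (simp add: bergman_space_def)
  \<comment> \<open>By the local estimate a function of norm 0 vanishes in the disc with all its
    derivatives, so its integral could not be strictly positive.\<close>
  have N: "N j > 0" for j
  proof (rule ccontr)
    assume "\<not> N j > 0"
    moreover have "0 \<le> bergman_norm p (f j)" by (simp add: bergman_norm_def)
    ultimately have N0: "bergman_norm p (f j) = 0" unfolding N_def by linarith
    have z: "(\<integral>\<^sup>+z\<in>disc. ennreal (cmod (f j z) powr p) \<partial>lborel) = 0"
      unfolding nn_integral_bergman_space[OF p f] N0 by simp
    have "sobolev_op n u (f j) z = 0" if zd: "z \<in> disc" for z
    proof -
      have "(deriv ^^ k) (f j) z = 0" for k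
      proof -
        obtain C where "C > 0" and est: "\<And>f z r. f holomorphic_on ball z r \<Longrightarrow> r > 0 \<Longrightarrow>
          ennreal (cmod ((deriv ^^ k) f z) powr p)
            \<le> ennreal (C * r powr (-2 - k * p)) * (\<integral>\<^sup>+w\<in>ball z r. ennreal (cmod (f w) powr p) \<partial>lborel)"
          using higher_deriv_local_estimate[OF p, of k] by blast
        have bs: "ball z (bdist z) \<subseteq> disc"
        proof
          fix w assume "w \<in> ball z (bdist z)"
          then show "w \<in> disc" using bdist_le_dist[of z w] by (simp add: dist_commute)
        qed
        have "(\<integral>\<^sup>+w\<in>ball z (bdist z). ennreal (cmod (f j w) powr p) \<partial>lborel) \<le> (\<integral>\<^sup>+w\<in>disc. ennreal (cmod (f j w) powr p) \<partial>lborel)"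
          using bs by (intro nn_integral_mono) (auto simp: indicator_def)
        then have "(\<integral>\<^sup>+w\<in>ball z (bdist z). ennreal (cmod (f j w) powr p) \<partial>lborel) = 0"
          unfolding z by simp
        then have "ennreal (cmod ((deriv ^^ k) (f j) z) powr p) \<le> 0"
          using est[OF holomorphic_on_subset[OF hol[of j] bs]] zd by simp
        then show ?thesis by simp
      qed
      then show ?thesis by (simp add: sobolev_op_def)
    qed
    then have "?I (f j) = (\<integral>\<^sup>+z. 0 \<partial>\<mu>)"
      by (intro nn_integral_cong) (simp add: space_disc_borel_measure[OF \<mu>])
    then show False using big[of j] by simp
  qed
  \<comment> \<open>The rescaled functions have norm 1 / (j + 1), which tends to 0, while their
    integrals stay at least 1.\<close>
  define t where "t = (\<lambda>j. 1 / (real (Suc j) * N j))"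
  have t: "t j > 0" for j using N[of j] by (simp add: t_def)
  have tN: "t j powr e * N j powr e = real (Suc j) powr (- e)" for j e
  proof -
    have "t j powr e * N j powr e = (t j * N j) powr e"
      using t[of j] N[of j] by (simp add: powr_mult)
    also have "t j * N j = 1 / real (Suc j)"
      unfolding t_def using N[of j] by (simp only: divide_divide_eq_left[symmetric]) simp
    also have "(1 / real (Suc j)) powr e = real (Suc j) powr (- e)"
      by (subst powr_divide) (auto simp: powr_minus_divide)
    finally show ?thesis .
  qed
  define F where "F = (\<lambda>j z. complex_of_real (t j) * f j z)"
  have "bdd_loc_unif_null p F"
  proof (rule bdd_loc_unif_nullI[OF p])
    show "F j holomorphic_on disc" for j
      unfolding F_def by (intro holomorphic_intros hol)
    show "(\<integral>\<^sup>+z\<in>disc. ennreal (cmod (F j z) powr p) \<partial>lborel) \<le> ennreal (pi * real (Suc j) powr (- p))" for j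
    proof -
      have [measurable]: "(\<lambda>z. ennreal (cmod (f j z) powr p) * indicator disc z) \<in> borel_measurable borel"
        by (rule borel_measurable_holomorphic_indicator[OF hol]) simp
      have "(\<integral>\<^sup>+z\<in>disc. ennreal (cmod (F j z) powr p) \<partial>lborel)
        = (\<integral>\<^sup>+z. ennreal (t j powr p) * (ennreal (cmod (f j z) powr p) * indicator disc z) \<partial>lborel)"
        using t[of j] by (intro nn_integral_cong) (simp add: F_def norm_mult powr_mult ennreal_mult mult.assoc)
      also have "\<dots> = ennreal (t j powr p) * ennreal (pi * N j powr p)"
        using nn_integral_bergman_space[OF p f[of j]] by (subst nn_integral_cmult) (auto simp: N_def)
      also have "\<dots> = ennreal (t j powr p * (pi * N j powr p))"
        by (intro ennreal_mult[symmetric]) auto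
      also have "t j powr p * (pi * N j powr p) = pi * real (Suc j) powr (- p)"
        unfolding tN[symmetric] by (simp only: mult_ac)
      finally show ?thesis by simp
    qed
    show "pi * real (Suc j) powr (- p) \<le> pi" for j
    proof -
      have "real (Suc j) powr (- p) \<le> real (Suc j) powr 0" using p by (intro powr_mono) auto
      then show ?thesis by simp
    qed
    have "(\<lambda>j. real (Suc j) powr (- p)) \<longlonglongrightarrow> 0"
      using p by real_asymp
    then have "(\<lambda>j. pi * real (Suc j) powr (- p)) \<longlonglongrightarrow> pi * 0"
      by (rule tendsto_mult_left)
    then show "(\<lambda>j. pi * real (Suc j) powr (- p)) \<longlonglongrightarrow> 0" by simp
  qed auto
  then have "(\<lambda>j. ?I (F j)) \<longlonglongrightarrow> 0"
    using van unfolding vanishing_sobolev_carleson_def by blast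
  then have "\<forall>\<^sub>F j in sequentially. ?I (F j) < 1"
    by (rule order_tendstoD) simp
  from eventually_happens'[OF sequentially_bot this] obtain j where small: "?I (F j) < 1"
    by blast
  have op: "sobolev_op n u (F j) z = complex_of_real (t j) * sobolev_op n u (f j) z" if "z \<in> disc" for z
    unfolding sobolev_op_def F_def
    using higher_deriv_cmult[OF hol that] by (simp add: sum_distrib_left mult_ac)
  have [measurable]: "sobolev_op n u (f j) \<in> borel_measurable \<mu>"
    by (intro measurable_holomorphic_disc[OF \<mu>] holomorphic_sobolev_op u hol)
  have "t j powr q * (real (Suc j) powr q * N j powr q) = real (Suc j) powr q * (t j powr q * N j powr q)"
    by (simp only: mult_ac)
  also have "\<dots> = 1" unfolding tN by (simp flip: powr_add)
  finally have "t j powr q * (real (Suc j) powr q * N j powr q) = 1" .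
  then have "1 = ennreal (t j powr q) * ennreal (real (Suc j) powr q * N j powr q)"
    by (simp flip: ennreal_mult)
  also have "\<dots> \<le> ennreal (t j powr q) * ?I (f j)"
    using big[of j] by (intro mult_left_mono) (auto simp: N_def)
  also have "\<dots> = (\<integral>\<^sup>+z. ennreal (t j powr q) * ennreal (cmod (sobolev_op n u (f j) z) powr q) \<partial>\<mu>)"
    by (rule nn_integral_cmult[symmetric]) measurable
  also have "\<dots> = ?I (F j)"
    using t[of j] by (intro nn_integral_cong)
      (simp add: op space_disc_borel_measure[OF \<mu>] norm_mult powr_mult ennreal_mult)
  finally show False using small by simp
qed

theorem theorem1p2:
  fixes n :: nat and p q :: real
    and u :: "nat \<Rightarrow> complex \<Rightarrow> complex" and \<mu> :: "complex measure"
  assumes "n \<ge> 1" and "0 < q" and "q < p"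
    and "\<And>k. k \<le> n \<Longrightarrow> u k holomorphic_on disc"
    and "disc_borel_measure \<mu>"
  shows "(sobolev_carleson n u p q \<mu> \<longleftrightarrow> vanishing_sobolev_carleson n u p q \<mu>)
       \<and> (vanishing_sobolev_carleson n u p q \<mu> \<longleftrightarrow>
            (\<forall>k\<le>n. carleson k p q (weighted \<mu> (u k) q)))
       \<and> ((\<forall>k\<le>n. carleson k p q (weighted \<mu> (u k) q)) \<longleftrightarrow>
            (\<forall>k\<le>n. vanishing_carleson k p q (weighted \<mu> (u k) q)))"
proof -
  note u = assms(4) and \<mu> = assms(5)
  have p: "0 < p" using assms by simp
  have ac: "carleson k p q (weighted \<mu> (u k) q)" and ad: "vanishing_carleson k p q (weighted \<mu> (u k) q)"
    if "sobolev_carleson n u p q \<mu>" "k \<le> n" for k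
    using sobolev_carleson_imp_weighted[OF that(1) u \<mu> assms(2,3) that(2)] by auto
  have ca: "sobolev_carleson n u p q \<mu>" if "\<forall>k\<le>n. carleson k p q (weighted \<mu> (u k) q)"
    using that by (intro carleson_imp_sobolev_carleson \<mu> u assms(2)) auto
  have db: "vanishing_sobolev_carleson n u p q \<mu>" if "\<forall>k\<le>n. vanishing_carleson k p q (weighted \<mu> (u k) q)"
    using that by (intro vanishing_carleson_imp_vanishing_sobolev_carleson \<mu> u assms(2)) auto
  have ba: "sobolev_carleson n u p q \<mu>" if "vanishing_sobolev_carleson n u p q \<mu>"
    using vanishing_sobolev_carleson_imp_sobolev_carleson[OF that \<mu> u p assms(2)] .
  show ?thesis using ac ad ca db ba by blast
qed

end
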